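(* Let assumptions (A1)--(A4) hold. There exist a unique sequence of symmetric multilinear forms $(\mathcal{T}_k)_{k\ge2}$ with $\mathcal{T}_k\in\mathcal{M}(Y^k,\mathbb{R})$ and a unique sequence of multilinear forms $(\mathcal{R}_k)_{k\ge3}$ with $\mathcal{R}_k\in\mathcal{M}(\mathcal{D}(A)^k,\mathbb{R})$ such that for all $(z_1,z_2)\in Y^2$, $\mathcal{T}_2(z_1,z_2)=\langle z_1,\Pi z_2\rangle$, and such that for all $k\ge3$ and all $(z_1,\dots,z_k)\in\mathcal{D}(A)^k$, $$\sum_{i=1}^k\mathcal{T}_k(z_1,\dots,z_{i-1},A_\Pi z_i,z_{i+1},\dots,z_k)=\frac{1}{2\alpha}\mathcal{R}_k(z_1,\dots,z_k),$$ $$\mathcal{R}_k=2k(k-1)\,\mathrm{Sym}_{1,k-1}(\mathcal{C}_1\otimes\mathcal{G}_{k-1})+\sum_{i=2}^{k-2}\binom ki\,\mathrm{Sym}_{i,k-i}\big((\mathcal{C}_i+i\mathcal{G}_i)\otimes(\mathcal{C}_{k-i}+(k-i)\mathcal{G}_{k-i})\big),$$ where $\mathcal{C}_i(z_1,\dots,z_i)=\mathcal{T}_{i+1}(B,z_1,\dots,z_i)$ for $i=1,\dots,k-2$ and $\mathcal{G}_i(z_1,\dots,z_i)=\frac1i\sum_{j=1}^i\mathcal{T}_i(z_1,\dots,z_{j-1},Nz_j,z_{j+1},\dots,z_i)$ for $i=2,\dots,k-1$.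
   Context: Setting. $V\subset Y\subset V^*$ is a Gelfand triple of real Hilbert spaces with $V$ densely and compactly embedded in $Y$; $\langle\cdot,\cdot\rangle$ is the inner product of $Y$. $a\colon V\times V\to\mathbb{R}$ is a bounded bilinear form such that (A1): there are $\nu>0$, $\lambda\in\mathbb{R}$ with $a(v,v)\ge\nu\|v\|_V^2-\lambda\|v\|_Y^2$ for all $v\in V$. $A$ is the closed operator in $Y$ with $\mathcal{D}(A)=\{v\in V: w\mapsto a(v,w)\text{ is }Y\text{-continuous}\}$, $\langle Av,w\rangle=-a(v,w)$. $\mathcal{D}(A)$ carries the graph norm. $B\in Y$, $\alpha>0$. (A2): $N\in\mathcal{L}(V,Y)\cap\mathcal{L}(\mathcal{D}(A),V)$ and $N^*\in\mathcal{L}(V,Y)$. (A3): with $A_0=A-\lambda I$ if $\lambda>0$ and $A_0=A$ otherwise, $[\mathcal{D}(-A_0),Y]_{1/2}=[\mathcal{D}(-A_0^* ),Y]_{1/2}=V$ (real interpolation with indices $2,\tfrac12$). (A4): there is $F\in\mathcal{L}(Y,\mathbb{R})$ such that the semigroup $e^{(A+BF)t}$ is exponentially stable on $Y$. $B$ is identified with the operator $\mathbb{R}\to Y$, $B^*z=\langle B,z\rangle$. $\Pi\in\mathcal{L}(Y)$ is the unique nonnegative self-adjoint stabilizing solution of the Riccati equation $\langle Az_1,\Pi z_2\rangle+\langle\Pi z_1,Az_2\rangle+\langle z_1,z_2\rangle-\frac1\alpha(B^*\Pi z_1)(B^*\Pi z_2)=0$ for all $z_1,z_2\in\mathcal{D}(A)$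 (it exists by (A4)); $A_\Pi=A-\frac1\alpha BB^*\Pi$ with domain $\mathcal{D}(A)$ generates an exponentially stable semigroup on $Y$. $\mathcal{M}(X^k,\mathbb{R})$ is the set of bounded multilinear forms $X^k\to\mathbb{R}$ (bounded on the product of unit balls of $X$); such a form is symmetric if invariant under all permutations of its arguments. $(\mathcal{T}_1\otimes\mathcal{T}_2)(y_1,\dots,y_{k+\ell})=\mathcal{T}_1(y_1,\dots,y_k)\mathcal{T}_2(y_{k+1},\dots,y_{k+\ell})$. For a multilinear form $\mathcal{T}$ of order $i+j$, $\mathrm{Sym}_{i,j}(\mathcal{T})(z_1,\dots,z_{i+j})=\binom{i+j}{i}^{-1}\sum_{\sigma\in S_{i,j}}\mathcal{T}(z_{\sigma(1)},\dots,z_{\sigma(i+j)})$, where $S_{i,j}$ is the set of permutations $\sigma$ of $\{1,\dots,i+j\}$ with $\sigma(1)<\dots<\sigma(i)$ and $\sigma(i+1)<\dots<\sigma(i+j)$. Empty sums are zero. *)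

theory Defs
  imports "HOL-Analysis.Analysis" "HOL-Combinatorics.Combinatorics"
begin

section \<open>Gelfand triples and the operator of a form\<close>

text \<open>The embedding of \<open>V\<close> into \<open>Y\<close> is an explicit map \<open>emb\<close>. An unbounded operator in \<open>Y\<close> is given
  by its domain, a set, together with a total function whose values are only used on that set.\<close>

definition gelfand_triple ::
  "('v::{real_inner,complete_space} \<Rightarrow> 'y::{real_inner,complete_space}) \<Rightarrow> bool" where
  "gelfand_triple emb \<longleftrightarrow>
     bounded_linear emb \<and> inj emb \<and> closure (range emb) = UNIV \<and>
     compact (closure (emb ` cball 0 1))"

definition V_norm :: "('v::real_normed_vector \<Rightarrow> 'y) \<Rightarrow> 'y \<Rightarrow> real" where
  "V_norm emb z = norm (inv emb z)"

text \<open>For the linear functional \<open>w \<mapsto> a v w\<close>, continuity in the norm of \<open>Y\<close> is written as a bound.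
  The adjoint of an unbounded operator below is treated the same way.\<close>

definition form_dom ::
  "('v \<Rightarrow> 'y::real_normed_vector) \<Rightarrow> ('v \<Rightarrow> 'v \<Rightarrow> real) \<Rightarrow> 'y set" where
  "form_dom emb a = {emb v |v. \<exists>C. \<forall>w. \<bar>a v w\<bar> \<le> C * norm (emb w)}"

definition form_op ::
  "('v \<Rightarrow> 'y::real_inner) \<Rightarrow> ('v \<Rightarrow> 'v \<Rightarrow> real) \<Rightarrow> 'y \<Rightarrow> 'y" where
  "form_op emb a z = (THE y. \<forall>w. inner y (emb w) = - a (inv emb z) w)"

definition graph_norm :: "('y \<Rightarrow> 'y) \<Rightarrow> 'y::real_normed_vector \<Rightarrow> real" where
  "graph_norm T z = norm z + norm (T z)"

definition adj_dom :: "'y set \<Rightarrow> ('y \<Rightarrow> 'y) \<Rightarrow> 'y::real_inner set" where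
  "adj_dom D T = {y. \<exists>C. \<forall>x\<in>D. \<bar>inner (T x) y\<bar> \<le> C * norm x}"

definition adj_op :: "'y set \<Rightarrow> ('y \<Rightarrow> 'y) \<Rightarrow> 'y \<Rightarrow> 'y::real_inner" where
  "adj_op D T y = (THE w. \<forall>x\<in>D. inner (T x) y = inner x w)"

definition shifted_op :: "real \<Rightarrow> ('y \<Rightarrow> 'y) \<Rightarrow> 'y \<Rightarrow> 'y::real_vector" where
  "shifted_op lam A z = (if lam > 0 then A z - lam *\<^sub>R z else A z)"

text \<open>\<open>N\<close> as an operator in \<open>Y\<close> with domain \<open>range emb\<close>.\<close>

definition on_Y :: "('v \<Rightarrow> 'y) \<Rightarrow> ('v \<Rightarrow> 'y) \<Rightarrow> 'y \<Rightarrow> 'y" where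
  "on_Y emb N z = N (inv emb z)"

definition bounded_into ::
  "'y set \<Rightarrow> ('y \<Rightarrow> real) \<Rightarrow> 'y set \<Rightarrow> ('y \<Rightarrow> real) \<Rightarrow> ('y \<Rightarrow> 'y) \<Rightarrow> bool" where
  "bounded_into X nX Z nZ T \<longleftrightarrow> T ` X \<subseteq> Z \<and> (\<exists>C. \<forall>x\<in>X. nZ (T x) \<le> C * nX x)"

section \<open>Real interpolation\<close>

text \<open>The K-method; \<open>q\<close> is the integrability index and \<open>\<theta>\<close> the interpolation parameter.\<close>

definition K_functional ::
  "'y set \<Rightarrow> ('y \<Rightarrow> real) \<Rightarrow> 'y set \<Rightarrow> ('y \<Rightarrow> real) \<Rightarrow> real \<Rightarrow> 'y::plus \<Rightarrow> real" where
  "K_functional X0 n0 X1 n1 t x =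
     Inf {n0 x0 + t * n1 x1 |x0 x1. x0 \<in> X0 \<and> x1 \<in> X1 \<and> x = x0 + x1}"

definition interp_integral ::
  "'y set \<Rightarrow> ('y \<Rightarrow> real) \<Rightarrow> 'y set \<Rightarrow> ('y \<Rightarrow> real) \<Rightarrow> real \<Rightarrow> real \<Rightarrow> 'y::plus \<Rightarrow> ennreal" where
  "interp_integral X0 n0 X1 n1 q \<theta> x =
     (\<integral>\<^sup>+t\<in>{0<..}. ennreal ((t powr (- \<theta>) * K_functional X0 n0 X1 n1 t x) powr q / t) \<partial>lborel)"

definition interp_space ::
  "'y set \<Rightarrow> ('y \<Rightarrow> real) \<Rightarrow> 'y set \<Rightarrow> ('y \<Rightarrow> real) \<Rightarrow> real \<Rightarrow> real \<Rightarrow> 'y::plus set" where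
  "interp_space X0 n0 X1 n1 q \<theta> =
     {x0 + x1 |x0 x1. x0 \<in> X0 \<and> x1 \<in> X1 \<and> interp_integral X0 n0 X1 n1 q \<theta> (x0 + x1) < \<infinity>}"

definition interp_norm ::
  "'y set \<Rightarrow> ('y \<Rightarrow> real) \<Rightarrow> 'y set \<Rightarrow> ('y \<Rightarrow> real) \<Rightarrow> real \<Rightarrow> real \<Rightarrow> 'y::plus \<Rightarrow> real" where
  "interp_norm X0 n0 X1 n1 q \<theta> x = enn2real (interp_integral X0 n0 X1 n1 q \<theta> x) powr (1 / q)"

text \<open>Identities between interpolation spaces are meant up to equivalence of norms.\<close>

definition same_normed_space ::
  "'y set \<Rightarrow> ('y \<Rightarrow> real) \<Rightarrow> 'y set \<Rightarrow> ('y \<Rightarrow> real) \<Rightarrow> bool" where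
  "same_normed_space X nX Z nZ \<longleftrightarrow>
     X = Z \<and> (\<exists>c>0. \<exists>C. \<forall>x\<in>X. c * nZ x \<le> nX x \<and> nX x \<le> C * nZ x)"

section \<open>Semigroups\<close>

definition C0_semigroup :: "(real \<Rightarrow> 'y::real_normed_vector \<Rightarrow>\<^sub>L 'y) \<Rightarrow> bool" where
  "C0_semigroup S \<longleftrightarrow>
     S 0 = id_blinfun \<and> (\<forall>s\<ge>0. \<forall>t\<ge>0. S (s + t) = S s o\<^sub>L S t) \<and>
     (\<forall>x. ((\<lambda>t. S t x) \<longlongrightarrow> x) (at_right 0))"

definition generates ::
  "'y set \<Rightarrow> ('y \<Rightarrow> 'y) \<Rightarrow> (real \<Rightarrow> 'y::real_normed_vector \<Rightarrow>\<^sub>L 'y) \<Rightarrow> bool" where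
  "generates D T S \<longleftrightarrow> C0_semigroup S \<and>
     (\<forall>x y. x \<in> D \<and> T x = y \<longleftrightarrow> ((\<lambda>t. (S t x - x) /\<^sub>R t) \<longlongrightarrow> y) (at_right 0))"

definition exp_stable :: "(real \<Rightarrow> 'y::real_normed_vector \<Rightarrow>\<^sub>L 'y) \<Rightarrow> bool" where
  "exp_stable S \<longleftrightarrow> (\<exists>M. \<exists>\<omega>>0. \<forall>t\<ge>0. norm (S t) \<le> M * exp (- \<omega> * t))"

section \<open>The Riccati equation\<close>

definition closed_loop ::
  "('y \<Rightarrow> 'y) \<Rightarrow> 'y \<Rightarrow> real \<Rightarrow> ('y::real_inner \<Rightarrow>\<^sub>L 'y) \<Rightarrow> 'y \<Rightarrow> 'y" where
  "closed_loop A B \<alpha> P z = A z - ((1 / \<alpha>) * inner B (P z)) *\<^sub>R B"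

definition riccati_solution ::
  "'y set \<Rightarrow> ('y \<Rightarrow> 'y) \<Rightarrow> 'y \<Rightarrow> real \<Rightarrow> ('y::real_inner \<Rightarrow>\<^sub>L 'y) \<Rightarrow> bool" where
  "riccati_solution D A B \<alpha> P \<longleftrightarrow>
     (\<forall>z1\<in>D. \<forall>z2\<in>D. inner (A z1) (P z2) + inner (P z1) (A z2) + inner z1 z2
        - (1 / \<alpha>) * (inner B (P z1) * inner B (P z2)) = 0)"

definition stabilizing_riccati_solution ::
  "'y set \<Rightarrow> ('y \<Rightarrow> 'y) \<Rightarrow> 'y \<Rightarrow> real \<Rightarrow> ('y::real_inner \<Rightarrow>\<^sub>L 'y) \<Rightarrow> bool" where
  "stabilizing_riccati_solution D A B \<alpha> P \<longleftrightarrow>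
     (\<forall>x y. inner (P x) y = inner x (P y)) \<and> (\<forall>x. 0 \<le> inner (P x) x) \<and>
     riccati_solution D A B \<alpha> P \<and>
     (\<exists>S. generates D (closed_loop A B \<alpha> P) S \<and> exp_stable S)"

section \<open>Multilinear forms\<close>

text \<open>A form of order \<open>k\<close> on \<open>X\<close> is a function on lists, of which only the values on \<open>tuples X k\<close>
  matter. List positions count from 0, so argument number \<open>i\<close> is the entry \<open>i - 1\<close>.\<close>

definition tuples :: "'y set \<Rightarrow> nat \<Rightarrow> 'y list set" where
  "tuples X k = {zs. length zs = k \<and> set zs \<subseteq> X}"

definition multilinear_on :: "'y::real_vector set \<Rightarrow> nat \<Rightarrow> ('y list \<Rightarrow> real) \<Rightarrow> bool" where
  "multilinear_on X k T \<longleftrightarrow>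
     (\<forall>zs\<in>tuples X k. \<forall>i<k. \<forall>x\<in>X. \<forall>y\<in>X. \<forall>c d.
        T (zs[i := c *\<^sub>R x + d *\<^sub>R y]) = c * T (zs[i := x]) + d * T (zs[i := y]))"

definition bounded_multilinear_forms ::
  "'y::real_vector set \<Rightarrow> ('y \<Rightarrow> real) \<Rightarrow> nat \<Rightarrow> ('y list \<Rightarrow> real) set" where
  "bounded_multilinear_forms X n k = {T. multilinear_on X k T \<and>
     (\<exists>M. \<forall>zs\<in>tuples X k. (\<forall>z\<in>set zs. n z \<le> 1) \<longrightarrow> \<bar>T zs\<bar> \<le> M)}"

definition symmetric_on :: "'y set \<Rightarrow> nat \<Rightarrow> ('y list \<Rightarrow> real) \<Rightarrow> bool" where
  "symmetric_on X k T \<longleftrightarrow>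
     (\<forall>zs\<in>tuples X k. \<forall>\<sigma>. \<sigma> permutes {..<k} \<longrightarrow> T (permute_list \<sigma> zs) = T zs)"

text \<open>\<open>tensor i S T\<close> is the tensor product of a form \<open>S\<close> of order \<open>i\<close> with \<open>T\<close>.\<close>

definition tensor :: "nat \<Rightarrow> ('y list \<Rightarrow> real) \<Rightarrow> ('y list \<Rightarrow> real) \<Rightarrow> 'y list \<Rightarrow> real" where
  "tensor i S T zs = S (take i zs) * T (drop i zs)"

definition shuffle_perms :: "nat \<Rightarrow> nat \<Rightarrow> (nat \<Rightarrow> nat) set" where
  "shuffle_perms i j = {\<sigma>. \<sigma> permutes {..<i + j} \<and>
     strict_mono_on {..<i} \<sigma> \<and> strict_mono_on {i..<i + j} \<sigma>}"

definition Sym :: "nat \<Rightarrow> nat \<Rightarrow> ('y list \<Rightarrow> real) \<Rightarrow> 'y list \<Rightarrow> real" where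
  "Sym i j T zs =
     (\<Sum>\<sigma>\<in>shuffle_perms i j. T (permute_list \<sigma> zs)) / real ((i + j) choose i)"

definition insert_op :: "('y \<Rightarrow> 'y) \<Rightarrow> nat \<Rightarrow> ('y list \<Rightarrow> real) \<Rightarrow> 'y list \<Rightarrow> real" where
  "insert_op L k T zs = (\<Sum>i<k. T (zs[i := L (zs ! i)]))"

definition form_C :: "'y \<Rightarrow> (nat \<Rightarrow> 'y list \<Rightarrow> real) \<Rightarrow> nat \<Rightarrow> 'y list \<Rightarrow> real" where
  "form_C B T i zs = T (i + 1) (B # zs)"

definition form_G :: "('y \<Rightarrow> 'y) \<Rightarrow> (nat \<Rightarrow> 'y list \<Rightarrow> real) \<Rightarrow> nat \<Rightarrow> 'y list \<Rightarrow> real" where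
  "form_G N T i zs = (1 / real i) * insert_op N i (T i) zs"

definition form_CG ::
  "'y \<Rightarrow> ('y \<Rightarrow> 'y) \<Rightarrow> (nat \<Rightarrow> 'y list \<Rightarrow> real) \<Rightarrow> nat \<Rightarrow> 'y list \<Rightarrow> real" where
  "form_CG B N T i zs = form_C B T i zs + real i * form_G N T i zs"

definition rhs_form ::
  "'y \<Rightarrow> ('y \<Rightarrow> 'y) \<Rightarrow> (nat \<Rightarrow> 'y list \<Rightarrow> real) \<Rightarrow> nat \<Rightarrow> 'y list \<Rightarrow> real" where
  "rhs_form B N T k zs =
     2 * real k * real (k - 1) * Sym 1 (k - 1) (tensor 1 (form_C B T 1) (form_G N T (k - 1))) zs
     + (\<Sum>i = 2..k - 2. real (k choose i) *
          Sym i (k - i) (tensor i (form_CG B N T i) (form_CG B N T (k - i))) zs)"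

definition lyapunov_system ::
  "'y set \<Rightarrow> ('y \<Rightarrow> 'y) \<Rightarrow> ('y \<Rightarrow> 'y) \<Rightarrow> 'y \<Rightarrow> real \<Rightarrow> ('y::real_inner \<Rightarrow>\<^sub>L 'y) \<Rightarrow>
   (nat \<Rightarrow> 'y list \<Rightarrow> real) \<Rightarrow> (nat \<Rightarrow> 'y list \<Rightarrow> real) \<Rightarrow> bool" where
  "lyapunov_system D A N B \<alpha> P T R \<longleftrightarrow>
     (\<forall>k\<ge>2. T k \<in> bounded_multilinear_forms UNIV norm k \<and> symmetric_on UNIV k (T k)) \<and>
     (\<forall>k\<ge>3. R k \<in> bounded_multilinear_forms D (graph_norm A) k) \<and>
     (\<forall>z1 z2. T 2 [z1, z2] = inner z1 (P z2)) \<and>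
     (\<forall>k\<ge>3. \<forall>zs\<in>tuples D k.
        insert_op (closed_loop A B \<alpha> P) k (T k) zs = 1 / (2 * \<alpha>) * R k zs \<and>
        R k zs = rhs_form B N T k zs)"

end

theory Submission
  imports Defs
begin

text \<open>The solution is \<open>T\<^sub>k(z) = -1/(2\<alpha>) \<integral> R\<^sub>k(S(t)z\<^sub>1, \<dots>, S(t)z\<^sub>k) dt\<close> over \<open>(0, \<infinity>)\<close>, where \<open>S\<close> is the
  exponentially stable closed-loop semigroup and \<open>R\<^sub>k\<close> depends on forms of lower order only. Each
  summand of \<open>R\<^sub>k\<close> contains \<open>N\<close> at most twice and on different arguments, so along the flow \<open>R\<^sub>k\<close> is
  dominated by the squared \<open>V\<close>-norms of the arguments. By coercivity of \<open>a\<close>, these are integrable in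
  time with a bound by the norm of \<open>Y\<close> alone. So \<open>T\<^sub>k\<close>, first defined on \<open>D\<close>, is bounded in the norm of \<open>Y\<close>
  and extends by density of \<open>D\<close>, which is read off the interpolation identity (A3). The equation is the
  derivative of \<open>T\<^sub>k(S(t)z)\<close> at \<open>t = 0\<close>. The difference of two solutions is constant along the flow, which
  tends to 0, so it vanishes.\<close>

section \<open>Multilinear forms on tuples\<close>

text \<open>The obstacle is that \<open>N\<close> is unbounded on \<open>Y\<close>:
  \<open>R k\<close> makes sense only on \<open>D\<close>, yet \<open>T k\<close> must be bounded in
  the norm of \<open>Y\<close>. By (A1), \<nu> times the squared \<open>V\<close>-norm is at most
  \<open>lam * (norm z)\<^sup>2 - inner (A z) z\<close>, and the closed loop \<open>L\<close>
  changes \<open>A\<close> by a bounded operator of rank one. Hence \<open>(norm (NY z))\<^sup>2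
  \<le> J * (norm z)\<^sup>2 - K * inner (L z) z\<close>. Along an orbit
  \<open>- 2 * inner (L z) z\<close> is minus the derivative of the squared norm, so its time
  integral is at most the initial squared norm, however large \<open>L z\<close> is. This
  inequality, density of \<open>D\<close> and exponential decay are all that the flow argument takes
  from the form \<open>a\<close>. \<open>N\<close> occurs at most twice because
  \<open>form_C\<close> contains none and each summand of \<open>form_G\<close> contains one. The
  recursion is well founded because \<open>form_C\<close>, which raises the order by one, stops at
  index \<open>k - 2\<close>: the products of C_1 with C_{k-1} stand on the left instead, where
  C_1(z) = \<open>inner B (P z)\<close> turns \<open>A\<close> into the closed loop.\<close>

abbreviation tup :: "nat \<Rightarrow> (nat \<Rightarrow> 'y) \<Rightarrow> 'y list" where
  "tup k x \<equiv> map x [0..<k]"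

lemma tup_in_tuples [simp]: "tup k x \<in> tuples X k \<longleftrightarrow> (\<forall>i<k. x i \<in> X)"
  by (auto simp: tuples_def)

lemma tup_nth: "zs \<in> tuples X k \<Longrightarrow> tup k ((!) zs) = zs"
  by (simp add: tuples_def list_eq_iff_nth_eq)

text \<open>Lists are traded for families indexed by naturals: overwriting an entry becomes a
  function update, and limits can be taken slot by slot.\<close>

lemma tup_update [simp]: "i < k \<Longrightarrow> (tup k x)[i := u] = tup k (x(i := u))"
  by (simp add: list_eq_iff_nth_eq nth_list_update)

lemma tuples_nth: "zs \<in> tuples X k \<Longrightarrow> i < k \<Longrightarrow> zs ! i \<in> X"
  by (auto simp: tuples_def)

lemma tuples_mono: "X \<subseteq> Y \<Longrightarrow> zs \<in> tuples X k \<Longrightarrow> zs \<in> tuples Y k"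
  by (auto simp: tuples_def)

lemma tuples_update: "zs \<in> tuples X k \<Longrightarrow> u \<in> X \<Longrightarrow> zs[i := u] \<in> tuples X k"
  using set_update_subset_insert[of zs i u] by (auto simp: tuples_def)

lemma tuples_permute_list:
  "zs \<in> tuples X k \<Longrightarrow> \<sigma> permutes {..<k} \<Longrightarrow> permute_list \<sigma> zs \<in> tuples X k"
  by (auto simp: tuples_def)

lemma multilinear_onD:
  assumes "multilinear_on X k T" "zs \<in> tuples X k" "i < k" "x \<in> X" "y \<in> X"
  shows "T (zs[i := c *\<^sub>R x + d *\<^sub>R y]) = c * T (zs[i := x]) + d * T (zs[i := y])"
  using assms by (auto simp: multilinear_on_def)

lemma multilinear_on_subset:
  "multilinear_on Y k T \<Longrightarrow> X \<subseteq> Y \<Longrightarrow> multilinear_on X k T"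
  unfolding multilinear_on_def using tuples_mono by (metis subsetD)

lemma multilinear_on_scale:
  assumes "multilinear_on X k T" "zs \<in> tuples X k" "i < k" "x \<in> X"
  shows "T (zs[i := c *\<^sub>R x]) = c * T (zs[i := x])"
  using multilinear_onD[OF assms assms(4), of c 0] by simp

lemma multilinear_on_diff:
  assumes "multilinear_on X k T" "zs \<in> tuples X k" "i < k" "x \<in> X" "y \<in> X"
  shows "T (zs[i := x - y]) = T (zs[i := x]) - T (zs[i := y])"
  using multilinear_onD[OF assms, of 1 "-1"] by simp

lemma multilinear_on_zero:
  assumes "multilinear_on X k T" "zs \<in> tuples X k" "i < k" "zs ! i = 0"
  shows "T zs = 0"
proof -
  have "zs ! i \<in> X" using assms(2,3) by (rule tuples_nth)
  \<comment> \<open>The zero is written as \<open>0\<close> times an entry, since only entries are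
    known to lie in \<open>X\<close>.\<close>
  then have "T (zs[i := 0 *\<^sub>R zs ! i]) = 0"
    using multilinear_on_scale[OF assms(1-3), of "zs ! i" 0] by simp
  then show ?thesis
    by (metis assms(4) list_update_id scaleR_zero_left)
qed

lemma multilinear_on_scale_all:
  assumes T: "multilinear_on X k T" and X: "subspace X" and x: "\<And>i. i < k \<Longrightarrow> x i \<in> X"
  shows "T (tup k (\<lambda>i. c i *\<^sub>R x i)) = (\<Prod>i<k. c i) * T (tup k x)"
proof -
  \<comment> \<open>Only the first \<open>m\<close> slots are scaled; the induction on
    \<open>m\<close> treats one slot at a time.\<close>
  have "m \<le> k \<Longrightarrow> T (tup k (\<lambda>i. if i < m then c i *\<^sub>R x i else x i)) = (\<Prod>i<m. c i) * T (tup k x)" for m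
  proof (induction m)
    case 0
    then show ?case by simp
  next
    case (Suc m)
    let ?g = "\<lambda>i. if i < m then c i *\<^sub>R x i else x i"
    have g: "tup k ?g \<in> tuples X k" using x X by (auto simp: subspace_scale)
    have "(\<lambda>i. if i < Suc m then c i *\<^sub>R x i else x i) = ?g(m := c m *\<^sub>R x m)"
      by (auto simp: fun_eq_iff less_Suc_eq)
    moreover have "?g(m := x m) = ?g" by (auto simp: fun_eq_iff)
    ultimately show ?case
      using multilinear_on_scale[OF T g, of m "x m" "c m"] Suc x by simp
  qed
  moreover have "tup k (\<lambda>i. if i < k then c i *\<^sub>R x i else x i) = tup k (\<lambda>i. c i *\<^sub>R x i)"
    by (intro map_cong) auto
  ultimately show ?thesis by (metis order_refl)
qed

text \<open>The families that take \<open>y\<close> before slot \<open>i\<close> and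
  \<open>x\<close> from \<open>i\<close> on lead from \<open>x\<close> to \<open>y\<close> as
  \<open>i\<close> runs from 0 to \<open>k\<close>. Neighbours differ in one slot, where linearity
  applies.\<close>

lemma multilinear_on_telescope:
  assumes T: "multilinear_on X k T" and X: "subspace X"
    and x: "\<And>i. i < k \<Longrightarrow> x i \<in> X" and y: "\<And>i. i < k \<Longrightarrow> y i \<in> X"
  shows "T (tup k x) - T (tup k y) =
    (\<Sum>i<k. T (tup k (\<lambda>j. if j < i then y j else if j = i then x i - y i else x j)))"
proof -
  let ?m = "\<lambda>i j. if j < i then y j else x j"
  have "T (tup k (\<lambda>j. if j < i then y j else if j = i then x i - y i else x j))
      = T (tup k (?m i)) - T (tup k (?m (Suc i)))" if "i < k" for i
  proof -
    have "(\<lambda>j. if j < i then y j else if j = i then x i - y i else x j) = (?m i)(i := x i - y i)"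
      "(?m i)(i := x i) = ?m i" "(?m i)(i := y i) = ?m (Suc i)"
      by (auto simp: fun_eq_iff less_Suc_eq)
    moreover have "tup k (?m i) \<in> tuples X k" using x y by auto
    ultimately show ?thesis
      using multilinear_on_diff[OF T, of "tup k (?m i)" i "x i" "y i"] that x y by simp
  qed
  then have "(\<Sum>i<k. T (tup k (\<lambda>j. if j < i then y j else if j = i then x i - y i else x j)))
      = (\<Sum>i<k. T (tup k (?m i)) - T (tup k (?m (Suc i))))"
    by (intro sum.cong) auto
  also have "\<dots> = T (tup k (?m 0)) - T (tup k (?m k))"
    using sum_lessThan_telescope'[of "\<lambda>i. T (tup k (?m i))" k] by simp
  also have "tup k (?m k) = tup k y" by (auto simp: list_eq_iff_nth_eq)
  finally show ?thesis by simp
qed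

text \<open>Instances are \<open>norm\<close> on \<open>UNIV\<close> and on \<open>D\<close> and,
  later, the graph norm of the generator on \<open>D\<close>. By \<open>norm_le\<close>,
  \<open>n\<close> vanishes only at 0, so nonzero arguments can be normalized.\<close>

locale normed_domain =
  fixes X :: "'y::real_normed_vector set" and n :: "'y \<Rightarrow> real"
  assumes subspace: "subspace X"
    and n_scale: "x \<in> X \<Longrightarrow> n (c *\<^sub>R x) = \<bar>c\<bar> * n x"
    and n_triangle: "x \<in> X \<Longrightarrow> y \<in> X \<Longrightarrow> n (x + y) \<le> n x + n y"
    and norm_le: "x \<in> X \<Longrightarrow> norm x \<le> n x"
begin

lemma n_nonneg: "x \<in> X \<Longrightarrow> 0 \<le> n x"
  using norm_le[of x] norm_ge_zero[of x] by linarith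

text \<open>By homogeneity it suffices to know the form on unit balls. Slot \<open>i\<close> is
  normalized by its own size and the others by a common radius, so the estimate stays linear in slot
  \<open>i\<close> with a constant independent of the arguments.\<close>

lemma slot_bound:
  assumes T: "T \<in> bounded_multilinear_forms X n k"
  obtains C where "C \<ge> 0"
    "\<forall>x i. (\<forall>j<k. x j \<in> X) \<longrightarrow> i < k \<longrightarrow> (\<forall>j<k. j \<noteq> i \<longrightarrow> n (x j) \<le> r)
      \<longrightarrow> \<bar>T (tup k x)\<bar> \<le> C * n (x i)"
proof -
  obtain M where ml: "multilinear_on X k T"
    and M: "\<And>zs. zs \<in> tuples X k \<Longrightarrow> (\<And>z. z \<in> set zs \<Longrightarrow> n z \<le> 1) \<Longrightarrow> \<bar>T zs\<bar> \<le> M"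
    using T unfolding bounded_multilinear_forms_def by blast
  \<comment> \<open>At least 1, so that division by \<open>s\<close> is possible also when
    \<open>r\<close> is not positive.\<close>
  define s where "s = max r 1"
  have s: "s \<ge> 1" "s \<ge> r" by (auto simp: s_def)
  have main: "\<bar>T (tup k x)\<bar> \<le> (\<bar>M\<bar> * s ^ (k - 1)) * n (x i)"
    if x: "\<And>j. j < k \<Longrightarrow> x j \<in> X" and i: "i < k" and r: "\<And>j. j < k \<Longrightarrow> j \<noteq> i \<Longrightarrow> n (x j) \<le> r" for x i
  proof (cases "x i = 0")
    case True
    then have "T (tup k x) = 0"
      using multilinear_on_zero[OF ml, of "tup k x" i] x i by simp
    then show ?thesis using s n_nonneg[OF x[OF i]] by simp
  next
    case False
    have pos: "n (x i) > 0"
      using False norm_le[OF x[OF i]] by (meson less_le_trans zero_less_norm_iff)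
    define c where "c j = (if j = i then n (x i) else s)" for j
    have c: "c j > 0" for j using pos s by (auto simp: c_def)
    let ?u = "\<lambda>j. (1 / c j) *\<^sub>R x j"
    have u: "\<And>j. j < k \<Longrightarrow> ?u j \<in> X" using x subspace by (auto simp: subspace_scale)
    have "n (?u j) \<le> 1" if j: "j < k" for j
    proof -
      have "n (x j) \<le> c j" using r[OF j] s by (auto simp: c_def)
      moreover have "n (?u j) = n (x j) / c j" using n_scale[OF x[OF j], of "1 / c j"] c[of j] by simp
      ultimately show ?thesis using c[of j] by simp
    qed
    then have "\<bar>T (tup k ?u)\<bar> \<le> M" using u by (intro M) auto
    then have bd: "\<bar>T (tup k ?u)\<bar> \<le> \<bar>M\<bar>" by linarith
    have "c j *\<^sub>R ?u j = x j" for j using c[of j] by simp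
    then have "tup k (\<lambda>j. c j *\<^sub>R ?u j) = tup k x" by simp
    then have "T (tup k x) = (\<Prod>j<k. c j) * T (tup k ?u)"
      using multilinear_on_scale_all[OF ml subspace, of ?u c] u by (simp only:)
    also have "(\<Prod>j<k. c j) = c i * (\<Prod>j\<in>{..<k} - {i}. c j)"
      using i by (intro prod.remove) auto
    also have "(\<Prod>j\<in>{..<k} - {i}. c j) = (\<Prod>j\<in>{..<k} - {i}. s)"
      by (intro prod.cong) (auto simp: c_def)
    also have "\<dots> = s ^ (k - 1)" using i by simp
    finally have "\<bar>T (tup k x)\<bar> = (n (x i) * s ^ (k - 1)) * \<bar>T (tup k ?u)\<bar>"
      using pos s by (simp add: c_def abs_mult)
    also have "\<dots> \<le> (n (x i) * s ^ (k - 1)) * \<bar>M\<bar>"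
      using bd pos s by (intro mult_left_mono) auto
    finally show ?thesis by (simp add: mult_ac)
  qed
  show thesis by (rule that[of "\<bar>M\<bar> * s ^ (k - 1)"]) (use s main in auto)
qed

text \<open>Each term of the telescoping sum carries the difference \<open>x i - y i\<close> in one
  slot and entries of size at most \<open>r\<close> elsewhere, which is the situation of
  \<open>slot_bound\<close>.\<close>

lemma locally_Lipschitz:
  assumes T: "T \<in> bounded_multilinear_forms X n k"
  obtains C where "C \<ge> 0"
    "\<forall>x y. (\<forall>j<k. x j \<in> X \<and> y j \<in> X \<and> n (x j) \<le> r \<and> n (y j) \<le> r)
      \<longrightarrow> \<bar>T (tup k x) - T (tup k y)\<bar> \<le> C * (\<Sum>i<k. n (x i - y i))"
proof -
  have ml: "multilinear_on X k T" using T by (auto simp: bounded_multilinear_forms_def)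
  obtain C where C: "C \<ge> 0"
    "\<forall>x i. (\<forall>j<k. x j \<in> X) \<longrightarrow> i < k \<longrightarrow> (\<forall>j<k. j \<noteq> i \<longrightarrow> n (x j) \<le> r)
      \<longrightarrow> \<bar>T (tup k x)\<bar> \<le> C * n (x i)"
    using slot_bound[OF T, of r] by blast
  show thesis
  proof (rule that[OF C(1)], intro allI impI)
    fix x y assume *: "\<forall>j<k. x j \<in> X \<and> y j \<in> X \<and> n (x j) \<le> r \<and> n (y j) \<le> r"
    let ?m = "\<lambda>i j. if j < i then y j else if j = i then x i - y i else x j"
    have "\<bar>T (tup k x) - T (tup k y)\<bar> = \<bar>\<Sum>i<k. T (tup k (?m i))\<bar>"
      using * multilinear_on_telescope[OF ml subspace, of x y] by auto
    also have "\<dots> \<le> (\<Sum>i<k. \<bar>T (tup k (?m i))\<bar>)" by (rule sum_abs)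
    also have "\<dots> \<le> (\<Sum>i<k. C * n (x i - y i))"
    proof (rule sum_mono)
      fix i assume i: "i \<in> {..<k}"
      have "\<bar>T (tup k (?m i))\<bar> \<le> C * n (?m i i)"
        using * i by (intro C(2)[rule_format]) (auto simp: subspace_diff[OF subspace])
      then show "\<bar>T (tup k (?m i))\<bar> \<le> C * n (x i - y i)" by simp
    qed
    finally show "\<bar>T (tup k x) - T (tup k y)\<bar> \<le> C * (\<Sum>i<k. n (x i - y i))"
      by (simp add: sum_distrib_left)
  qed
qed

text \<open>Neither family is assumed to converge in \<open>X\<close>. This serves the extension by
  density, where the common limit may lie outside the domain of the form.\<close>

lemma tendsto_form_diff:
  assumes T: "T \<in> bounded_multilinear_forms X n k"
    and ev: "\<And>i. i < k \<Longrightarrow> \<forall>\<^sub>F h in F. x h i \<in> X \<and> y h i \<in> X \<and> n (x h i) \<le> r \<and> n (y h i) \<le> r"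
    and lim: "\<And>i. i < k \<Longrightarrow> ((\<lambda>h. n (x h i - y h i)) \<longlongrightarrow> 0) F"
  shows "((\<lambda>h. T (tup k (x h)) - T (tup k (y h))) \<longlongrightarrow> 0) F"
proof -
  obtain C where C: "C \<ge> 0"
    "\<forall>x y. (\<forall>j<k. x j \<in> X \<and> y j \<in> X \<and> n (x j) \<le> r \<and> n (y j) \<le> r)
      \<longrightarrow> \<bar>T (tup k x) - T (tup k y)\<bar> \<le> C * (\<Sum>i<k. n (x i - y i))"
    using locally_Lipschitz[OF T, of r] by blast
  have "\<forall>\<^sub>F h in F. \<forall>i\<in>{..<k}. x h i \<in> X \<and> y h i \<in> X \<and> n (x h i) \<le> r \<and> n (y h i) \<le> r"
    using ev by (intro eventually_ball_finite) auto
  then have "\<forall>\<^sub>F h in F. norm (T (tup k (x h)) - T (tup k (y h))) \<le> C * (\<Sum>i<k. n (x h i - y h i))"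
    by eventually_elim (auto intro!: C(2)[rule_format])
  moreover have "((\<lambda>h. C * (\<Sum>i<k. n (x h i - y h i))) \<longlongrightarrow> C * (\<Sum>i<k. 0)) F"
    using lim by (intro tendsto_intros) auto
  ultimately show ?thesis by (auto intro: Lim_null_comparison)
qed

lemma tendsto_form:
  assumes T: "T \<in> bounded_multilinear_forms X n k"
    and x: "\<And>i. i < k \<Longrightarrow> \<forall>\<^sub>F h in F. x h i \<in> X" and z: "\<And>i. i < k \<Longrightarrow> z i \<in> X"
    and lim: "\<And>i. i < k \<Longrightarrow> ((\<lambda>h. n (x h i - z i)) \<longlongrightarrow> 0) F"
  shows "((\<lambda>h. T (tup k (x h))) \<longlongrightarrow> T (tup k z)) F"
proof -
  \<comment> \<open>Dominates every \<open>n (z i) + 1\<close>, which bounds \<open>x h i\<close>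
    once its distance to \<open>z i\<close> is below 1.\<close>
  define r where "r = (\<Sum>i<k. n (z i) + 1)"
  have r: "n (z i) + 1 \<le> r" if "i < k" for i
    unfolding r_def using that z n_nonneg by (intro member_le_sum) (auto intro: add_nonneg_nonneg)
  have "\<forall>\<^sub>F h in F. x h i \<in> X \<and> z i \<in> X \<and> n (x h i) \<le> r \<and> n (z i) \<le> r" if i: "i < k" for i
  proof -
    have "\<forall>\<^sub>F h in F. n (x h i - z i) < 1" using lim[OF i] by (rule order_tendstoD) simp
    with x[OF i] show ?thesis
    proof eventually_elim
      case (elim h)
      have "n (x h i) \<le> n (x h i - z i) + n (z i)"
        using n_triangle[of "x h i - z i" "z i"] elim z[OF i] by (simp add: subspace_diff[OF subspace])
      then show ?case using r[OF i] elim z[OF i] by auto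
    qed
  qed
  from tendsto_form_diff[OF T this lim] show ?thesis
    by (simp add: LIM_zero_iff)
qed

end

global_interpretation normed_UNIV: normed_domain UNIV norm
  by unfold_locales (auto simp: norm_triangle_ineq)

lemma normed_domain_norm: "subspace X \<Longrightarrow> normed_domain X norm"
  by unfold_locales (auto simp: norm_triangle_ineq)

text \<open>The scaling function \<open>q\<close> stands for the inverse of an increment, so that one-sided and
  two-sided difference quotients are covered at once.\<close>

lemma tendsto_form_difference_quotient:
  fixes x :: "'a \<Rightarrow> nat \<Rightarrow> 'y::real_normed_vector"
  assumes T: "T \<in> bounded_multilinear_forms UNIV norm k"
    and x: "\<And>i. i < k \<Longrightarrow> ((\<lambda>h. x h i) \<longlongrightarrow> z i) F"
    and d: "\<And>i. i < k \<Longrightarrow> ((\<lambda>h. q h *\<^sub>R (x h i - z i)) \<longlongrightarrow> d i) F"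
  shows "((\<lambda>h. q h * (T (tup k (x h)) - T (tup k z))) \<longlongrightarrow> (\<Sum>i<k. T (tup k (z(i := d i))))) F"
proof -
  have ml: "multilinear_on UNIV k T" using T by (auto simp: bounded_multilinear_forms_def)
  let ?m = "\<lambda>h i u j. if j < i then z j else if j = i then u else x h j"
  \<comment> \<open>Each telescoping term has an increment in slot \<open>i\<close> alone, so the
    factor \<open>q h\<close> is absorbed there and turns it into a difference quotient.\<close>
  have eq: "q h * T (tup k (?m h i (x h i - z i))) = T (tup k (?m h i (q h *\<^sub>R (x h i - z i))))"
    if "i < k" for h i
  proof -
    have "(?m h i 0)(i := u) = ?m h i u" for u by (auto simp: fun_eq_iff)
    then show ?thesis
      using multilinear_on_scale[OF ml, of "tup k (?m h i 0)" i "x h i - z i" "q h"] that by simp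
  qed
  have "q h * (T (tup k (x h)) - T (tup k z)) = (\<Sum>i<k. T (tup k (?m h i (q h *\<^sub>R (x h i - z i)))))" for h
    using multilinear_on_telescope[OF ml, of "x h" z] eq
    by (simp add: sum_distrib_left)
  moreover have "((\<lambda>h. T (tup k (?m h i (q h *\<^sub>R (x h i - z i))))) \<longlongrightarrow> T (tup k (z(i := d i)))) F"
    if i: "i < k" for i
  proof (rule normed_UNIV.tendsto_form[OF T])
    fix j assume j: "j < k"
    show "((\<lambda>h. norm ((if j < i then z j else if j = i then q h *\<^sub>R (x h i - z i) else x h j) - (z(i := d i)) j)) \<longlongrightarrow> 0) F"
      using d[OF i] x[OF j] by (cases "j < i"; cases "j = i")
        (simp_all add: tendsto_norm_zero_iff LIM_zero_iff)
  qed auto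
  ultimately show ?thesis
    by (simp only:) (intro tendsto_sum, simp)
qed

subsection \<open>Extension by density\<close>

text \<open>Local Lipschitz continuity makes the values along approximating sequences Cauchy, with a
  limit independent of the sequence. Identities then pass to the limit with approximants chosen to
  suit each of them.\<close>

lemma extend_form:
  fixes D :: "'y::real_normed_vector set"
  assumes D: "subspace D" and dense: "closure D = UNIV"
    and T0: "T0 \<in> bounded_multilinear_forms D norm k" and sym: "symmetric_on D k T0"
  obtains T where "T \<in> bounded_multilinear_forms UNIV norm k" "symmetric_on UNIV k T"
    "\<And>zs. zs \<in> tuples D k \<Longrightarrow> T zs = T0 zs"
proof -
  interpret normed_domain D norm using D by (rule normed_domain_norm)
  have ml0: "multilinear_on D k T0" using T0 by (auto simp: bounded_multilinear_forms_def)
  have "\<exists>f. (\<forall>n::nat. f n \<in> D) \<and> f \<longlonglongrightarrow> z \<and> (z \<in> D \<longrightarrow> f = (\<lambda>_. z))" for z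
  proof (cases "z \<in> D")
    case False
    then show ?thesis using dense by (metis UNIV_I closure_sequential)
  qed (auto intro!: exI[of _ "\<lambda>_. z"])
  then obtain d where d: "\<And>z n. d z n \<in> D" "\<And>z. d z \<longlonglongrightarrow> z" "\<And>z. z \<in> D \<Longrightarrow> d z = (\<lambda>_. z)"
    by metis
  have bdd: "\<exists>r. \<forall>n. \<forall>i<k. norm (x i n) \<le> r" if "\<And>i. i < k \<Longrightarrow> (x i) \<longlonglongrightarrow> z i"
    for x :: "nat \<Rightarrow> nat \<Rightarrow> 'y" and z
  proof -
    have "\<exists>b\<ge>0. \<forall>n. norm (x i n) \<le> b" if "i < k" for i
      using convergent_imp_Bseq[of "x i"] \<open>i < k \<Longrightarrow> (x i) \<longlonglongrightarrow> z i\<close> that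
      by (meson BseqE convergentI less_imp_le)
    then obtain b where b: "\<And>i. i < k \<Longrightarrow> b i \<ge> 0 \<and> (\<forall>n. norm (x i n) \<le> b i)" by metis
    have "norm (x i n) \<le> (\<Sum>i<k. b i)" if i: "i < k" for i n
    proof -
      have "b i \<le> (\<Sum>i<k. b i)" using i b by (intro member_le_sum) auto
      then show ?thesis using b[OF i] by (meson order_trans)
    qed
    then show ?thesis by blast
  qed
  have diff: "(\<lambda>n. T0 (tup k (\<lambda>i. x i n)) - T0 (tup k (\<lambda>i. y i n))) \<longlonglongrightarrow> 0"
    if x: "\<And>i. i < k \<Longrightarrow> x i \<longlonglongrightarrow> z i" and y: "\<And>i. i < k \<Longrightarrow> y i \<longlonglongrightarrow> z i"
      and D: "\<And>i n. i < k \<Longrightarrow> x i n \<in> D" "\<And>i n. i < k \<Longrightarrow> y i n \<in> D" for x y z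
  proof -
    obtain r1 r2 where r: "\<forall>n. \<forall>i<k. norm (x i n) \<le> r1" "\<forall>n. \<forall>i<k. norm (y i n) \<le> r2"
      using bdd[of x z] bdd[of y z] x y by metis
    show ?thesis
    proof (rule tendsto_form_diff[OF T0, where r = "max r1 r2"])
      fix i assume i: "i < k"
      show "\<forall>\<^sub>F n in sequentially. x i n \<in> D \<and> y i n \<in> D \<and> norm (x i n) \<le> max r1 r2 \<and> norm (y i n) \<le> max r1 r2"
        using r D i by (auto intro!: always_eventually simp: le_max_iff_disj)
      show "(\<lambda>n. norm (x i n - y i n)) \<longlonglongrightarrow> 0"
        using tendsto_diff[OF x[OF i] y[OF i]] by (simp add: tendsto_norm_zero_iff)
    qed
  qed
  have Cauchy: "Cauchy (\<lambda>n. T0 (tup k (\<lambda>i. d (z i) n)))" for z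
  proof -
    obtain r where r: "\<forall>n. \<forall>i<k. norm (d (z i) n) \<le> r"
      using bdd[of "\<lambda>i. d (z i)" z] d by auto
    obtain C where C: "C \<ge> 0"
      "\<forall>x y. (\<forall>j<k. x j \<in> D \<and> y j \<in> D \<and> norm (x j) \<le> r \<and> norm (y j) \<le> r)
      \<longrightarrow> \<bar>T0 (tup k x) - T0 (tup k y)\<bar> \<le> C * (\<Sum>i<k. norm (x i - y i))"
      using locally_Lipschitz[OF T0, of r] by blast
    show ?thesis
    proof (rule CauchyI)
      fix e :: real assume e: "e > 0"
      \<comment> \<open>The added ones exclude a zero denominator and keep the final inequality
        strict, also for \<open>C = 0\<close> or \<open>k = 0\<close>.\<close>
      define e' where "e' = e / ((C + 1) * (real k + 1))"
      have e': "e' > 0" using e C by (simp add: e'_def)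
      have "\<forall>\<^sub>F n in sequentially. norm (d w n - w) < e' / 2" for w
        using tendstoD[OF d(2), of "e' / 2" w] e' by (simp add: dist_norm)
      then have "\<forall>\<^sub>F n in sequentially. \<forall>i\<in>{..<k}. norm (d (z i) n - z i) < e' / 2"
        by (intro eventually_ball_finite) auto
      then obtain m where m: "\<And>n i. n \<ge> m \<Longrightarrow> i < k \<Longrightarrow> norm (d (z i) n - z i) < e' / 2"
        by (auto simp: eventually_sequentially)
      have "norm (T0 (tup k (\<lambda>i. d (z i) p)) - T0 (tup k (\<lambda>i. d (z i) q))) < e"
        if "p \<ge> m" "q \<ge> m" for p q
      proof -
        have "\<bar>T0 (tup k (\<lambda>i. d (z i) p)) - T0 (tup k (\<lambda>i. d (z i) q))\<bar>
            \<le> C * (\<Sum>i<k. norm (d (z i) p - d (z i) q))"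
          using r d by (intro C(2)[rule_format]) auto
        also have "\<dots> \<le> C * (\<Sum>i<k. e')"
        proof (intro mult_left_mono sum_mono C(1))
          fix i assume "i \<in> {..<k}"
          then show "norm (d (z i) p - d (z i) q) \<le> e'"
            using m[of p i] m[of q i] that norm_triangle_ineq4[of "d (z i) p - z i" "d (z i) q - z i"] by simp
        qed
        also have "\<dots> = C * real k * e'" by simp
        also have "\<dots> < (C + 1) * (real k + 1) * e'"
          using e' C by (intro mult_strict_right_mono mult_strict_mono') auto
        also have "\<dots> = e" using C by (simp add: e'_def divide_simps add_nonneg_eq_0_iff)
        finally show ?thesis by simp
      qed
      then show "\<exists>M. \<forall>p\<ge>M. \<forall>q\<ge>M.
          norm (T0 (tup k (\<lambda>i. d (z i) p)) - T0 (tup k (\<lambda>i. d (z i) q))) < e" by blast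
    qed
  qed
  define T where "T zs = lim (\<lambda>n. T0 (tup k (\<lambda>i. d (zs ! i) n)))" for zs
  \<comment> \<open>Any approximating sequence in \<open>D\<close> may replace the chosen
    \<open>d\<close>; the properties of \<open>T\<close> below all use this freedom.\<close>
  have T: "(\<lambda>n. T0 (tup k (\<lambda>i. x i n))) \<longlonglongrightarrow> T (tup k z)"
    if x: "\<And>i. i < k \<Longrightarrow> x i \<longlonglongrightarrow> z i" "\<And>i n. i < k \<Longrightarrow> x i n \<in> D" for x z
  proof -
    have "convergent (\<lambda>n. T0 (tup k (\<lambda>i. d (z i) n)))"
      using Cauchy[of z] by (simp add: Cauchy_convergent_iff)
    moreover have "tup k (\<lambda>i. d (tup k z ! i) n) = tup k (\<lambda>i. d (z i) n)" for n by simp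
    ultimately have "(\<lambda>n. T0 (tup k (\<lambda>i. d (z i) n))) \<longlonglongrightarrow> T (tup k z)"
      by (simp only: T_def convergent_LIMSEQ_iff)
    moreover have "(\<lambda>n. T0 (tup k (\<lambda>i. x i n)) - T0 (tup k (\<lambda>i. d (z i) n))) \<longlonglongrightarrow> 0"
      by (rule diff[where z = z]) (use x d(1,2) in auto)
    ultimately show ?thesis using tendsto_add by fastforce
  qed
  have agree: "T zs = T0 zs" if "zs \<in> tuples D k" for zs
  proof -
    have "(\<lambda>n. T0 (tup k ((!) zs))) \<longlonglongrightarrow> T (tup k ((!) zs))"
      using that by (intro T) (auto intro: tuples_nth)
    then show ?thesis using that by (simp add: tup_nth LIMSEQ_const_iff)
  qed
  have "multilinear_on UNIV k T"
    unfolding multilinear_on_def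
  proof (intro ballI allI impI)
    fix zs :: "'y list" and i u v c e assume zs: "zs \<in> tuples UNIV k" and i: "i < k"
    let ?z = "(!) zs"
    let ?x = "\<lambda>j. d (?z j)"
    have D: "(?x(i := y)) j n \<in> D" if "\<And>n. y n \<in> D" for y j n using d that by auto
    have lim: "(\<lambda>n. T0 (tup k (\<lambda>j. (?x(i := y)) j n))) \<longlonglongrightarrow> T (tup k (?z(i := w)))"
      if "y \<longlonglongrightarrow> w" "\<And>n. y n \<in> D" for y w
      using that d D by (intro T) auto
    \<comment> \<open>The combination is approximated by combining approximants, not by
      \<open>d\<close> of the combination, so that multilinearity of \<open>T0\<close> applies at
      each \<open>n\<close>.\<close>
    have comb: "c *\<^sub>R d u n + e *\<^sub>R d v n \<in> D" for n
      using D d \<open>subspace D\<close> by (simp add: subspace_add subspace_scale)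
    have eq: "T0 (tup k (\<lambda>j. (?x(i := (\<lambda>n. c *\<^sub>R d u n + e *\<^sub>R d v n))) j n)) =
        c * T0 (tup k (\<lambda>j. (?x(i := d u)) j n)) + e * T0 (tup k (\<lambda>j. (?x(i := d v)) j n))" for n
    proof -
      have fu: "(\<lambda>j. (?x(i := y)) j n) = (\<lambda>j. ?x j n)(i := y n)" for y by (auto simp: fun_eq_iff)
      show ?thesis
        using multilinear_onD[OF ml0, of "tup k (\<lambda>j. ?x j n)" i "d u n" "d v n" c e] i d
        unfolding fu by simp
    qed
    have "(\<lambda>n. T0 (tup k (\<lambda>j. (?x(i := (\<lambda>n. c *\<^sub>R d u n + e *\<^sub>R d v n))) j n)))
        \<longlonglongrightarrow> T (tup k (?z(i := c *\<^sub>R u + e *\<^sub>R v)))"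
      by (rule lim) (use d comb in \<open>auto intro!: tendsto_intros\<close>)
    moreover have "(\<lambda>n. c * T0 (tup k (\<lambda>j. (?x(i := d u)) j n)) + e * T0 (tup k (\<lambda>j. (?x(i := d v)) j n)))
        \<longlonglongrightarrow> c * T (tup k (?z(i := u))) + e * T (tup k (?z(i := v)))"
      by (intro tendsto_intros lim d)
    ultimately have "T (tup k (?z(i := c *\<^sub>R u + e *\<^sub>R v))) =
        c * T (tup k (?z(i := u))) + e * T (tup k (?z(i := v)))"
      unfolding eq using LIMSEQ_unique by blast
    moreover have "zs[i := w] = tup k (?z(i := w))" for w
      using zs i by (metis tup_nth tup_update)
    ultimately show "T (zs[i := c *\<^sub>R u + e *\<^sub>R v]) = c * T (zs[i := u]) + e * T (zs[i := v])"
      by simp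
  qed
  moreover have "\<exists>M. \<forall>zs\<in>tuples UNIV k. (\<forall>z\<in>set zs. norm z \<le> 1) \<longrightarrow> \<bar>T zs\<bar> \<le> M"
  proof -
    obtain C where C: "C \<ge> 0"
      "\<forall>x y. (\<forall>j<k. x j \<in> D \<and> y j \<in> D \<and> norm (x j) \<le> 2 \<and> norm (y j) \<le> 2)
      \<longrightarrow> \<bar>T0 (tup k x) - T0 (tup k y)\<bar> \<le> C * (\<Sum>i<k. norm (x i - y i))"
      using locally_Lipschitz[OF T0, of 2] by blast
    \<comment> \<open>Approximants of points of the unit ball eventually have norm below 2 and are
      compared with the zero tuple. Its value vanishes for positive \<open>k\<close> and is kept to
      cover \<open>k = 0\<close>.\<close>
    let ?M = "\<bar>T0 (tup k (\<lambda>_. 0))\<bar> + C * (\<Sum>i<k. 2)"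
    have "\<bar>T zs\<bar> \<le> ?M" if zs: "zs \<in> tuples UNIV k" and le: "\<And>z. z \<in> set zs \<Longrightarrow> norm z \<le> 1" for zs
    proof -
      have lim: "(\<lambda>n. \<bar>T0 (tup k (\<lambda>i. d (zs ! i) n))\<bar>) \<longlonglongrightarrow> \<bar>T (tup k ((!) zs))\<bar>"
        using d by (intro tendsto_rabs T) auto
      have "norm (zs ! i) < 2" if "i < k" for i
        using le[of "zs ! i"] zs that by (force simp: tuples_def)
      then have "\<forall>i<k. \<forall>\<^sub>F n in sequentially. norm (d (zs ! i) n) < 2"
        using order_tendstoD(2)[OF tendsto_norm[OF d(2)]] by blast
      then have "\<forall>\<^sub>F n in sequentially. \<forall>i\<in>{..<k}. norm (d (zs ! i) n) < 2"
        by (intro eventually_ball_finite) auto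
      then have "\<forall>\<^sub>F n in sequentially. \<bar>T0 (tup k (\<lambda>i. d (zs ! i) n))\<bar> \<le> ?M"
      proof eventually_elim
        case (elim n)
        have "\<bar>T0 (tup k (\<lambda>i. d (zs ! i) n)) - T0 (tup k (\<lambda>_. 0))\<bar> \<le> C * (\<Sum>i<k. norm (d (zs ! i) n - 0))"
          using elim d D by (intro C(2)[rule_format]) (auto simp: subspace_0 less_imp_le)
        also have "\<dots> \<le> C * (\<Sum>i<k. 2)"
          using elim C(1) by (intro mult_left_mono sum_mono) (auto simp: less_imp_le)
        finally show ?case by linarith
      qed
      from tendsto_upperbound[OF lim this] show ?thesis using zs by (simp add: tup_nth)
    qed
    then show ?thesis by blast
  qed
  ultimately have 1: "T \<in> bounded_multilinear_forms UNIV norm k"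
    by (simp add: bounded_multilinear_forms_def)
  have 2: "symmetric_on UNIV k T"
    unfolding symmetric_on_def
  proof (intro ballI allI impI)
    fix zs :: "'y list" and \<sigma> assume zs: "zs \<in> tuples UNIV k" and \<sigma>: "\<sigma> permutes {..<k}"
    have \<sigma>k: "i < k \<Longrightarrow> \<sigma> i < k" for i using permutes_in_image[OF \<sigma>, of i] by simp
    have p: "permute_list \<sigma> (tup k x) = tup k (\<lambda>i. x (\<sigma> i))" for x :: "nat \<Rightarrow> 'y"
      using \<sigma>k by (simp add: permute_list_def cong: map_cong)
    have "(\<lambda>n. T0 (tup k (\<lambda>i. d (zs ! \<sigma> i) n))) \<longlonglongrightarrow> T (tup k (\<lambda>i. zs ! \<sigma> i))"
      using d(1,2) by (intro T) auto
    moreover have "T0 (tup k (\<lambda>i. d (zs ! \<sigma> i) n)) = T0 (tup k (\<lambda>i. d (zs ! i) n))" for n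
    proof -
      have "tup k (\<lambda>i. d (zs ! i) n) \<in> tuples D k" using d(1) by simp
      then have "T0 (permute_list \<sigma> (tup k (\<lambda>i. d (zs ! i) n))) = T0 (tup k (\<lambda>i. d (zs ! i) n))"
        using sym \<sigma> by (simp only: symmetric_on_def)
      then show ?thesis by (simp only: p)
    qed
    moreover have "(\<lambda>n. T0 (tup k (\<lambda>i. d (zs ! i) n))) \<longlonglongrightarrow> T (tup k ((!) zs))"
      using d(1,2) by (intro T) auto
    ultimately have "T (tup k (\<lambda>i. zs ! \<sigma> i)) = T (tup k ((!) zs))"
      using LIMSEQ_unique by (simp only:)
    then show "T (permute_list \<sigma> zs) = T zs"
      using zs p[of "(!) zs"] by (simp add: tup_nth)
  qed
  show thesis by (rule that[OF 1 2 agree])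
qed

section \<open>Symmetric forms\<close>

text \<open>Equality of multisets is easier to check than exhibiting a permutation, for instance
  after prepending \<open>B\<close>, overwriting an entry or sorting.\<close>

lemma symmetric_on_mset:
  "symmetric_on X k T \<longleftrightarrow>
    (\<forall>xs\<in>tuples X k. \<forall>ys\<in>tuples X k. mset xs = mset ys \<longrightarrow> T xs = T ys)"
proof
  assume sym: "symmetric_on X k T"
  show "\<forall>xs\<in>tuples X k. \<forall>ys\<in>tuples X k. mset xs = mset ys \<longrightarrow> T xs = T ys"
  proof (intro ballI impI)
    fix xs ys :: "'a list" assume *: "xs \<in> tuples X k" "ys \<in> tuples X k" "mset xs = mset ys"
    obtain p where "p permutes {..<length ys}" "permute_list p ys = xs"
      using mset_eq_permutation[OF *(3)] by metis
    then show "T xs = T ys"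
      using sym * by (auto simp: symmetric_on_def tuples_def)
  qed
next
  assume *: "\<forall>xs\<in>tuples X k. \<forall>ys\<in>tuples X k. mset xs = mset ys \<longrightarrow> T xs = T ys"
  show "symmetric_on X k T"
    unfolding symmetric_on_def
  proof (intro ballI allI impI)
    fix zs and \<sigma> :: "nat \<Rightarrow> nat" assume "zs \<in> tuples X k" "\<sigma> permutes {..<k}"
    moreover from this have "mset (permute_list \<sigma> zs) = mset zs"
      by (intro mset_permute_list) (auto simp: tuples_def)
    ultimately show "T (permute_list \<sigma> zs) = T zs"
      using * by (meson tuples_permute_list)
  qed
qed

lemma symmetric_onD:
  "symmetric_on X k T \<Longrightarrow> xs \<in> tuples X k \<Longrightarrow> ys \<in> tuples X k \<Longrightarrow> mset xs = mset ys \<Longrightarrow> T xs = T ys"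
  unfolding symmetric_on_mset by blast

text \<open>The inverse appears because \<open>permute_list \<sigma>\<close> reads entry
  \<open>\<sigma> m\<close> at position \<open>m\<close>, so entry \<open>i\<close> moves to
  position \<open>inv \<sigma> i\<close>.\<close>

lemma permute_list_update:
  assumes "\<sigma> permutes {..<length zs}" "i < length zs"
  shows "permute_list \<sigma> (zs[i := x]) = (permute_list \<sigma> zs)[inv \<sigma> i := x]"
proof (rule nth_equalityI)
  fix m assume "m < length (permute_list \<sigma> (zs[i := x]))"
  then have m: "m < length zs" by simp
  then have "\<sigma> m < length zs" using permutes_in_image[OF assms(1), of m] by simp
  moreover have "\<sigma> m = i \<longleftrightarrow> m = inv \<sigma> i"
    using permutes_inverses[OF assms(1)] by metis
  ultimately show "permute_list \<sigma> (zs[i := x]) ! m = (permute_list \<sigma> zs)[inv \<sigma> i := x] ! m"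
    using m assms by (auto simp: permute_list_nth nth_list_update)
qed simp

lemma multilinear_on_permute_list:
  assumes "multilinear_on X k T" and \<sigma>: "\<sigma> permutes {..<k}"
  shows "multilinear_on X k (\<lambda>zs. T (permute_list \<sigma> zs))"
  unfolding multilinear_on_def
proof (intro ballI allI impI)
  fix zs i x y c d assume *: "zs \<in> tuples X k" "i < k" "x \<in> X" "y \<in> X"
  have "inv \<sigma> i < k" using permutes_in_image[OF permutes_inv[OF \<sigma>], of i] * by simp
  moreover have "permute_list \<sigma> (zs[i := u]) = (permute_list \<sigma> zs)[inv \<sigma> i := u]" for u
    using * \<sigma> by (intro permute_list_update) (auto simp: tuples_def)
  ultimately show "T (permute_list \<sigma> (zs[i := c *\<^sub>R x + d *\<^sub>R y])) =
      c * T (permute_list \<sigma> (zs[i := x])) + d * T (permute_list \<sigma> (zs[i := y]))"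
    using * \<sigma> assms(1) by (auto intro!: multilinear_onD tuples_permute_list)
qed

lemma multilinear_on_tensor:
  assumes S: "multilinear_on X i S" and T: "multilinear_on X j T"
  shows "multilinear_on X (i + j) (tensor i S T)"
  unfolding multilinear_on_def
proof (intro ballI allI impI)
  fix zs m x y c d assume *: "zs \<in> tuples X (i + j)" "m < i + j" "x \<in> X" "y \<in> X"
  have z: "take i zs \<in> tuples X i" "drop i zs \<in> tuples X j"
    using * by (auto simp: tuples_def dest: in_set_takeD in_set_dropD)
  show "tensor i S T (zs[m := c *\<^sub>R x + d *\<^sub>R y]) =
      c * tensor i S T (zs[m := x]) + d * tensor i S T (zs[m := y])"
  proof (cases "m < i")
    case True
    then show ?thesis using multilinear_onD[OF S z(1) _ *(3,4), of m c d]
      by (simp add: tensor_def take_update_swap algebra_simps)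
  next
    case False
    then show ?thesis using multilinear_onD[OF T z(2) _ *(3,4), of "m - i" c d] *(2)
      by (simp add: tensor_def drop_update_swap algebra_simps)
  qed
qed

lemma multilinear_on_sum:
  "(\<And>a. a \<in> I \<Longrightarrow> multilinear_on X k (T a)) \<Longrightarrow> multilinear_on X k (\<lambda>zs. \<Sum>a\<in>I. T a zs)"
  by (simp add: multilinear_on_def sum.distrib sum_distrib_left)

lemma multilinear_on_cmult:
  "multilinear_on X k T \<Longrightarrow> multilinear_on X k (\<lambda>zs. c * T zs)"
  by (simp add: multilinear_on_def algebra_simps)

lemma multilinear_on_add:
  "multilinear_on X k S \<Longrightarrow> multilinear_on X k T \<Longrightarrow> multilinear_on X k (\<lambda>zs. S zs + T zs)"
  by (simp add: multilinear_on_def algebra_simps)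

lemma multilinear_on_Cons:
  assumes T: "multilinear_on X (Suc k) T" and b: "b \<in> X"
  shows "multilinear_on X k (\<lambda>zs. T (b # zs))"
  unfolding multilinear_on_def
proof (intro ballI allI impI)
  fix zs i x y c d assume *: "zs \<in> tuples X k" "i < k" "x \<in> X" "y \<in> X"
  have "b # zs \<in> tuples X (Suc k)" using * b by (auto simp: tuples_def)
  from multilinear_onD[OF T this _ *(3,4), of "Suc i" c d] *(2)
  show "T (b # zs[i := c *\<^sub>R x + d *\<^sub>R y]) = c * T (b # zs[i := x]) + d * T (b # zs[i := y])"
    by simp
qed

lemma symmetric_on_sum:
  "(\<And>a. a \<in> I \<Longrightarrow> symmetric_on X k (T a)) \<Longrightarrow> symmetric_on X k (\<lambda>zs. \<Sum>a\<in>I. T a zs)"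
  unfolding symmetric_on_def by (intro ballI allI impI sum.cong) auto

section \<open>Shuffles and the symmetrized tensor product\<close>

lemma finite_shuffle_perms: "finite (shuffle_perms i j)"
  by (rule finite_subset[OF _ finite_permutations[of "{..<i + j}"]]) (auto simp: shuffle_perms_def)

lemma map_strict_mono_eq_sorted_list:
  assumes "strict_mono_on {a..<b} (\<sigma> :: nat \<Rightarrow> nat)"
  shows "map \<sigma> [a..<b] = sorted_list_of_set (\<sigma> ` {a..<b})"
proof -
  have "sorted_wrt (<) (map \<sigma> [a..<b])"
    by (auto simp: sorted_wrt_iff_nth_less intro!: strict_mono_onD[OF assms])
  moreover have "inj_on \<sigma> {a..<b}" using assms by (rule strict_mono_on_imp_inj_on)
  ultimately show ?thesis
    by (intro iffD1[OF sorted_list_of_set_unique, symmetric]) (simp_all add: card_image)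
qed

text \<open>Monotonicity forces each block to list its values in increasing order, so the set of the
  first \<open>i\<close> values determines the shuffle. Conversely, listing a set and then its
  complement in increasing order gives a shuffle.\<close>

lemma bij_betw_shuffle_perms:
  "bij_betw (\<lambda>\<sigma>. \<sigma> ` {..<i}) (shuffle_perms i j) {A. A \<subseteq> {..<i + j} \<and> card A = i}"
proof (rule bij_betw_imageI)
  have comp: "\<sigma> ` {i..<i + j} = {..<i + j} - \<sigma> ` {..<i}" if "\<sigma> permutes {..<i + j}" for \<sigma> :: "nat \<Rightarrow> nat"
  proof -
    have "{i..<i + j} = {..<i + j} - {..<i}" by auto
    then show ?thesis
      using image_set_diff[OF permutes_inj[OF that]] permutes_image[OF that] by metis
  qed
  show "inj_on (\<lambda>\<sigma>. \<sigma> ` {..<i}) (shuffle_perms i j)"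
  proof (rule inj_onI)
    fix \<sigma> \<tau> assume *: "\<sigma> \<in> shuffle_perms i j" "\<tau> \<in> shuffle_perms i j" "\<sigma> ` {..<i} = \<tau> ` {..<i}"
    have p: "\<sigma> permutes {..<i + j}" "\<tau> permutes {..<i + j}" using * by (auto simp: shuffle_perms_def)
    have "map \<sigma> [0..<i] = map \<tau> [0..<i]" "map \<sigma> [i..<i + j] = map \<tau> [i..<i + j]"
      using * comp[OF p(1)] comp[OF p(2)]
      by (auto simp: shuffle_perms_def map_strict_mono_eq_sorted_list lessThan_atLeast0)
    then have "\<sigma> m = \<tau> m" if "m < i + j" for m
      using that by (cases "m < i") auto
    moreover have "\<sigma> m = \<tau> m" if "\<not> m < i + j" for m
      using p that by (simp add: permutes_def)
    ultimately show "\<sigma> = \<tau>" by blast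
  qed
  show "(\<lambda>\<sigma>. \<sigma> ` {..<i}) ` shuffle_perms i j = {A. A \<subseteq> {..<i + j} \<and> card A = i}"
  proof (intro equalityI subsetI)
    fix A assume "A \<in> (\<lambda>\<sigma>. \<sigma> ` {..<i}) ` shuffle_perms i j"
    then obtain \<sigma> where \<sigma>: "\<sigma> permutes {..<i + j}" "A = \<sigma> ` {..<i}" by (auto simp: shuffle_perms_def)
    then have "A \<subseteq> {..<i + j}" using permutes_image[OF \<sigma>(1)] by auto
    moreover have "card A = i" using \<sigma> by (simp add: card_image permutes_inj_on)
    ultimately show "A \<in> {A. A \<subseteq> {..<i + j} \<and> card A = i}" by simp
  next
    fix A assume "A \<in> {A. A \<subseteq> {..<i + j} \<and> card A = i}"
    then have A: "A \<subseteq> {..<i + j}" "card A = i" by auto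
    have fin: "finite A" using A(1) by (rule finite_subset) simp
    let ?B = "{..<i + j} - A"
    have B: "card ?B = j" using A fin by (simp add: card_Diff_subset)
    define l where "l = sorted_list_of_set A @ sorted_list_of_set ?B"
    have l: "length l = i + j" "distinct l" "set l = {..<i + j}"
      using A B fin by (auto simp: l_def)
    define \<sigma> where "\<sigma> m = (if m < i + j then l ! m else m)" for m
    have "bij_betw (\<lambda>m. l ! m) {..<i + j} {..<i + j}"
      by (intro bij_betw_nth) (simp_all only: l)
    then have "bij_betw \<sigma> {..<i + j} {..<i + j}"
      by (rule bij_betw_cong[THEN iffD1, rotated]) (simp add: \<sigma>_def)
    then have perm: "\<sigma> permutes {..<i + j}"
      by (rule bij_imp_permutes) (auto simp: \<sigma>_def)
    have 1: "\<sigma> m = sorted_list_of_set A ! m" if "m < i" for m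
      using that A by (simp add: \<sigma>_def l_def nth_append)
    have 2: "\<sigma> m = sorted_list_of_set ?B ! (m - i)" if "i \<le> m" "m < i + j" for m
      using that A by (simp add: \<sigma>_def l_def nth_append)
    have nth: "sorted_list_of_set C ! a < sorted_list_of_set C ! b" if "a < b" "b < card C" for C :: "nat set" and a b
      using strict_sorted_list_of_set[of C] that by (simp add: sorted_wrt_iff_nth_less)
    have "strict_mono_on {..<i} \<sigma>" using A by (auto intro!: strict_mono_onI nth simp: 1)
    moreover have "strict_mono_on {i..<i + j} \<sigma>"
      using B by (auto intro!: strict_mono_onI nth simp: 2)
    ultimately have "\<sigma> \<in> shuffle_perms i j" using perm by (simp add: shuffle_perms_def)
    moreover have "\<sigma> ` {..<i} = A"
    proof -
      have "\<sigma> ` {..<i} = (!) (sorted_list_of_set A) ` {..<i}" by (intro image_cong) (auto simp: 1)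
      also have "\<dots> = set (sorted_list_of_set A)"
        using A by (auto simp: set_conv_nth)
      finally show ?thesis using fin by simp
    qed
    ultimately show "A \<in> (\<lambda>\<sigma>. \<sigma> ` {..<i}) ` shuffle_perms i j" by blast
  qed
qed

text \<open>Symmetric factors see only which arguments they receive. The sum over shuffles is
  therefore a sum over the sets of \<open>i\<close> positions, and a permutation of the arguments
  merely permutes these sets.\<close>

lemma symmetric_on_Sym_tensor:
  assumes S: "symmetric_on X i S" and T: "symmetric_on X j T"
  shows "symmetric_on X (i + j) (Sym i j (tensor i S T))"
  unfolding symmetric_on_def
proof (intro ballI allI impI)
  fix zs and \<rho> :: "nat \<Rightarrow> nat" assume zs: "zs \<in> tuples X (i + j)" and \<rho>: "\<rho> permutes {..<i + j}"
  let ?n = "i + j"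
  let ?z = "\<lambda>A. map ((!) zs) (sorted_list_of_set A)"
  define g where "g A = S (?z A) * T (?z ({..<?n} - A))" for A
  have len: "length zs = ?n" using zs by (simp add: tuples_def)
  \<comment> \<open>Stated for every permutation: composing a shuffle with \<open>\<rho>\<close>
    need not give a shuffle, yet only the image of the first block matters.\<close>
  have val: "tensor i S T (permute_list \<tau> zs) = g (\<tau> ` {..<i})" if \<tau>: "\<tau> permutes {..<?n}" for \<tau>
  proof -
    have inj: "inj_on \<tau> C" for C using \<tau> by (rule permutes_inj_on)
    have lt: "m < ?n \<Longrightarrow> \<tau> m < ?n" for m using permutes_in_image[OF \<tau>, of m] by simp
    have eq: "permute_list \<tau> zs = map ((!) zs) (map \<tau> [0..<?n])"
      using len by (simp add: permute_list_def)
    have m: "mset (map \<tau> [a..<b]) = mset (sorted_list_of_set (\<tau> ` {a..<b}))" for a b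
    proof -
      have "mset (map \<tau> [a..<b]) = mset_set (set (map \<tau> [a..<b]))"
        by (intro mset_set_set[symmetric]) (simp add: distinct_map inj)
      also have "\<dots> = mset (sorted_list_of_set (\<tau> ` {a..<b}))"
        using mset_set_set[of "sorted_list_of_set (\<tau> ` {a..<b})"] by simp
      finally show ?thesis .
    qed
    have tk: "take i (permute_list \<tau> zs) = map ((!) zs) (map \<tau> [0..<i])"
      and dp: "drop i (permute_list \<tau> zs) = map ((!) zs) (map \<tau> [i..<?n])"
      unfolding eq by (simp_all add: take_map drop_map)
    have "\<tau> ` {i..<?n} = {..<?n} - \<tau> ` {..<i}"
    proof -
      have "{i..<?n} = {..<?n} - {..<i}" by auto
      then show ?thesis
        using image_set_diff[OF permutes_inj[OF \<tau>]] permutes_image[OF \<tau>] by metis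
    qed
    then have "?z ({..<?n} - \<tau> ` {..<i}) = map ((!) zs) (sorted_list_of_set (\<tau> ` {i..<?n}))" by simp
    moreover have "S (map ((!) zs) (map \<tau> [0..<i])) = S (?z (\<tau> ` {..<i}))"
    proof (rule symmetric_onD[OF S])
      show "map ((!) zs) (map \<tau> [0..<i]) \<in> tuples X i" using lt zs by (auto intro: tuples_nth)
      show "?z (\<tau> ` {..<i}) \<in> tuples X i"
        using lt zs inj by (auto simp: tuples_def card_image intro!: tuples_nth[of zs X ?n, unfolded tuples_def])
      show "mset (map ((!) zs) (map \<tau> [0..<i])) = mset (?z (\<tau> ` {..<i}))"
        using m[of 0 i] by (simp only: mset_map lessThan_atLeast0)
    qed
    moreover have "T (map ((!) zs) (map \<tau> [i..<?n])) = T (map ((!) zs) (sorted_list_of_set (\<tau> ` {i..<?n})))"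
    proof (rule symmetric_onD[OF T])
      show "map ((!) zs) (map \<tau> [i..<?n]) \<in> tuples X j"
        using lt zs by (auto simp: tuples_def intro!: tuples_nth[of zs X ?n, unfolded tuples_def])
      show "?z (\<tau> ` {i..<?n}) \<in> tuples X j"
        using lt zs inj by (auto simp: tuples_def card_image intro!: tuples_nth[of zs X ?n, unfolded tuples_def])
      show "mset (map ((!) zs) (map \<tau> [i..<?n])) = mset (?z (\<tau> ` {i..<?n}))"
        using m[of i ?n] by (simp only: mset_map)
    qed
    ultimately show ?thesis by (simp only: tensor_def tk dp g_def)
  qed
  let ?\<A> = "{A. A \<subseteq> {..<?n} \<and> card A = i}"
  have sum: "(\<Sum>\<sigma>\<in>shuffle_perms i j. h (\<sigma> ` {..<i})) = (\<Sum>A\<in>?\<A>. h A)" for h :: "nat set \<Rightarrow> real"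
    by (rule sum.reindex_bij_betw[OF bij_betw_shuffle_perms])
  have "(\<Sum>\<sigma>\<in>shuffle_perms i j. tensor i S T (permute_list \<sigma> (permute_list \<rho> zs)))
      = (\<Sum>\<sigma>\<in>shuffle_perms i j. g (\<rho> ` (\<sigma> ` {..<i})))"
  proof (rule sum.cong)
    fix \<sigma> assume "\<sigma> \<in> shuffle_perms i j"
    then have \<sigma>: "\<sigma> permutes {..<?n}" by (simp add: shuffle_perms_def)
    have "permute_list \<sigma> (permute_list \<rho> zs) = permute_list (\<rho> \<circ> \<sigma>) zs"
      using \<sigma> \<rho> len by (simp add: permute_list_compose)
    then show "tensor i S T (permute_list \<sigma> (permute_list \<rho> zs)) = g (\<rho> ` (\<sigma> ` {..<i}))"
      using val[OF permutes_compose[OF \<sigma> \<rho>]] by (simp add: image_comp)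
  qed simp
  also have "\<dots> = (\<Sum>A\<in>?\<A>. g (\<rho> ` A))" by (rule sum)
  also have "\<dots> = (\<Sum>A\<in>?\<A>. g A)"
  proof (rule sum.reindex_bij_betw)
    have im: "\<tau> ` A \<in> ?\<A>" if "\<tau> permutes {..<?n}" "A \<in> ?\<A>" for \<tau> A
      using that permutes_image[OF that(1)] permutes_inj_on[OF that(1), of A]
      by (auto simp: card_image permutes_in_image)
    show "bij_betw ((`) \<rho>) ?\<A> ?\<A>"
    proof (rule bij_betw_byWitness[where f' = "(`) (inv \<rho>)"])
      show "\<forall>A\<in>?\<A>. inv \<rho> ` \<rho> ` A = A" "\<forall>A\<in>?\<A>. \<rho> ` inv \<rho> ` A = A"
        using permutes_inverses[OF \<rho>] by (simp_all add: image_comp o_def)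
      show "(`) \<rho> ` ?\<A> \<subseteq> ?\<A>" using im[OF \<rho>] by blast
      show "(`) (inv \<rho>) ` ?\<A> \<subseteq> ?\<A>" using im[OF permutes_inv[OF \<rho>]] by blast
    qed
  qed
  also have "\<dots> = (\<Sum>\<sigma>\<in>shuffle_perms i j. g (\<sigma> ` {..<i}))" by (rule sum[symmetric])
  also have "\<dots> = (\<Sum>\<sigma>\<in>shuffle_perms i j. tensor i S T (permute_list \<sigma> zs))"
    by (intro sum.cong) (auto simp: val shuffle_perms_def)
  finally show "Sym i j (tensor i S T) (permute_list \<rho> zs) = Sym i j (tensor i S T) zs"
    by (simp add: Sym_def)
qed

lemma multilinear_on_Sym:
  assumes "multilinear_on X (i + j) T"
  shows "multilinear_on X (i + j) (Sym i j T)"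
proof -
  have "multilinear_on X (i + j) (\<lambda>zs. (1 / real ((i + j) choose i)) *
      (\<Sum>\<sigma>\<in>shuffle_perms i j. T (permute_list \<sigma> zs)))"
    using assms by (intro multilinear_on_cmult multilinear_on_sum multilinear_on_permute_list)
      (auto simp: shuffle_perms_def)
  then show ?thesis unfolding Sym_def[abs_def] by simp
qed

section \<open>Stable flows\<close>

text \<open>A primitive replaces the integral of the majorant: \<open>\<Phi> a - \<Phi> b\<close>
  bounds the increment of the integral of \<open>f\<close> from \<open>a\<close> to
  \<open>b\<close>, and \<open>\<Phi> \<tau>\<close> bounds the tail from \<open>\<tau>\<close> on.
  The bound for the whole integral is then an initial value.\<close>

lemma dominated_improper_integral:
  fixes f \<Phi> \<Phi>' :: "real \<Rightarrow> real"
  assumes cont: "continuous_on {0..} f"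
    and \<Phi>: "\<And>t. t \<ge> 0 \<Longrightarrow> (\<Phi> has_real_derivative \<Phi>' t) (at t within {0..})"
    and bd: "\<And>t. t \<ge> 0 \<Longrightarrow> \<bar>f t\<bar> \<le> - \<Phi>' t"
    and lim: "(\<Phi> \<longlongrightarrow> 0) at_top"
  obtains l where "((\<lambda>\<tau>. integral {0..\<tau>} f) \<longlongrightarrow> l) at_top" "\<bar>l\<bar> \<le> \<Phi> 0"
proof -
  define F where "F \<tau> = integral {0..\<tau>} f" for \<tau>
  have FF: "\<bar>F b - F a\<bar> \<le> \<Phi> a - \<Phi> b" if "0 \<le> a" "a \<le> b" for a b
  proof -
    have int: "f integrable_on {u..v}" if "0 \<le> u" for u v
      using that by (intro integrable_continuous_real continuous_on_subset[OF cont]) auto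
    have "(\<Phi> has_vector_derivative \<Phi>' x) (at x within {a..b})" if "x \<in> {a..b}" for x
      using \<Phi>[of x] that \<open>0 \<le> a\<close>
      by (auto simp: has_real_derivative_iff_has_vector_derivative intro: has_vector_derivative_within_subset)
    then have "(\<Phi>' has_integral \<Phi> b - \<Phi> a) {a..b}"
      using that by (intro fundamental_theorem_of_calculus) auto
    then have "((\<lambda>t. - \<Phi>' t) has_integral - (\<Phi> b - \<Phi> a)) {a..b}" by (rule has_integral_neg)
    then have *: "(\<lambda>t. - \<Phi>' t) integrable_on {a..b}" "integral {a..b} (\<lambda>t. - \<Phi>' t) = \<Phi> a - \<Phi> b"
      by (auto simp: has_integral_iff)
    have "F b - F a = integral {a..b} f"
      using Henstock_Kurzweil_Integration.integral_combine[where a = 0 and c = a and b = b and f = f] int that by (simp add: F_def)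
    also have "norm \<dots> \<le> integral {a..b} (\<lambda>t. - \<Phi>' t)"
      using bd that by (intro integral_norm_bound_integral int *) auto
    finally show ?thesis using * by simp
  qed
  have lim': "(\<lambda>n. \<Phi> (real n)) \<longlonglongrightarrow> 0"
    using lim filterlim_real_sequentially by (rule filterlim_compose)
  have "Cauchy (\<lambda>n. F (real n))"
  proof (rule metric_CauchyI)
    fix e :: real assume "e > 0"
    then obtain m where m: "\<And>p q. p \<ge> m \<Longrightarrow> q \<ge> m \<Longrightarrow> dist (\<Phi> (real p)) (\<Phi> (real q)) < e"
      using LIMSEQ_imp_Cauchy[OF lim'] metric_CauchyD by metis
    have "dist (F (real p)) (F (real q)) < e" if "p \<ge> m" "q \<ge> m" for p q
      using m[OF that] FF[of "real p" "real q"] FF[of "real q" "real p"]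
      by (cases "p \<le> q") (auto simp: dist_real_def)
    then show "\<exists>m. \<forall>p\<ge>m. \<forall>q\<ge>m. dist (F (real p)) (F (real q)) < e" by blast
  qed
  then obtain l where l: "(\<lambda>n. F (real n)) \<longlonglongrightarrow> l"
    using Cauchy_convergent convergent_def by blast
  \<comment> \<open>Convergence is known along the integers only; this tail estimate carries it to
    real \<open>\<tau>\<close>.\<close>
  have le: "\<bar>F \<tau> - l\<bar> \<le> \<Phi> \<tau>" if \<tau>: "\<tau> \<ge> 0" for \<tau>
  proof -
    have "(\<lambda>n. \<bar>F \<tau> - F (real n)\<bar>) \<longlonglongrightarrow> \<bar>F \<tau> - l\<bar>" by (intro tendsto_intros l)
    moreover have "(\<lambda>n. \<Phi> \<tau> - \<Phi> (real n)) \<longlonglongrightarrow> \<Phi> \<tau> - 0" by (intro tendsto_intros lim')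
    moreover have "\<forall>\<^sub>F n in sequentially. \<bar>F \<tau> - F (real n)\<bar> \<le> \<Phi> \<tau> - \<Phi> (real n)"
      using eventually_ge_at_top[of "nat \<lceil>\<tau>\<rceil>"]
    proof eventually_elim
      case (elim n)
      then have "\<tau> \<le> real n" by linarith
      from FF[OF \<tau> this] show ?case by (simp add: abs_minus_commute)
    qed
    ultimately show ?thesis using tendsto_le[OF sequentially_bot] by fastforce
  qed
  have "((\<lambda>\<tau>. F \<tau> - l) \<longlongrightarrow> 0) at_top"
  proof (rule Lim_null_comparison[OF _ lim])
    show "\<forall>\<^sub>F \<tau> in at_top. norm (F \<tau> - l) \<le> \<Phi> \<tau>"
      using eventually_ge_at_top[of 0] by eventually_elim (use le in auto)
  qed
  then have "(F \<longlongrightarrow> l) at_top" by (simp add: LIM_zero_iff)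
  moreover have "\<bar>l\<bar> \<le> \<Phi> 0" using le[of 0] by (simp add: F_def)
  ultimately show thesis using that by (simp add: F_def[abs_def])
qed

text \<open>Collects what the sequel uses of the form, the feedback and \<open>N\<close>. As
  \<open>2 * inner (L z) z\<close> is the derivative of the squared norm along the flow,
  \<open>N_bound\<close> says that \<open>NY\<close> is paid for by dissipation, up to a bounded
  term with factor \<open>J\<close>.\<close>

locale stable_flow =
  fixes D :: "'y::{real_inner,complete_space} set" and L NY :: "'y \<Rightarrow> 'y"
    and S :: "real \<Rightarrow> 'y \<Rightarrow>\<^sub>L 'y" and J K :: real
  assumes gen: "generates D L S" and stab: "exp_stable S" and dense: "closure D = UNIV"
    and N_lin: "x \<in> D \<Longrightarrow> y \<in> D \<Longrightarrow> NY (c *\<^sub>R x + d *\<^sub>R y) = c *\<^sub>R NY x + d *\<^sub>R NY y"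
    and J_nonneg: "J \<ge> 0" and K_nonneg: "K \<ge> 0"
    and N_bound: "z \<in> D \<Longrightarrow> (norm (NY z))\<^sup>2 \<le> J * (norm z)\<^sup>2 - K * inner (L z) z"
begin

section \<open>Orbits of the semigroup\<close>

lemma S_0 [simp]: "S 0 z = z"
  using gen by (simp add: generates_def C0_semigroup_def)

lemma S_add: "s \<ge> 0 \<Longrightarrow> t \<ge> 0 \<Longrightarrow> S (s + t) z = S s (S t z)"
  using gen by (simp add: generates_def C0_semigroup_def)

lemma S_tendsto_0: "((\<lambda>t. S t z) \<longlongrightarrow> z) (at_right 0)"
  using gen by (simp add: generates_def C0_semigroup_def)

lemma generator_iff:
  "x \<in> D \<and> L x = y \<longleftrightarrow> ((\<lambda>t. (S t x - x) /\<^sub>R t) \<longlongrightarrow> y) (at_right 0)"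
  using gen by (simp add: generates_def)

lemma generator_lim: "z \<in> D \<Longrightarrow> ((\<lambda>t. (S t z - z) /\<^sub>R t) \<longlongrightarrow> L z) (at_right 0)"
  using generator_iff by blast

text \<open>\<open>generates\<close> makes membership in \<open>D\<close> equivalent to the
  existence of the limit of the difference quotient. That quotient is linear in the initial value,
  so linearity of \<open>L\<close> and of its domain follows from the semigroup.\<close>

lemma generator_comb:
  assumes "x \<in> D" "y \<in> D"
  shows "c *\<^sub>R x + d *\<^sub>R y \<in> D \<and> L (c *\<^sub>R x + d *\<^sub>R y) = c *\<^sub>R L x + d *\<^sub>R L y"
proof -
  have "((\<lambda>t. c *\<^sub>R ((S t x - x) /\<^sub>R t) + d *\<^sub>R ((S t y - y) /\<^sub>R t)) \<longlongrightarrow> c *\<^sub>R L x + d *\<^sub>R L y) (at_right 0)"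
    using assms by (intro tendsto_intros generator_lim)
  then show ?thesis
    unfolding generator_iff by (simp add: blinfun.bilinear_simps algebra_simps)
qed

lemma subspace_D: "subspace D"
proof (rule subspaceI)
  have "((\<lambda>t. (S t 0 - 0) /\<^sub>R t) \<longlongrightarrow> 0) (at_right 0)" by simp
  then show "0 \<in> D" using generator_iff by blast
  show "x + y \<in> D" if "x \<in> D" "y \<in> D" for x y
    using generator_comb[OF that, of 1 1] by simp
  show "c *\<^sub>R x \<in> D" if "x \<in> D" for c x
    using generator_comb[OF that that, of c 0] by simp
qed

lemma L_diff: "x \<in> D \<Longrightarrow> y \<in> D \<Longrightarrow> L (x - y) = L x - L y"
  using generator_comb[of x y 1 "-1"] by simp

lemma decay:
  obtains M \<omega> where "M \<ge> 0" "\<omega> > 0" "\<forall>t\<ge>0. \<forall>z. norm (S t z) \<le> M * exp (- \<omega> * t) * norm z"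
proof -
  obtain M \<omega> where *: "\<omega> > 0" "\<And>t. t \<ge> 0 \<Longrightarrow> norm (S t) \<le> M * exp (- \<omega> * t)"
    using stab by (auto simp: exp_stable_def)
  have "norm (S t z) \<le> M * exp (- \<omega> * t) * norm z" if "t \<ge> 0" for t z
    using norm_blinfun[of "S t" z] mult_right_mono[OF *(2)[OF that] norm_ge_zero[of z]] by linarith
  moreover have "M \<ge> 0" using *(2)[of 0] norm_ge_zero[of "S 0"] by (simp del: norm_ge_zero)
  ultimately show thesis using that * by blast
qed

lemma S_bounded:
  obtains M where "M \<ge> 0" "\<forall>t\<ge>0. \<forall>z. norm (S t z) \<le> M * norm z"
proof -
  obtain M \<omega> where *: "M \<ge> 0" "\<omega> > 0" "\<forall>t\<ge>0. \<forall>z. norm (S t z) \<le> M * exp (- \<omega> * t) * norm z"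
    by (rule decay) (rule that)
  have "norm (S t z) \<le> M * norm z" if "t \<ge> 0" for t z
  proof -
    have "M * exp (- \<omega> * t) * norm z \<le> M * 1 * norm z"
      using * that by (intro mult_right_mono mult_left_mono) auto
    then show ?thesis using *(3)[rule_format, OF that, of z] by simp
  qed
  then show thesis using that * by blast
qed

lemma S_tendsto_at_top: "((\<lambda>t. S t z) \<longlongrightarrow> 0) at_top"
proof -
  obtain M \<omega> where *: "M \<ge> 0" "\<omega> > 0" "\<forall>t\<ge>0. \<forall>z. norm (S t z) \<le> M * exp (- \<omega> * t) * norm z"
    by (rule decay) (rule that)
  have "((\<lambda>t. exp (- \<omega> * t)) \<longlongrightarrow> 0) at_top"
    using * by (intro filterlim_compose[OF exp_at_bot] filterlim_tendsto_neg_mult_at_bot[OF tendsto_const])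
      (auto simp: filterlim_ident)
  then have "((\<lambda>t. M * exp (- \<omega> * t) * norm z) \<longlongrightarrow> 0) at_top"
    by (intro tendsto_mult_left_zero tendsto_mult_right_zero)
  moreover have "\<forall>\<^sub>F t in at_top. norm (S t z) \<le> M * exp (- \<omega> * t) * norm z"
    using eventually_ge_at_top[of 0] by eventually_elim (use * in auto)
  ultimately show ?thesis by (rule Lim_null_comparison[rotated])
qed

text \<open>\<open>S t\<close> is bounded and commutes with \<open>S h\<close>, so applying it to
  the difference quotient of \<open>z\<close> at 0 gives that of \<open>S t z\<close>.\<close>

lemma S_D: assumes z: "z \<in> D" and t: "t \<ge> 0" shows "S t z \<in> D" and "L (S t z) = S t (L z)"
proof -
  have "((\<lambda>h. S t ((S h z - z) /\<^sub>R h)) \<longlongrightarrow> S t (L z)) (at_right 0)"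
    by (intro tendsto_intros generator_lim z)
  moreover have "\<forall>\<^sub>F h in at_right 0. S t ((S h z - z) /\<^sub>R h) = (S h (S t z) - S t z) /\<^sub>R h"
    using eventually_at_right_less[of 0]
  proof eventually_elim
    case (elim h)
    have "S h (S t z) = S t (S h z)"
      using S_add[of h t z] S_add[of t h z] elim t by (simp add: add.commute)
    then show ?case by (simp add: blinfun.bilinear_simps)
  qed
  ultimately have "((\<lambda>h. (S h (S t z) - S t z) /\<^sub>R h) \<longlongrightarrow> S t (L z)) (at_right 0)"
    by (rule Lim_transform_eventually)
  then show "S t z \<in> D" "L (S t z) = S t (L z)" using generator_iff by blast+
qed

text \<open>Sends both one-sided limits at \<open>t\<close> to the right-hand limit at 0, the only
  one that the definition of a semigroup provides.\<close>

lemma filterlim_increment: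
  "filterlim (\<lambda>s. \<bar>s - t\<bar>) (at_right 0) (at (t::real) within A)"
proof -
  have "((\<lambda>s. \<bar>s - t\<bar>) \<longlongrightarrow> \<bar>t - t\<bar>) (at t within A)" by (intro tendsto_intros)
  moreover have "\<forall>\<^sub>F s in at t within A. \<bar>s - t\<bar> \<in> {0<..} \<and> \<bar>s - t\<bar> \<noteq> 0"
    by (auto simp: eventually_at intro!: exI[of _ 1])
  ultimately show ?thesis by (auto simp: filterlim_at)
qed

text \<open>The operator at the smaller of the two times factors out and is uniformly bounded, so
  continuity at 0 spreads to every \<open>t\<close>.\<close>

lemma S_continuous:
  assumes t: "t \<ge> 0" shows "((\<lambda>s. S s z) \<longlongrightarrow> S t z) (at t within {0..})"
proof -
  obtain M where M: "M \<ge> 0" "\<forall>t\<ge>0. \<forall>z. norm (S t z) \<le> M * norm z" by (rule S_bounded) (rule that)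
  have "((\<lambda>h. S h z - z) \<longlongrightarrow> z - z) (at_right 0)" by (intro tendsto_intros S_tendsto_0)
  then have "((\<lambda>s. S \<bar>s - t\<bar> z - z) \<longlongrightarrow> 0) (at t within {0..})"
    by (intro filterlim_compose[OF _ filterlim_increment]) simp
  then have lim: "((\<lambda>s. M * norm (S \<bar>s - t\<bar> z - z)) \<longlongrightarrow> 0) (at t within {0..})"
    by (intro tendsto_mult_right_zero) (simp add: tendsto_norm_zero_iff)
  have "norm (S s z - S t z) \<le> M * norm (S \<bar>s - t\<bar> z - z)" if s: "s \<ge> 0" for s
  proof (cases "s \<le> t")
    case True
    then have "S t z - S s z = S s (S \<bar>s - t\<bar> z - z)"
      using S_add[of s "t - s" z] s by (simp add: blinfun.diff_right)
    then have "norm (S s z - S t z) = norm (S s (S \<bar>s - t\<bar> z - z))"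
      by (metis norm_minus_commute)
    then show ?thesis using M(2)[rule_format, OF s] by (simp only:)
  next
    case False
    then have "S s z - S t z = S t (S \<bar>s - t\<bar> z - z)"
      using S_add[of t "s - t" z] t by (simp add: blinfun.diff_right)
    then show ?thesis using M(2)[rule_format, OF t] by (simp only:)
  qed
  then have "\<forall>\<^sub>F s in at t within {0..}. norm (S s z - S t z) \<le> M * norm (S \<bar>s - t\<bar> z - z)"
    by (auto simp: eventually_at intro!: exI[of _ 1])
  from Lim_null_comparison[OF this lim] show ?thesis by (simp add: LIM_zero_iff)
qed

text \<open>For \<open>s\<close> below \<open>t\<close> the operator that factors out is
  \<open>S s\<close>, which moves with \<open>s\<close>; hence the second error term
  \<open>S s (L z) - S t (L z)\<close>. To the right of \<open>t\<close> the fixed operator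
  \<open>S t\<close> factors out.\<close>

lemma S_difference_quotient:
  assumes z: "z \<in> D" and t: "t \<ge> 0"
  shows "((\<lambda>s. (1 / (s - t)) *\<^sub>R (S s z - S t z)) \<longlongrightarrow> S t (L z)) (at t within {0..})"
proof -
  obtain M where M: "M \<ge> 0" "\<forall>t\<ge>0. \<forall>z. norm (S t z) \<le> M * norm z" by (rule S_bounded) (rule that)
  let ?q = "\<lambda>h. (S h z - z) /\<^sub>R h"
  have "((\<lambda>h. ?q h - L z) \<longlongrightarrow> L z - L z) (at_right 0)" by (intro tendsto_intros generator_lim z)
  then have "((\<lambda>s. ?q \<bar>s - t\<bar> - L z) \<longlongrightarrow> 0) (at t within {0..})"
    by (intro filterlim_compose[OF _ filterlim_increment]) simp
  then have "((\<lambda>s. M * norm (?q \<bar>s - t\<bar> - L z)) \<longlongrightarrow> 0) (at t within {0..})"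
    by (intro tendsto_mult_right_zero) (simp add: tendsto_norm_zero_iff)
  moreover have "((\<lambda>s. norm (S s (L z) - S t (L z))) \<longlongrightarrow> 0) (at t within {0..})"
    using S_continuous[OF t, of "L z"] by (simp add: tendsto_norm_zero_iff LIM_zero_iff)
  ultimately have lim: "((\<lambda>s. M * norm (?q \<bar>s - t\<bar> - L z) + norm (S s (L z) - S t (L z))) \<longlongrightarrow> 0 + 0)
      (at t within {0..})"
    by (intro tendsto_add)
  have "norm ((1 / (s - t)) *\<^sub>R (S s z - S t z) - S t (L z))
      \<le> M * norm (?q \<bar>s - t\<bar> - L z) + norm (S s (L z) - S t (L z))" if s: "s \<ge> 0" "s \<noteq> t" for s
  proof (cases "s < t")
    case True
    have eq: "(1 / (s - t)) *\<^sub>R (S s z - S t z) = S s (?q \<bar>s - t\<bar>)"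
    proof -
      have "S t z = S s (S (t - s) z)" using S_add[of s "t - s" z] s True by simp
      moreover have "1 / (s - t) = - inverse (t - s)" using True by (simp add: field_simps)
      ultimately show ?thesis using True by (simp add: blinfun.bilinear_simps algebra_simps)
    qed
    have e2: "(1 / (s - t)) *\<^sub>R (S s z - S t z) - S t (L z) =
        S s (?q \<bar>s - t\<bar> - L z) + (S s (L z) - S t (L z))"
      unfolding eq by (simp add: blinfun.diff_right)
    show ?thesis
      unfolding e2
      using norm_triangle_ineq[of "S s (?q \<bar>s - t\<bar> - L z)" "S s (L z) - S t (L z)"]
        M(2)[rule_format, OF s(1), of "?q \<bar>s - t\<bar> - L z"] by linarith
  next
    case False
    have eq: "(1 / (s - t)) *\<^sub>R (S s z - S t z) = S t (?q \<bar>s - t\<bar>)"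
    proof -
      have "S s z = S t (S (s - t) z)" using S_add[of t "s - t" z] t False by simp
      then show ?thesis using False by (simp add: blinfun.bilinear_simps divide_inverse)
    qed
    have e2: "(1 / (s - t)) *\<^sub>R (S s z - S t z) - S t (L z) = S t (?q \<bar>s - t\<bar> - L z)"
      unfolding eq by (simp add: blinfun.diff_right)
    show ?thesis
      unfolding e2
      using M(2)[rule_format, OF t, of "?q \<bar>s - t\<bar> - L z"] norm_ge_zero[of "S s (L z) - S t (L z)"] by linarith
  qed
  then have "\<forall>\<^sub>F s in at t within {0..}. norm ((1 / (s - t)) *\<^sub>R (S s z - S t z) - S t (L z))
      \<le> M * norm (?q \<bar>s - t\<bar> - L z) + norm (S s (L z) - S t (L z))"
    by (auto simp: eventually_at intro!: exI[of _ 1])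
  from Lim_null_comparison[OF this] lim show ?thesis by (simp add: LIM_zero_iff)
qed

lemma S_has_vector_derivative:
  assumes "z \<in> D" "t \<ge> 0"
  shows "((\<lambda>s. S s z) has_vector_derivative S t (L z)) (at t within {0..})"
proof -
  have "((\<lambda>s. norm ((1 / (s - t)) *\<^sub>R (S s z - S t z) - S t (L z))) \<longlongrightarrow> 0) (at t within {0..})"
    using S_difference_quotient[OF assms] by (simp add: tendsto_norm_zero_iff LIM_zero_iff)
  moreover have "\<forall>\<^sub>F s in at t within {0..}. norm ((1 / (s - t)) *\<^sub>R (S s z - S t z) - S t (L z))
      = norm ((1 / norm (s - t)) *\<^sub>R (S s z - (S t z + (s - t) *\<^sub>R S t (L z))))"
  proof -
    have "norm ((1 / (s - t)) *\<^sub>R (S s z - S t z) - S t (L z))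
        = norm ((1 / norm (s - t)) *\<^sub>R (S s z - (S t z + (s - t) *\<^sub>R S t (L z))))" if "s \<noteq> t" for s
    proof -
      have "(1 / (s - t)) *\<^sub>R (S s z - S t z) - S t (L z)
          = (1 / (s - t)) *\<^sub>R (S s z - (S t z + (s - t) *\<^sub>R S t (L z)))"
        using that by (simp add: scaleR_diff_right scaleR_add_right)
      then show ?thesis by simp
    qed
    then show ?thesis by (auto simp: eventually_at intro!: exI[of _ 1])
  qed
  ultimately have "((\<lambda>s. norm ((1 / norm (s - t)) *\<^sub>R (S s z - (S t z + (s - t) *\<^sub>R S t (L z))))) \<longlongrightarrow> 0)
      (at t within {0..})"
    by (rule Lim_transform_eventually)
  then show ?thesis
    unfolding has_vector_derivative_def has_derivative_within tendsto_norm_zero_iff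
    by (simp add: bounded_linear_scaleR_left)
qed

lemma norm_S_sq_deriv:
  assumes "z \<in> D" "t \<ge> 0"
  shows "((\<lambda>s. (norm (S s z))\<^sup>2) has_real_derivative 2 * inner (L (S t z)) (S t z)) (at t within {0..})"
  using bounded_bilinear.has_vector_derivative[OF bounded_bilinear_inner
      S_has_vector_derivative[OF assms] S_has_vector_derivative[OF assms]]
  by (simp add: has_real_derivative_iff_has_vector_derivative power2_norm_eq_inner S_D[OF assms] inner_commute)

section \<open>Forms controlled by the dissipation\<close>

text \<open>Stands in for the norm of \<open>V\<close>: it bounds an argument both with and without
  \<open>NY\<close> in front, and the dissipation controls its square along orbits in
  \<open>D\<close>.\<close>

definition weight :: "'y \<Rightarrow> real" where
  "weight z = norm z + norm (NY z)"

text \<open>On sets bounded in \<open>Y\<close>, a form of growth \<open>p\<close> contains the operator \<open>NY\<close> at most \<open>p\<close> times.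
  Growth 2 is what the dissipation integrates along the flow.\<close>

definition growth :: "nat \<Rightarrow> nat \<Rightarrow> ('y list \<Rightarrow> real) \<Rightarrow> bool" where
  "growth p k F \<longleftrightarrow> (\<forall>r. \<exists>C\<ge>0. \<forall>zs\<in>tuples D k. (\<forall>z\<in>set zs. norm z \<le> r) \<longrightarrow>
     \<bar>F zs\<bar> \<le> C * (\<Sum>z\<leftarrow>zs. weight z) ^ p)"

text \<open>Symmetry is carried along because that of a symmetrized tensor product rests on the
  symmetry of the factors.\<close>

definition controlled :: "nat \<Rightarrow> nat \<Rightarrow> ('y list \<Rightarrow> real) \<Rightarrow> bool" where
  "controlled p k F \<longleftrightarrow> multilinear_on D k F \<and> symmetric_on D k F \<and> growth p k F"

lemma weight_nonneg: "weight z \<ge> 0"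
  by (simp add: weight_def)

lemma weights_nonneg: "(\<Sum>z\<leftarrow>zs. weight z) \<ge> 0"
  by (induction zs) (auto simp: weight_nonneg)

lemma weight_le_weights: "z \<in> set zs \<Longrightarrow> weight z \<le> (\<Sum>z\<leftarrow>zs. weight z)"
  by (induction zs) (auto simp: weight_nonneg weights_nonneg add_increasing add_increasing2)

section \<open>Growth under algebraic operations\<close>

lemma growth_cmult:
  assumes "growth p k F" shows "growth p k (\<lambda>zs. c * F zs)"
  unfolding growth_def
proof
  fix r
  obtain C where C: "C \<ge> 0" "\<forall>zs\<in>tuples D k. (\<forall>z\<in>set zs. norm z \<le> r) \<longrightarrow>
     \<bar>F zs\<bar> \<le> C * (\<Sum>z\<leftarrow>zs. weight z) ^ p"
    using assms unfolding growth_def by meson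
  have "\<bar>c * F zs\<bar> \<le> (\<bar>c\<bar> * C) * (\<Sum>z\<leftarrow>zs. weight z) ^ p" if "zs \<in> tuples D k" "\<forall>z\<in>set zs. norm z \<le> r" for zs
    using mult_left_mono[OF C(2)[rule_format, OF that(1)], of "\<bar>c\<bar>"] that(2) by (simp add: abs_mult mult.assoc)
  then show "\<exists>C\<ge>0. \<forall>zs\<in>tuples D k. (\<forall>z\<in>set zs. norm z \<le> r) \<longrightarrow>
     \<bar>c * F zs\<bar> \<le> C * (\<Sum>z\<leftarrow>zs. weight z) ^ p"
    using C(1) by (intro exI[of _ "\<bar>c\<bar> * C"]) auto
qed

lemma growth_add:
  assumes "growth p k F" "growth p k G" shows "growth p k (\<lambda>zs. F zs + G zs)"
  unfolding growth_def
proof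
  fix r
  obtain C where C: "C \<ge> 0" "\<forall>zs\<in>tuples D k. (\<forall>z\<in>set zs. norm z \<le> r) \<longrightarrow>
     \<bar>F zs\<bar> \<le> C * (\<Sum>z\<leftarrow>zs. weight z) ^ p"
    using assms(1) unfolding growth_def by meson
  obtain E where E: "E \<ge> 0" "\<forall>zs\<in>tuples D k. (\<forall>z\<in>set zs. norm z \<le> r) \<longrightarrow>
     \<bar>G zs\<bar> \<le> E * (\<Sum>z\<leftarrow>zs. weight z) ^ p"
    using assms(2) unfolding growth_def by meson
  have "\<bar>F zs + G zs\<bar> \<le> (C + E) * (\<Sum>z\<leftarrow>zs. weight z) ^ p" if "zs \<in> tuples D k" "\<forall>z\<in>set zs. norm z \<le> r" for zs
    using C(2)[rule_format, OF that(1)] E(2)[rule_format, OF that(1)] that(2) by (simp add: distrib_right)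
  then show "\<exists>C\<ge>0. \<forall>zs\<in>tuples D k. (\<forall>z\<in>set zs. norm z \<le> r) \<longrightarrow>
     \<bar>F zs + G zs\<bar> \<le> C * (\<Sum>z\<leftarrow>zs. weight z) ^ p"
    using C(1) E(1) by (intro exI[of _ "C + E"]) auto
qed

lemma growth_zero: "growth p k (\<lambda>zs. 0)"
  unfolding growth_def by (auto intro!: exI[of _ 0])

lemma growth_sum:
  assumes "finite I" "\<And>a. a \<in> I \<Longrightarrow> growth p k (F a)"
  shows "growth p k (\<lambda>zs. \<Sum>a\<in>I. F a zs)"
  using assms by (induction rule: finite_induct) (simp_all add: growth_zero growth_add)

lemma growth_permute_list:
  assumes F: "growth p k F" and \<sigma>: "\<sigma> permutes {..<k}"
  shows "growth p k (\<lambda>zs. F (permute_list \<sigma> zs))"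
  unfolding growth_def
proof
  fix r
  obtain C where C: "C \<ge> 0" "\<forall>zs\<in>tuples D k. (\<forall>z\<in>set zs. norm z \<le> r) \<longrightarrow>
     \<bar>F zs\<bar> \<le> C * (\<Sum>z\<leftarrow>zs. weight z) ^ p"
    using F unfolding growth_def by meson
  have "\<bar>F (permute_list \<sigma> zs)\<bar> \<le> C * (\<Sum>z\<leftarrow>zs. weight z) ^ p"
    if zs: "zs \<in> tuples D k" and r: "\<forall>z\<in>set zs. norm z \<le> r" for zs
  proof -
    have \<sigma>': "\<sigma> permutes {..<length zs}" using zs \<sigma> by (simp add: tuples_def)
    have "(\<Sum>z\<leftarrow>permute_list \<sigma> zs. weight z) = (\<Sum>z\<leftarrow>zs. weight z)"
      using mset_permute_list[OF \<sigma>'] by (metis mset_map sum_mset_sum_list)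
    then show ?thesis
      using C(2)[rule_format, OF tuples_permute_list[OF zs \<sigma>]] r set_permute_list[OF \<sigma>'] by simp
  qed
  then show "\<exists>C\<ge>0. \<forall>zs\<in>tuples D k. (\<forall>z\<in>set zs. norm z \<le> r) \<longrightarrow>
     \<bar>F (permute_list \<sigma> zs)\<bar> \<le> C * (\<Sum>z\<leftarrow>zs. weight z) ^ p"
    using C(1) by blast
qed

text \<open>Each factor is linear in the weights of its own arguments, so the product is at most
  quadratic in the sum of all weights.\<close>

lemma growth_tensor:
  assumes F: "growth 1 i F" and G: "growth 1 j G"
  shows "growth 2 (i + j) (tensor i F G)"
  unfolding growth_def
proof
  fix r
  obtain C where C: "C \<ge> 0" "\<forall>zs\<in>tuples D i. (\<forall>z\<in>set zs. norm z \<le> r) \<longrightarrow>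
     \<bar>F zs\<bar> \<le> C * (\<Sum>z\<leftarrow>zs. weight z) ^ 1"
    using F unfolding growth_def by meson
  obtain E where E: "E \<ge> 0" "\<forall>zs\<in>tuples D j. (\<forall>z\<in>set zs. norm z \<le> r) \<longrightarrow>
     \<bar>G zs\<bar> \<le> E * (\<Sum>z\<leftarrow>zs. weight z) ^ 1"
    using G unfolding growth_def by meson
  have "\<bar>tensor i F G zs\<bar> \<le> (C * E) * (\<Sum>z\<leftarrow>zs. weight z) ^ 2"
    if zs: "zs \<in> tuples D (i + j)" and r: "\<forall>z\<in>set zs. norm z \<le> r" for zs
  proof -
    let ?a = "take i zs" and ?b = "drop i zs"
    have "?a \<in> tuples D i" "?b \<in> tuples D j"
      using zs by (auto simp: tuples_def dest: in_set_takeD in_set_dropD)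
    moreover have "\<forall>z\<in>set ?a. norm z \<le> r" "\<forall>z\<in>set ?b. norm z \<le> r"
      using r by (auto dest: in_set_takeD in_set_dropD)
    ultimately have "\<bar>F ?a\<bar> \<le> C * (\<Sum>z\<leftarrow>?a. weight z)" "\<bar>G ?b\<bar> \<le> E * (\<Sum>z\<leftarrow>?b. weight z)"
      using C(2) E(2) by auto
    moreover have "(\<Sum>z\<leftarrow>zs. weight z) = (\<Sum>z\<leftarrow>?a. weight z) + (\<Sum>z\<leftarrow>?b. weight z)"
      by (metis append_take_drop_id map_append sum_list_append)
    ultimately have "\<bar>F ?a\<bar> \<le> C * (\<Sum>z\<leftarrow>zs. weight z)" "\<bar>G ?b\<bar> \<le> E * (\<Sum>z\<leftarrow>zs. weight z)"
      using weights_nonneg[of ?a] weights_nonneg[of ?b] C(1) E(1)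
      by (auto elim!: order_trans intro!: mult_left_mono)
    then have "\<bar>F ?a\<bar> * \<bar>G ?b\<bar> \<le> (C * (\<Sum>z\<leftarrow>zs. weight z)) * (E * (\<Sum>z\<leftarrow>zs. weight z))"
      using C(1) weights_nonneg by (intro mult_mono) auto
    then show ?thesis by (simp add: tensor_def abs_mult power2_eq_square mult_ac)
  qed
  then show "\<exists>C\<ge>0. \<forall>zs\<in>tuples D (i + j). (\<forall>z\<in>set zs. norm z \<le> r) \<longrightarrow>
     \<bar>tensor i F G zs\<bar> \<le> C * (\<Sum>z\<leftarrow>zs. weight z) ^ 2"
    using C(1) E(1) by (intro exI[of _ "C * E"]) auto
qed

lemma growth_Sym: "growth p (i + j) F \<Longrightarrow> growth p (i + j) (Sym i j F)"
proof -
  assume F: "growth p (i + j) F"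
  have "growth p (i + j) (\<lambda>zs. (1 / real ((i + j) choose i)) *
      (\<Sum>\<sigma>\<in>shuffle_perms i j. F (permute_list \<sigma> zs)))"
    using F by (intro growth_cmult growth_sum growth_permute_list finite_shuffle_perms)
      (auto simp: shuffle_perms_def)
  then show ?thesis unfolding Sym_def[abs_def] by simp
qed

lemma controlled_cmult: "controlled p k F \<Longrightarrow> controlled p k (\<lambda>zs. c * F zs)"
  by (simp add: controlled_def multilinear_on_cmult growth_cmult symmetric_on_def)

lemma controlled_add: "controlled p k F \<Longrightarrow> controlled p k G \<Longrightarrow> controlled p k (\<lambda>zs. F zs + G zs)"
  by (simp add: controlled_def multilinear_on_add growth_add symmetric_on_def)

lemma controlled_sum:
  "finite I \<Longrightarrow> (\<And>a. a \<in> I \<Longrightarrow> controlled p k (F a)) \<Longrightarrow> controlled p k (\<lambda>zs. \<Sum>a\<in>I. F a zs)"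
  by (simp add: controlled_def multilinear_on_sum growth_sum symmetric_on_sum)

lemma controlled_Sym_tensor:
  "controlled 1 i F \<Longrightarrow> controlled 1 j G \<Longrightarrow> controlled 2 (i + j) (Sym i j (tensor i F G))"
  by (simp add: controlled_def multilinear_on_Sym multilinear_on_tensor growth_Sym growth_tensor
      symmetric_on_Sym_tensor)

text \<open>One argument must be left to supply the weight, hence \<open>i \<ge> 1\<close>; the
  remaining slots, \<open>B\<close> included, are bounded by \<open>max r (norm B)\<close>.\<close>

lemma controlled_form_C:
  assumes T: "T (Suc i) \<in> bounded_multilinear_forms UNIV norm (Suc i)"
    and sym: "symmetric_on UNIV (Suc i) (T (Suc i))" and i: "i \<ge> 1"
  shows "controlled 1 i (form_C B T i)"
proof -
  have ml: "multilinear_on UNIV (Suc i) (T (Suc i))"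
    using T by (simp add: bounded_multilinear_forms_def)
  have "multilinear_on D i (form_C B T i)"
    unfolding form_C_def[abs_def] using multilinear_on_Cons[OF ml UNIV_I]
    by (auto intro: multilinear_on_subset)
  moreover have "symmetric_on D i (form_C B T i)"
    unfolding symmetric_on_mset form_C_def
  proof (intro ballI impI)
    fix xs ys assume "xs \<in> tuples D i" "ys \<in> tuples D i" "mset xs = mset ys"
    then show "T (i + 1) (B # xs) = T (i + 1) (B # ys)"
      using symmetric_onD[OF sym, of "B # xs" "B # ys"] by (simp add: tuples_def)
  qed
  moreover have "growth 1 i (form_C B T i)"
    unfolding growth_def
  proof
    fix r
    obtain C where C: "C \<ge> 0"
      "\<forall>x m. (\<forall>j<Suc i. x j \<in> UNIV) \<longrightarrow> m < Suc i \<longrightarrow> (\<forall>j<Suc i. j \<noteq> m \<longrightarrow> norm (x j) \<le> max r (norm B))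
        \<longrightarrow> \<bar>T (Suc i) (tup (Suc i) x)\<bar> \<le> C * norm (x m)"
      using normed_UNIV.slot_bound[OF T, of "max r (norm B)"] by blast
    have "\<bar>form_C B T i zs\<bar> \<le> C * (\<Sum>z\<leftarrow>zs. weight z) ^ 1"
      if zs: "zs \<in> tuples D i" and r: "\<forall>z\<in>set zs. norm z \<le> r" for zs
    proof -
      have len: "length zs = i" using zs by (simp add: tuples_def)
      have tup: "tup (Suc i) ((!) (B # zs)) = B # zs"
        using len by (intro tup_nth[of _ UNIV]) (simp add: tuples_def)
      have "norm ((B # zs) ! j) \<le> max r (norm B)" if "j < Suc i" for j
      proof -
        have "(B # zs) ! j \<in> set (B # zs)" using that len by (intro nth_mem) simp
        then show ?thesis using r by (auto simp: le_max_iff_disj)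
      qed
      \<comment> \<open>Position 0 holds \<open>B\<close>, so position 1 is the first genuine
        argument.\<close>
      then have "\<bar>T (Suc i) (B # zs)\<bar> \<le> C * norm ((B # zs) ! 1)"
        using C(2)[rule_format, of "(!) (B # zs)" 1] i unfolding tup by simp
      also have "norm ((B # zs) ! 1) \<le> weight (zs ! 0)" using i len by (simp add: weight_def)
      also have "\<dots> \<le> (\<Sum>z\<leftarrow>zs. weight z)" using i len by (intro weight_le_weights) auto
      finally show ?thesis using C(1) by (simp add: form_C_def mult_left_mono)
    qed
    then show "\<exists>C\<ge>0. \<forall>zs\<in>tuples D i. (\<forall>z\<in>set zs. norm z \<le> r) \<longrightarrow>
        \<bar>form_C B T i zs\<bar> \<le> C * (\<Sum>z\<leftarrow>zs. weight z) ^ 1"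
      using C(1) by blast
  qed
  ultimately show ?thesis by (simp add: controlled_def)
qed

text \<open>In the summand with \<open>NY\<close> in slot \<open>l\<close>, the bound that is linear
  in that slot yields the weight of \<open>zs ! l\<close>, while the other slots stay below
  \<open>r\<close>. A permutation of the arguments only reindexes the summands.\<close>

lemma controlled_insert_op:
  assumes T: "T \<in> bounded_multilinear_forms UNIV norm k" and sym: "symmetric_on UNIV k T"
  shows "controlled 1 k (insert_op NY k T)"
proof -
  have ml: "multilinear_on UNIV k T"
    using T by (simp add: bounded_multilinear_forms_def)
  have "multilinear_on D k (insert_op NY k T)"
    unfolding insert_op_def[abs_def]
  proof (rule multilinear_on_sum)
    fix l assume "l \<in> {..<k}"
    show "multilinear_on D k (\<lambda>zs. T (zs[l := NY (zs ! l)]))"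
      unfolding multilinear_on_def
    proof (intro ballI allI impI)
      fix zs m x y c d assume *: "zs \<in> tuples D k" "m < k" "x \<in> D" "y \<in> D"
      then have len: "length zs = k" by (simp add: tuples_def)
      show "T (zs[m := c *\<^sub>R x + d *\<^sub>R y, l := NY (zs[m := c *\<^sub>R x + d *\<^sub>R y] ! l)]) =
          c * T (zs[m := x, l := NY (zs[m := x] ! l)]) + d * T (zs[m := y, l := NY (zs[m := y] ! l)])"
      proof (cases "l = m")
        case True
        have "zs \<in> tuples UNIV k" using len by (simp add: tuples_def)
        from multilinear_onD[OF ml this *(2), of "NY x" "NY y" c d] True show ?thesis
          using * len by (simp add: N_lin)
      next
        case False
        have "zs[l := NY (zs ! l)] \<in> tuples UNIV k" using len by (simp add: tuples_def)
        from multilinear_onD[OF ml this *(2), of x y c d] False show ?thesis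
          by (simp add: list_update_swap)
      qed
    qed
  qed
  moreover have "symmetric_on D k (insert_op NY k T)"
    unfolding symmetric_on_def
  proof (intro ballI allI impI)
    fix zs and \<sigma> :: "nat \<Rightarrow> nat" assume zs: "zs \<in> tuples D k" and \<sigma>: "\<sigma> permutes {..<k}"
    have len: "length zs = k" using zs by (simp add: tuples_def)
    have \<sigma>': "\<sigma> permutes {..<length zs}" using \<sigma> len by simp
    have "T ((permute_list \<sigma> zs)[l := NY (permute_list \<sigma> zs ! l)]) = T (zs[\<sigma> l := NY (zs ! \<sigma> l)])"
      if l: "l < k" for l
    proof (rule symmetric_onD[OF sym])
      have \<sigma>l: "\<sigma> l < k" using permutes_in_image[OF \<sigma>, of l] l by simp
      show "mset ((permute_list \<sigma> zs)[l := NY (permute_list \<sigma> zs ! l)]) = mset (zs[\<sigma> l := NY (zs ! \<sigma> l)])"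
        using l \<sigma>l len \<sigma>' by (simp add: mset_update permute_list_nth)
    qed (use len in \<open>auto simp: tuples_def\<close>)
    then have "insert_op NY k T (permute_list \<sigma> zs) = (\<Sum>l<k. T (zs[\<sigma> l := NY (zs ! \<sigma> l)]))"
      by (simp add: insert_op_def)
    also have "\<dots> = insert_op NY k T zs"
      unfolding insert_op_def
      by (rule sum.reindex_bij_betw[OF permutes_imp_bij[OF \<sigma>], of "\<lambda>l. T (zs[l := NY (zs ! l)])"])
    finally show "insert_op NY k T (permute_list \<sigma> zs) = insert_op NY k T zs" .
  qed
  moreover have "growth 1 k (insert_op NY k T)"
    unfolding growth_def
  proof
    fix r
    obtain C where C: "C \<ge> 0"
      "\<forall>x m. (\<forall>j<k. x j \<in> UNIV) \<longrightarrow> m < k \<longrightarrow> (\<forall>j<k. j \<noteq> m \<longrightarrow> norm (x j) \<le> r)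
        \<longrightarrow> \<bar>T (tup k x)\<bar> \<le> C * norm (x m)"
      using normed_UNIV.slot_bound[OF T, of r] by blast
    have "\<bar>insert_op NY k T zs\<bar> \<le> C * (\<Sum>z\<leftarrow>zs. weight z) ^ 1"
      if zs: "zs \<in> tuples D k" and r: "\<forall>z\<in>set zs. norm z \<le> r" for zs
    proof -
      have len: "length zs = k" using zs by (simp add: tuples_def)
      have "\<bar>T (zs[l := NY (zs ! l)])\<bar> \<le> C * weight (zs ! l)" if l: "l < k" for l
      proof -
        let ?x = "((!) zs)(l := NY (zs ! l))"
        have tup: "zs[l := NY (zs ! l)] = tup k ?x"
          using zs l by (metis tup_nth tup_update)
        have "\<forall>j<k. j \<noteq> l \<longrightarrow> norm (?x j) \<le> r" using r len by auto
        then have "\<bar>T (tup k ?x)\<bar> \<le> C * norm (?x l)" using C(2) l by blast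
        also have "\<dots> \<le> C * weight (zs ! l)"
          using C(1) by (intro mult_left_mono) (auto simp: weight_def)
        finally show ?thesis by (simp only: tup)
      qed
      then have "\<bar>insert_op NY k T zs\<bar> \<le> (\<Sum>l<k. C * weight (zs ! l))"
        unfolding insert_op_def by (intro order_trans[OF sum_abs] sum_mono) auto
      also have "\<dots> = C * (\<Sum>z\<leftarrow>zs. weight z)"
        using len by (simp add: sum_list_sum_nth sum_distrib_left atLeast0LessThan)
      finally show ?thesis by simp
    qed
    then show "\<exists>C\<ge>0. \<forall>zs\<in>tuples D k. (\<forall>z\<in>set zs. norm z \<le> r) \<longrightarrow>
        \<bar>insert_op NY k T zs\<bar> \<le> C * (\<Sum>z\<leftarrow>zs. weight z) ^ 1"
      using C(1) by blast
  qed
  ultimately show ?thesis by (simp add: controlled_def)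
qed

text \<open>\<open>form_C\<close> of index \<open>i\<close> uses \<open>T\<close> of order
  \<open>i + 1\<close> with \<open>i\<close> at most \<open>k - 2\<close>, and \<open>form_G\<close>
  goes up to index \<open>k - 1\<close>; hence only orders below \<open>k\<close> enter.\<close>

lemma controlled_rhs_form:
  assumes T: "\<And>j. 2 \<le> j \<Longrightarrow> j < k \<Longrightarrow>
      T j \<in> bounded_multilinear_forms UNIV norm j \<and> symmetric_on UNIV j (T j)"
    and k: "k \<ge> 3"
  shows "controlled 2 k (rhs_form B NY T k)"
proof -
  have C: "controlled 1 i (form_C B T i)" if "1 \<le> i" "i \<le> k - 2" for i
    using T[of "Suc i"] that k by (intro controlled_form_C) auto
  have G: "controlled 1 i (form_G NY T i)" if "2 \<le> i" "i \<le> k - 1" for i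
    unfolding form_G_def[abs_def]
    using T[of i] that k by (intro controlled_cmult controlled_insert_op) auto
  have CG: "controlled 1 i (form_CG B NY T i)" if "2 \<le> i" "i \<le> k - 2" for i
    unfolding form_CG_def[abs_def]
    using that by (intro controlled_add controlled_cmult C G) auto
  have "controlled 2 k (Sym 1 (k - 1) (tensor 1 (form_C B T 1) (form_G NY T (k - 1))))"
    using controlled_Sym_tensor[OF C[of 1] G[of "k - 1"]] k by simp
  moreover have "controlled 2 k (Sym i (k - i) (tensor i (form_CG B NY T i) (form_CG B NY T (k - i))))"
    if "i \<in> {2..k - 2}" for i
  proof -
    have "2 \<le> i" "i \<le> k - 2" "2 \<le> k - i" "k - i \<le> k - 2" "i + (k - i) = k" using that by auto
    then show ?thesis using controlled_Sym_tensor[OF CG[of i] CG[of "k - i"]] by simp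
  qed
  ultimately show ?thesis
    unfolding rhs_form_def[abs_def]
    by (intro controlled_add controlled_cmult controlled_sum) auto
qed

lemma weight_le:
  assumes "z \<in> D" shows "(weight z)\<^sup>2 \<le> (2 + 2 * J) * (norm z)\<^sup>2 - 2 * K * inner (L z) z"
proof -
  have "(weight z)\<^sup>2 \<le> 2 * (norm z)\<^sup>2 + 2 * (norm (NY z))\<^sup>2"
    unfolding weight_def using zero_le_power2[of "norm z - norm (NY z)"] by (simp add: power2_eq_square algebra_simps)
  also have "\<dots> \<le> 2 * (norm z)\<^sup>2 + 2 * (J * (norm z)\<^sup>2 - K * inner (L z) z)"
    using N_bound[OF assms] by simp
  finally show ?thesis by (simp add: algebra_simps)
qed

text \<open>The norm \<open>n\<close> is left open because the bound is needed for the graph norms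
  of both the closed-loop operator and \<open>A\<close>.\<close>

lemma controlled_bounded:
  assumes F: "controlled p k F"
    and n: "\<And>z. z \<in> D \<Longrightarrow> norm z \<le> n z" "\<And>z. z \<in> D \<Longrightarrow> weight z \<le> c * n z"
  shows "F \<in> bounded_multilinear_forms D n k"
proof -
  obtain C where C: "C \<ge> 0" "\<forall>zs\<in>tuples D k. (\<forall>z\<in>set zs. norm z \<le> 1) \<longrightarrow>
     \<bar>F zs\<bar> \<le> C * (\<Sum>z\<leftarrow>zs. weight z) ^ p"
    using F unfolding controlled_def growth_def by meson
  have "\<bar>F zs\<bar> \<le> C * (real k * \<bar>c\<bar>) ^ p" if zs: "zs \<in> tuples D k" and le: "\<forall>z\<in>set zs. n z \<le> 1" for zs
  proof -
    have z: "norm z \<le> 1 \<and> weight z \<le> \<bar>c\<bar>" if "z \<in> set zs" for z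
    proof -
      have "z \<in> D" using zs that by (auto simp: tuples_def)
      then have *: "norm z \<le> n z" "weight z \<le> c * n z" "n z \<le> 1" using n le that by auto
      have "0 \<le> n z" using *(1) norm_ge_zero[of z] by linarith
      then have "c * n z \<le> \<bar>c\<bar> * 1" using * by (intro mult_mono) auto
      then show ?thesis using * by linarith
    qed
    have "(\<Sum>z\<leftarrow>zs. weight z) \<le> (\<Sum>z\<leftarrow>zs. \<bar>c\<bar>)" using z by (intro sum_list_mono) auto
    also have "\<dots> = real k * \<bar>c\<bar>" using zs by (simp add: tuples_def sum_list_triv)
    finally have "(\<Sum>z\<leftarrow>zs. weight z) ^ p \<le> (real k * \<bar>c\<bar>) ^ p"
      by (intro power_mono weights_nonneg)
    then show ?thesis using C zs z by (meson mult_left_mono order_trans)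
  qed
  then show ?thesis
    using F by (auto simp: bounded_multilinear_forms_def controlled_def)
qed

lemma normed_domain_graph: "normed_domain D (graph_norm L)"
proof (rule normed_domain.intro)
  show "subspace D" by (rule subspace_D)
  show "graph_norm L (c *\<^sub>R x) = \<bar>c\<bar> * graph_norm L x" if "x \<in> D" for x c
    using generator_comb[OF that that, of c 0] by (simp add: graph_norm_def algebra_simps)
  show "graph_norm L (x + y) \<le> graph_norm L x + graph_norm L y" if "x \<in> D" "y \<in> D" for x y
    using generator_comb[OF that, of 1 1] norm_triangle_ineq[of x y] norm_triangle_ineq[of "L x" "L y"]
    by (simp add: graph_norm_def)
  show "norm x \<le> graph_norm L x" if "x \<in> D" for x by (simp add: graph_norm_def)
qed

text \<open>By Cauchy-Schwarz, \<open>- inner (L z) z\<close> is at most the squared graph norm;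
  inserted into \<open>weight_le\<close>, this gives the constant.\<close>

lemma weight_le_graph: "z \<in> D \<Longrightarrow> weight z \<le> sqrt (2 + 2 * J + 2 * K) * graph_norm L z"
proof -
  assume z: "z \<in> D"
  let ?g = "graph_norm L z"
  have g: "norm z \<le> ?g" "norm (L z) \<le> ?g" "0 \<le> ?g" by (auto simp: graph_norm_def)
  have "- inner (L z) z \<le> norm (L z) * norm z"
    using norm_cauchy_schwarz[of "- L z" z] by simp
  also have "\<dots> \<le> ?g * ?g" using g by (intro mult_mono) auto
  finally have "- (2 * K * inner (L z) z) \<le> 2 * K * ?g\<^sup>2"
    using mult_left_mono[of "- inner (L z) z" "?g * ?g" "2 * K"] K_nonneg by (simp add: power2_eq_square)
  moreover have "(2 + 2 * J) * (norm z)\<^sup>2 \<le> (2 + 2 * J) * ?g\<^sup>2"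
    using g J_nonneg by (intro mult_left_mono power_mono) auto
  ultimately have "(weight z)\<^sup>2 \<le> (2 + 2 * J + 2 * K) * ?g\<^sup>2"
    using weight_le[OF z] unfolding distrib_right by linarith
  also have "\<dots> = (sqrt (2 + 2 * J + 2 * K) * ?g)\<^sup>2" using J_nonneg K_nonneg by (simp add: power_mult_distrib)
  finally show ?thesis
    by (rule power2_le_imp_le) (use g J_nonneg K_nonneg in auto)
qed

section \<open>The Lyapunov equation\<close>

lemma map_flow: "zs \<in> tuples X k \<Longrightarrow> map f zs = tup k (\<lambda>i. f (zs ! i))"
  by (simp add: tuples_def list_eq_iff_nth_eq)

lemma flow_in_tuples: "zs \<in> tuples D k \<Longrightarrow> t \<ge> 0 \<Longrightarrow> map (S t) zs \<in> tuples D k"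
  by (auto simp: tuples_def S_D)

text \<open>Boundedness of \<open>R\<close> is assumed in the graph norm only. Orbits in
  \<open>D\<close> are continuous in that norm because \<open>L\<close> commutes with the
  semigroup.\<close>

lemma flow_form_continuous:
  assumes R: "R \<in> bounded_multilinear_forms D (graph_norm L) k" and zs: "zs \<in> tuples D k"
  shows "continuous_on {0..} (\<lambda>t. R (map (S t) zs))"
  unfolding continuous_on_def
proof
  fix t :: real assume "t \<in> {0..}"
  then have t: "t \<ge> 0" by simp
  interpret normed_domain D "graph_norm L" by (rule normed_domain_graph)
  have z: "zs ! i \<in> D" if "i < k" for i using zs that by (rule tuples_nth)
  have ev: "\<forall>\<^sub>F s in at t within {0..}. s \<ge> 0"
    by (auto simp: eventually_at intro!: exI[of _ 1])
  have "((\<lambda>s. R (tup k (\<lambda>i. S s (zs ! i)))) \<longlongrightarrow> R (tup k (\<lambda>i. S t (zs ! i)))) (at t within {0..})"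
  proof (rule tendsto_form[OF R])
    fix i assume i: "i < k"
    show "\<forall>\<^sub>F s in at t within {0..}. S s (zs ! i) \<in> D"
      using ev by eventually_elim (use S_D z[OF i] in auto)
    show "S t (zs ! i) \<in> D" using S_D t z[OF i] by auto
    have "((\<lambda>s. norm (S s (zs ! i) - S t (zs ! i)) + norm (S s (L (zs ! i)) - S t (L (zs ! i)))) \<longlongrightarrow> 0 + 0)
        (at t within {0..})"
      using S_continuous[OF t] by (intro tendsto_add) (simp_all add: tendsto_norm_zero_iff LIM_zero_iff)
    moreover have "\<forall>\<^sub>F s in at t within {0..}. norm (S s (zs ! i) - S t (zs ! i)) + norm (S s (L (zs ! i)) - S t (L (zs ! i)))
        = graph_norm L (S s (zs ! i) - S t (zs ! i))"
      using ev by eventually_elim (use S_D[OF z[OF i]] t in \<open>simp add: graph_norm_def L_diff\<close>)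
    ultimately show "((\<lambda>s. graph_norm L (S s (zs ! i) - S t (zs ! i))) \<longlongrightarrow> 0) (at t within {0..})"
      using Lim_transform_eventually by fastforce
  qed
  then show "((\<lambda>s. R (map (S s) zs)) \<longlongrightarrow> R (map (S t) zs)) (at t within {0..})"
    by (simp only: map_flow[OF zs])
qed

lemma controlled_bounded_graph:
  "controlled p k F \<Longrightarrow> F \<in> bounded_multilinear_forms D (graph_norm L) k"
  using controlled_bounded[of p k F "graph_norm L" "sqrt (2 + 2 * J + 2 * K)"] weight_le_graph
  by (auto simp: graph_norm_def)

text \<open>The majorant is \<open>- \<Phi>'\<close> for an explicit \<open>\<Phi>\<close>, and only
  \<open>\<Phi> 0\<close> survives in the bound. It contains neither \<open>L\<close> nor
  \<open>NY\<close>, so \<open>E\<close> depends on the radius \<open>r\<close> and not on graph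
  norms.\<close>

lemma controlled_integral:
  assumes R: "controlled 2 k R"
  obtains E where "\<forall>zs\<in>tuples D k. (\<forall>z\<in>set zs. norm z \<le> r) \<longrightarrow>
    (\<exists>l. ((\<lambda>\<tau>. integral {0..\<tau>} (\<lambda>t. R (map (S t) zs))) \<longlongrightarrow> l) at_top \<and> \<bar>l\<bar> \<le> E)"
proof -
  obtain M \<omega> where M: "M \<ge> 0" "\<omega> > 0" "\<forall>t\<ge>0. \<forall>z. norm (S t z) \<le> M * exp (- \<omega> * t) * norm z"
    by (rule decay) (rule that)
  \<comment> \<open>Bounds whole orbits; the absolute value keeps it nonnegative for every
    \<open>r\<close>.\<close>
  define \<rho> where "\<rho> = M * \<bar>r\<bar>"
  have "growth 2 k R" using R by (simp add: controlled_def)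
  then obtain C where C: "C \<ge> 0" "\<forall>zs\<in>tuples D k. (\<forall>z\<in>set zs. norm z \<le> \<rho>) \<longrightarrow>
     \<bar>R zs\<bar> \<le> C * (\<Sum>z\<leftarrow>zs. weight z) ^ 2"
    unfolding growth_def by meson
  define c where "c = (2 + 2 * J) * \<rho>\<^sup>2"
  \<comment> \<open>The value of \<open>\<Phi>\<close> at 0 with \<open>r\<close> in place of the
    norms of the arguments.\<close>
  define E where "E = C * real k * (\<Sum>i<k. c / (2 * \<omega>) + K * r\<^sup>2)"
  have main: "\<exists>l. ((\<lambda>\<tau>. integral {0..\<tau>} (\<lambda>t. R (map (S t) zs))) \<longlongrightarrow> l) at_top \<and> \<bar>l\<bar> \<le> E"
    if zs: "zs \<in> tuples D k" and r: "\<forall>z\<in>set zs. norm z \<le> r" for zs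
  proof -
    let ?y = "\<lambda>i t. S t (zs ! i)"
    have len: "length zs = k" using zs by (simp add: tuples_def)
    have z: "zs ! i \<in> D" "norm (zs ! i) \<le> r" if "i < k" for i
      using zs r that len by (auto intro: tuples_nth)
    have y: "norm (?y i t) \<le> \<rho> * exp (- \<omega> * t)" if "i < k" "t \<ge> 0" for i t
    proof -
      have "M * exp (- \<omega> * t) * norm (zs ! i) \<le> M * exp (- \<omega> * t) * \<bar>r\<bar>"
        using M z[OF that(1)] by (intro mult_left_mono) auto
      then show ?thesis using M(3)[rule_format, OF that(2), of "zs ! i"] by (simp add: \<rho>_def mult_ac)
    qed
    have \<rho>: "\<rho> \<ge> 0" using M by (simp add: \<rho>_def)
    \<comment> \<open>The exponential accounts for the decaying bound of \<open>(2 + 2 * J)\<close>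
      times the squared norm, the other summand for the dissipation in \<open>weight_le\<close>. One
      factor \<open>k\<close> comes from estimating the square of a sum of \<open>k\<close> weights
      by the sum of squares.\<close>
    define \<Phi> where "\<Phi> t = C * real k * (\<Sum>i<k. c / (2 * \<omega>) * exp (- (2 * \<omega>) * t) + K * (norm (?y i t))\<^sup>2)" for t
    define \<Phi>' where "\<Phi>' t = C * real k * (\<Sum>i<k. - (c * exp (- (2 * \<omega>) * t)) + K * (2 * inner (L (?y i t)) (?y i t)))" for t
    have cont: "continuous_on {0..} (\<lambda>t. R (map (S t) zs))"
      using R zs by (intro flow_form_continuous controlled_bounded_graph)
    have deriv: "(\<Phi> has_real_derivative \<Phi>' t) (at t within {0..})" if "t \<ge> 0" for t
      unfolding \<Phi>_def[abs_def] \<Phi>'_def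
    proof (intro DERIV_cmult DERIV_sum DERIV_add)
      fix i assume "i \<in> {..<k}"
      then show "((\<lambda>t. (norm (?y i t))\<^sup>2) has_real_derivative 2 * inner (L (?y i t)) (?y i t)) (at t within {0..})"
        using norm_S_sq_deriv[OF z(1) that] by simp
      show "((\<lambda>t. c / (2 * \<omega>) * exp (- (2 * \<omega>) * t)) has_real_derivative - (c * exp (- (2 * \<omega>) * t))) (at t within {0..})"
        using M(2) by (auto intro!: derivative_eq_intros)
    qed
    have bd: "\<bar>R (map (S t) zs)\<bar> \<le> - \<Phi>' t" if t: "t \<ge> 0" for t
    proof -
      have "exp (- \<omega> * t) \<le> 1" using M(2) t by simp
      then have "\<rho> * exp (- \<omega> * t) \<le> \<rho>" using \<rho> by (simp add: mult_left_le)
      then have "\<forall>z\<in>set (map (S t) zs). norm z \<le> \<rho>"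
        using y[OF _ t] len by (force simp: in_set_conv_nth)
      then have "\<bar>R (map (S t) zs)\<bar> \<le> C * (\<Sum>z\<leftarrow>map (S t) zs. weight z) ^ 2"
        using C(2) flow_in_tuples[OF zs t] by blast
      also have "(\<Sum>z\<leftarrow>map (S t) zs. weight z) = (\<Sum>i<k. weight (?y i t))"
        using len by (simp add: sum_list_sum_nth atLeast0LessThan)
      also have "C * (\<Sum>i<k. weight (?y i t))\<^sup>2 \<le> C * ((\<Sum>i<k. (weight (?y i t))\<^sup>2) * real k)"
        using C(1) sum_squared_le_sum_of_squares[of "\<lambda>i. weight (?y i t)" "{..<k}"] by (intro mult_left_mono) auto
      also have "\<dots> = C * real k * (\<Sum>i<k. (weight (?y i t))\<^sup>2)" by simp
      also have "\<dots> \<le> C * real k * (\<Sum>i<k. c * exp (- (2 * \<omega>) * t) - K * (2 * inner (L (?y i t)) (?y i t)))"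
      proof (intro mult_left_mono sum_mono)
        fix i assume "i \<in> {..<k}"
        then have i: "i < k" by simp
        have "(norm (?y i t))\<^sup>2 \<le> (\<rho> * exp (- \<omega> * t))\<^sup>2" using y[OF i t] by (intro power_mono) auto
        also have "\<dots> = \<rho>\<^sup>2 * exp (- (2 * \<omega>) * t)"
          by (simp add: power_mult_distrib exp_double[symmetric] mult_ac)
        finally have "(2 + 2 * J) * (norm (?y i t))\<^sup>2 \<le> c * exp (- (2 * \<omega>) * t)"
          using mult_left_mono[of "(norm (?y i t))\<^sup>2" _ "2 + 2 * J"] J_nonneg by (simp add: c_def mult.assoc)
        then show "(weight (?y i t))\<^sup>2 \<le> c * exp (- (2 * \<omega>) * t) - K * (2 * inner (L (?y i t)) (?y i t))"
          using weight_le[OF S_D(1)[OF z(1)[OF i] t]] by linarith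
      qed (use C(1) in auto)
      also have "\<dots> = - \<Phi>' t"
        unfolding \<Phi>'_def mult_minus_right[symmetric] sum_negf[symmetric] by (simp add: algebra_simps)
      finally show ?thesis .
    qed
    have "((\<lambda>t. exp (- (2 * \<omega>) * t)) \<longlongrightarrow> 0) at_top"
      using M(2) by (intro filterlim_compose[OF exp_at_bot] filterlim_tendsto_neg_mult_at_bot[OF tendsto_const])
        (auto simp: filterlim_ident)
    then have "(\<Phi> \<longlongrightarrow> C * real k * (\<Sum>i<k. c / (2 * \<omega>) * 0 + K * (norm (0::'y))\<^sup>2)) at_top"
      unfolding \<Phi>_def[abs_def] by (intro tendsto_intros S_tendsto_at_top)
    then have lim: "(\<Phi> \<longlongrightarrow> 0) at_top" by simp
    obtain l where l: "((\<lambda>\<tau>. integral {0..\<tau>} (\<lambda>t. R (map (S t) zs))) \<longlongrightarrow> l) at_top" "\<bar>l\<bar> \<le> \<Phi> 0"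
      using dominated_improper_integral[OF cont deriv bd lim] by blast
    have "\<Phi> 0 \<le> E"
      unfolding \<Phi>_def E_def using z C(1) K_nonneg
      by (intro mult_left_mono sum_mono add_mono power_mono) auto
    then show ?thesis using l by auto
  qed
  show thesis by (rule that[of E]) (use main in blast)
qed

lemma lyapunov_solution:
  assumes R: "controlled 2 k R"
  obtains T where "T \<in> bounded_multilinear_forms UNIV norm k" "symmetric_on UNIV k T"
    "\<forall>zs\<in>tuples D k. insert_op L k T zs = c * R zs"
proof -
  have mlR: "multilinear_on D k R" and symR: "symmetric_on D k R"
    using R by (auto simp: controlled_def)
  note bR = controlled_bounded_graph[OF R]
  let ?F = "\<lambda>zs \<tau>. integral {0..\<tau>} (\<lambda>t. R (map (S t) zs))"
  have int: "(\<lambda>t. R (map (S t) zs)) integrable_on {a..b}" if "zs \<in> tuples D k" "a \<ge> 0" for zs a b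
    using that by (intro integrable_continuous_real continuous_on_subset[OF flow_form_continuous[OF bR]]) auto
  define I where "I zs = Lim at_top (?F zs)" for zs
  have I: "(?F zs \<longlongrightarrow> I zs) at_top" if zs: "zs \<in> tuples D k" for zs
  proof -
    \<comment> \<open>The estimate asks for some radius that covers all entries of
      \<open>zs\<close>.\<close>
    obtain E where "\<forall>xs\<in>tuples D k. (\<forall>z\<in>set xs. norm z \<le> Max (norm ` set zs)) \<longrightarrow>
        (\<exists>l. (?F xs \<longlongrightarrow> l) at_top \<and> \<bar>l\<bar> \<le> E)"
      by (rule controlled_integral[OF R]) (rule that)
    then obtain l where "(?F zs \<longlongrightarrow> l) at_top" using zs by fastforce
    then show ?thesis by (simp add: I_def tendsto_Lim)
  qed
  have I_eq: "I zs = l" if "zs \<in> tuples D k" "(?F zs \<longlongrightarrow> l) at_top" for zs l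
    using tendsto_unique[OF trivial_limit_at_top_linorder I[OF that(1)] that(2)] .
  \<comment> \<open>The flow leads from \<open>zs\<close> to 0, so the derivative
    \<open>c * R\<close> of \<open>T\<close> along it integrates to \<open>- T zs\<close> over all
    times; this fixes the sign.\<close>
  define T0 where "T0 zs = - c * I zs" for zs
  have "multilinear_on D k I"
    unfolding multilinear_on_def
  proof (intro ballI allI impI)
    fix zs i x y b d assume *: "zs \<in> tuples D k" "i < k" "x \<in> D" "y \<in> D"
    have mem: "zs[i := u] \<in> tuples D k" if "u \<in> D" for u using *(1) that by (rule tuples_update)
    have xy: "b *\<^sub>R x + d *\<^sub>R y \<in> D" using generator_comb[OF *(3,4)] by blast
    show "I (zs[i := b *\<^sub>R x + d *\<^sub>R y]) = b * I (zs[i := x]) + d * I (zs[i := y])"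
    proof (rule I_eq[OF mem[OF xy]])
      have "?F (zs[i := b *\<^sub>R x + d *\<^sub>R y]) \<tau> = b * ?F (zs[i := x]) \<tau> + d * ?F (zs[i := y]) \<tau>" for \<tau>
      proof -
        have "?F (zs[i := b *\<^sub>R x + d *\<^sub>R y]) \<tau>
            = integral {0..\<tau>} (\<lambda>t. b * R (map (S t) (zs[i := x])) + d * R (map (S t) (zs[i := y])))"
        proof (rule Henstock_Kurzweil_Integration.integral_cong)
          fix t assume "t \<in> {0..\<tau>}"
          then have t: "t \<ge> 0" by simp
          show "R (map (S t) (zs[i := b *\<^sub>R x + d *\<^sub>R y])) =
              b * R (map (S t) (zs[i := x])) + d * R (map (S t) (zs[i := y]))"
            using multilinear_onD[OF mlR flow_in_tuples[OF *(1) t] *(2) S_D(1)[OF *(3) t] S_D(1)[OF *(4) t]]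
            by (simp add: map_update blinfun.bilinear_simps)
        qed
        also have "\<dots> = b * ?F (zs[i := x]) \<tau> + d * ?F (zs[i := y]) \<tau>"
          using int[OF mem[OF *(3)]] int[OF mem[OF *(4)]]
          by (simp add: Henstock_Kurzweil_Integration.integral_add integrable_on_mult_right)
        finally show ?thesis .
      qed
      then show "(?F (zs[i := b *\<^sub>R x + d *\<^sub>R y]) \<longlongrightarrow> b * I (zs[i := x]) + d * I (zs[i := y])) at_top"
        using *(3,4) by (simp only:) (intro tendsto_intros I mem)
    qed
  qed
  then have ml: "multilinear_on D k T0"
    unfolding T0_def[abs_def] by (rule multilinear_on_cmult)
  moreover have "\<exists>B. \<forall>zs\<in>tuples D k. (\<forall>z\<in>set zs. norm z \<le> 1) \<longrightarrow> \<bar>T0 zs\<bar> \<le> B"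
  proof -
    obtain E where E: "\<forall>zs\<in>tuples D k. (\<forall>z\<in>set zs. norm z \<le> 1) \<longrightarrow>
        (\<exists>l. (?F zs \<longlongrightarrow> l) at_top \<and> \<bar>l\<bar> \<le> E)"
      by (rule controlled_integral[OF R]) (rule that)
    have "\<bar>T0 zs\<bar> \<le> \<bar>c\<bar> * E" if zs: "zs \<in> tuples D k" and le: "\<forall>z\<in>set zs. norm z \<le> 1" for zs
    proof -
      obtain l where l: "(?F zs \<longlongrightarrow> l) at_top" "\<bar>l\<bar> \<le> E" using E zs le by blast
      then have "\<bar>I zs\<bar> \<le> E" using I_eq[OF zs] by blast
      then show ?thesis by (simp add: T0_def abs_mult mult_left_mono)
    qed
    then show ?thesis by blast
  qed
  ultimately have T0: "T0 \<in> bounded_multilinear_forms D norm k"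
    by (simp add: bounded_multilinear_forms_def)
  have symT0: "symmetric_on D k T0"
    unfolding symmetric_on_def
  proof (intro ballI allI impI)
    fix zs and \<sigma> :: "nat \<Rightarrow> nat" assume zs: "zs \<in> tuples D k" and \<sigma>: "\<sigma> permutes {..<k}"
    have "R (map (S t) (permute_list \<sigma> zs)) = R (map (S t) zs)" if "t \<ge> 0" for t
    proof -
      have "map (S t) (permute_list \<sigma> zs) = permute_list \<sigma> (map (S t) zs)"
        using \<sigma> zs by (simp add: permute_list_map tuples_def)
      then show ?thesis
        using symR \<sigma> flow_in_tuples[OF zs that] by (simp add: symmetric_on_def)
    qed
    then have "?F (permute_list \<sigma> zs) = ?F zs"
      by (intro ext Henstock_Kurzweil_Integration.integral_cong) auto
    then show "T0 (permute_list \<sigma> zs) = T0 zs" by (simp add: T0_def I_def)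
  qed
  obtain T where T: "T \<in> bounded_multilinear_forms UNIV norm k" "symmetric_on UNIV k T"
    "\<forall>zs\<in>tuples D k. T zs = T0 zs"
    by (rule extend_form[OF subspace_D dense T0 symT0], rule that) blast+
  have "insert_op L k T zs = c * R zs" if zs: "zs \<in> tuples D k" for zs
  proof -
    have z: "zs ! i \<in> D" if "i < k" for i using zs that by (rule tuples_nth)
    \<comment> \<open>Starting at time \<open>h\<close> drops the initial piece of the integral:
      substitute \<open>t + h\<close> and use the semigroup law.\<close>
    have shift: "I (map (S h) zs) = I zs - ?F zs h" if h: "h \<ge> 0" for h
    proof (rule I_eq[OF flow_in_tuples[OF zs h]])
      have "filterlim (\<lambda>\<tau>. \<tau> + h) at_top at_top"
        by (rule filterlim_tendsto_add_at_top[OF tendsto_const filterlim_ident, of h, unfolded add.commute[of h]])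
      from filterlim_compose[OF I[OF zs] this]
      have "((\<lambda>\<tau>. ?F zs (\<tau> + h) - ?F zs h) \<longlongrightarrow> I zs - ?F zs h) at_top" by (intro tendsto_intros)
      moreover have "\<forall>\<^sub>F \<tau> in at_top. ?F zs (\<tau> + h) - ?F zs h = ?F (map (S h) zs) \<tau>"
        using eventually_ge_at_top[of 0]
      proof eventually_elim
        case (elim \<tau>)
        have "?F zs h + integral {h..\<tau> + h} (\<lambda>t. R (map (S t) zs)) = ?F zs (\<tau> + h)"
          using elim h int[OF zs] by (intro Henstock_Kurzweil_Integration.integral_combine) auto
        moreover have "integral {h..\<tau> + h} (\<lambda>t. R (map (S t) zs)) = integral {0..\<tau>} (\<lambda>t. R (map (S (t + h)) zs))"
          using integral_shift_real_ivl[of h h "\<tau> + h" "\<lambda>t. R (map (S t) zs)"] by simp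
        moreover have "integral {0..\<tau>} (\<lambda>t. R (map (S (t + h)) zs)) = ?F (map (S h) zs) \<tau>"
        proof (rule Henstock_Kurzweil_Integration.integral_cong)
          fix t assume "t \<in> {0..\<tau>}"
          then have "blinfun_apply (S (t + h)) = (\<lambda>z. S t (S h z))" using h by (intro ext S_add) auto
          then show "R (map (S (t + h)) zs) = R (map (S t) (map (S h) zs))" by (simp add: comp_def)
        qed
        ultimately show ?case by simp
      qed
      ultimately show "(?F (map (S h) zs) \<longlongrightarrow> I zs - ?F zs h) at_top"
        by (rule Lim_transform_eventually)
    qed
    have "((\<lambda>h. 1 / (h - 0) * (T (tup k (\<lambda>i. S h (zs ! i))) - T (tup k (\<lambda>i. zs ! i)))) \<longlongrightarrow>
        (\<Sum>i<k. T (tup k ((\<lambda>i. zs ! i)(i := L (zs ! i)))))) (at 0 within {0..})"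
    proof (rule tendsto_form_difference_quotient[OF T(1)])
      fix i assume i: "i < k"
      show "((\<lambda>h. S h (zs ! i)) \<longlongrightarrow> zs ! i) (at 0 within {0..})"
        using S_continuous[of 0 "zs ! i"] by simp
      show "((\<lambda>h. (1 / (h - 0)) *\<^sub>R (S h (zs ! i) - zs ! i)) \<longlongrightarrow> L (zs ! i)) (at 0 within {0..})"
        using S_difference_quotient[OF z[OF i], of 0] by simp
    qed
    moreover have "(\<Sum>i<k. T (tup k ((\<lambda>i. zs ! i)(i := L (zs ! i))))) = insert_op L k T zs"
      unfolding insert_op_def using zs by (intro sum.cong) (auto simp: tup_update[symmetric] tup_nth simp del: tup_update)
    ultimately have 1: "((\<lambda>h. (T (map (S h) zs) - T zs) / h) \<longlongrightarrow> insert_op L k T zs) (at 0 within {0..})"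
      by (simp add: map_flow[OF zs] tup_nth[OF zs])
    have "((?F zs) has_real_derivative R (map (S 0) zs)) (at 0 within {0..1})"
      using flow_form_continuous[OF bR zs]
      by (intro integral_has_real_derivative) (auto intro: continuous_on_subset)
    then have "((\<lambda>h. (?F zs h - ?F zs 0) / (h - 0)) \<longlongrightarrow> R (map (S 0) zs)) (at 0 within {0..1})"
      by (simp only: has_field_derivative_iff)
    \<comment> \<open>The fundamental theorem is applied on a compact interval, the flow limit is
      taken on the half-line; near 0 the two filters agree.\<close>
    moreover have "at (0::real) within {0..1} = at 0 within {0..}"
      by (rule at_within_nhd[of _ "{..<1}"]) auto
    moreover have "map (S 0) zs = zs" by (simp add: list_eq_iff_nth_eq)
    ultimately have "((\<lambda>h. c * (?F zs h / h)) \<longlongrightarrow> c * R zs) (at 0 within {0..})"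
      by (intro tendsto_intros) simp
    moreover have "\<forall>\<^sub>F h in at 0 within {0..}. c * (?F zs h / h) = (T (map (S h) zs) - T zs) / h"
    proof -
      have "c * (?F zs h / h) = (T (map (S h) zs) - T zs) / h" if "h \<ge> 0" for h
      proof -
        have "T (map (S h) zs) - T zs = c * ?F zs h"
          using T(3) zs flow_in_tuples[OF zs that] shift[OF that] by (simp add: T0_def right_diff_distrib)
        then show ?thesis by simp
      qed
      then show ?thesis by (auto simp: eventually_at intro!: exI[of _ 1])
    qed
    ultimately have 2: "((\<lambda>h. (T (map (S h) zs) - T zs) / h) \<longlongrightarrow> c * R zs) (at 0 within {0..})"
      by (rule Lim_transform_eventually)
    show ?thesis
    proof (rule tendsto_unique[OF _ 1 2])
      show "at (0::real) within {0..} \<noteq> bot" by (simp add: at_within_Ici_at_right)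
    qed
  qed
  then show thesis using that T by blast
qed

lemma lyapunov_unique:
  assumes T: "T \<in> bounded_multilinear_forms UNIV norm k" and k: "k \<ge> 1"
    and zero: "\<And>zs. zs \<in> tuples D k \<Longrightarrow> insert_op L k T zs = 0"
    and zs: "zs \<in> tuples UNIV k"
  shows "T zs = 0"
proof -
  have ml: "multilinear_on UNIV k T" using T by (simp add: bounded_multilinear_forms_def)
  have D: "T zs = 0" if zs: "zs \<in> tuples D k" for zs
  proof -
    have z: "zs ! i \<in> D" if "i < k" for i using zs that by (rule tuples_nth)
    let ?\<phi> = "\<lambda>t. T (tup k (\<lambda>i. S t (zs ! i)))"
    have "(?\<phi> has_real_derivative 0) (at t within {0..})" if "t \<in> {0..}" for t
    proof -
      have t: "t \<ge> 0" using that by simp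
      have "((\<lambda>s. 1 / (s - t) * (?\<phi> s - ?\<phi> t)) \<longlongrightarrow>
          (\<Sum>i<k. T (tup k ((\<lambda>i. S t (zs ! i))(i := S t (L (zs ! i))))))) (at t within {0..})"
        by (rule tendsto_form_difference_quotient[OF T])
          (auto intro!: S_continuous S_difference_quotient t z)
      \<comment> \<open>As \<open>L\<close> commutes with the flow, the derivative at time
        \<open>t\<close> is the Lyapunov expression at the transported tuple, which still lies in
        \<open>D\<close>.\<close>
      moreover have "(\<Sum>i<k. T (tup k ((\<lambda>i. S t (zs ! i))(i := S t (L (zs ! i)))))) = insert_op L k T (map (S t) zs)"
        unfolding insert_op_def map_flow[OF zs] using S_D(2)[OF z t] by (intro sum.cong) auto
      ultimately show ?thesis
        using zero[OF flow_in_tuples[OF zs t]] by (simp add: has_field_derivative_iff)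
    qed
    then obtain b where b: "\<And>t. t \<in> {0..} \<Longrightarrow> ?\<phi> t = b"
      using has_field_derivative_zero_constant[of "{0..}" ?\<phi>] by auto
    have "(?\<phi> \<longlongrightarrow> T (tup k (\<lambda>_. 0))) at_top"
      by (rule normed_UNIV.tendsto_form[OF T])
        (use S_tendsto_at_top in \<open>auto simp: tendsto_norm_zero_iff\<close>)
    moreover have "\<forall>\<^sub>F t in at_top. ?\<phi> t = b"
      using eventually_ge_at_top[of 0] by eventually_elim (use b in auto)
    ultimately have "((\<lambda>_::real. b) \<longlongrightarrow> T (tup k (\<lambda>_. 0))) at_top"
      by (rule Lim_transform_eventually)
    then have "b = T (tup k (\<lambda>_. 0))" by (simp add: tendsto_const_iff)
    \<comment> \<open>Here \<open>k \<ge> 1\<close> enters: a form of order 0 is a constant and need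
      not vanish at the end of the flow.\<close>
    also have "\<dots> = 0" using k by (intro multilinear_on_zero[OF ml, of _ 0]) auto
    finally have "?\<phi> 0 = 0" using b[of 0] by simp
    then show ?thesis using tup_nth[OF zs] by simp
  qed
  have "\<exists>f. (\<forall>n::nat. f n \<in> D) \<and> f \<longlonglongrightarrow> z" for z
    using dense by (metis UNIV_I closure_sequential)
  then obtain d where d: "\<And>z n. d z n \<in> D" "\<And>z. d z \<longlonglongrightarrow> z" by metis
  have "(\<lambda>n. T (tup k (\<lambda>i. d (zs ! i) n))) \<longlonglongrightarrow> T (tup k ((!) zs))"
    by (rule normed_UNIV.tendsto_form[OF T])
      (use d(2) in \<open>auto simp: tendsto_norm_zero_iff LIM_zero_iff\<close>)
  moreover have "T (tup k (\<lambda>i. d (zs ! i) n)) = 0" for n using d(1) by (intro D) auto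
  ultimately show ?thesis by (simp add: tup_nth[OF zs] LIMSEQ_const_iff)
qed

end

section \<open>The operator of a form\<close>

text \<open>The range of \<open>e\<close> need not be closed, so \<open>y\<close> is found in its
  closure. The bound on \<open>g\<close> keeps the energy bounded below, the parallelogram law makes
  a minimizing sequence Cauchy in \<open>Y\<close>, and the vanishing first variation at the limit
  is the asserted identity.\<close>

lemma riesz_on_range:
  fixes e :: "'v::real_vector \<Rightarrow> 'y::{real_inner,complete_space}" and g :: "'v \<Rightarrow> real"
  assumes e: "linear e" and g: "linear g" and bd: "\<And>w. \<bar>g w\<bar> \<le> C * norm (e w)"
  shows "\<exists>y. \<forall>w. inner y (e w) = g w"
proof -
  \<comment> \<open>\<open>y\<close> is the limit of a minimising sequence of the energy \<open>J\<close>.\<close>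
  define J where "J w = (norm (e w))\<^sup>2 - 2 * g w" for w
  have lower: "- (C\<^sup>2) \<le> J w" for w
  proof -
    have "0 \<le> (norm (e w) - C)\<^sup>2" by simp
    then have "- (C\<^sup>2) \<le> (norm (e w))\<^sup>2 - 2 * (C * norm (e w))"
      by (simp add: power2_eq_square algebra_simps)
    moreover have "g w \<le> C * norm (e w)" using bd[of w] by linarith
    ultimately show ?thesis unfolding J_def by linarith
  qed
  define m where "m = Inf (range J)"
  have bdd: "bdd_below (range J)" using lower by (intro bdd_belowI2)
  have m: "m \<le> J w" for w unfolding m_def using bdd by (simp add: cInf_lower)
  have "\<exists>w. J w < m + 1 / real (Suc n)" for n
  proof -
    have "Inf (range J) < m + 1 / real (Suc n)" by (simp add: m_def)
    then show ?thesis using cInf_lessD[of "range J"] by blast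
  qed
  then obtain w where w: "\<And>n. J (w n) < m + 1 / real (Suc n)" by metis
  \<comment> \<open>Parallelogram law for the midpoint of \<open>u\<close> and \<open>v\<close>,
    whose energy is at least \<open>m\<close>.\<close>
  have par: "(norm (e u - e v))\<^sup>2 \<le> 2 * J u + 2 * J v - 4 * m" for u v
  proof -
    have "(norm (e u - e v))\<^sup>2 + 4 * J ((1/2) *\<^sub>R (u + v)) = 2 * J u + 2 * J v"
      unfolding J_def power2_norm_eq_inner linear_scale[OF e] linear_add[OF e] linear_scale[OF g] linear_add[OF g]
      by (simp add: inner_add_left inner_add_right inner_diff_left inner_diff_right inner_commute field_simps)
    moreover have "4 * m \<le> 4 * J ((1/2) *\<^sub>R (u + v))" using m by simp
    ultimately show ?thesis by linarith
  qed
  have "Cauchy (\<lambda>n. e (w n))"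
  proof (rule CauchyI)
    fix \<epsilon> :: real assume \<epsilon>: "\<epsilon> > 0"
    obtain M where M: "4 / \<epsilon>\<^sup>2 < real M" using reals_Archimedean2 by blast
    have "norm (e (w p) - e (w q)) < \<epsilon>" if "p \<ge> M" "q \<ge> M" for p q
    proof -
      have small: "J (w n) - m < \<epsilon>\<^sup>2 / 4" if "n \<ge> M" for n
      proof -
        have "4 / \<epsilon>\<^sup>2 < real (Suc n)" using M that by linarith
        then have "1 / real (Suc n) < \<epsilon>\<^sup>2 / 4" using \<epsilon> by (simp add: field_simps)
        then show ?thesis using w[of n] by linarith
      qed
      have "(norm (e (w p) - e (w q)))\<^sup>2 \<le> 2 * J (w p) + 2 * J (w q) - 4 * m" by (rule par)
      also have "\<dots> < \<epsilon>\<^sup>2" using small[OF that(1)] small[OF that(2)] by argo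
      finally show ?thesis by (rule power_less_imp_less_base) (use \<epsilon> in simp)
    qed
    then show "\<exists>M. \<forall>p\<ge>M. \<forall>q\<ge>M. norm (e (w p) - e (w q)) < \<epsilon>" by blast
  qed
  then obtain y where y: "(\<lambda>n. e (w n)) \<longlonglongrightarrow> y"
    using Cauchy_convergent convergent_def by blast
  have "inner y (e v) = g v" for v
  proof -
    define d where "d = inner y (e v) - g v"
    define q where "q = (norm (e v))\<^sup>2"
    \<comment> \<open>Minimality is tested along \<open>w n + t *\<^sub>R v\<close> and passed to
      the limit, as \<open>y\<close> itself need not lie in the range of \<open>e\<close>.\<close>
    have ge: "0 \<le> 2 * t * d + t\<^sup>2 * q" for t
    proof -
      have "0 \<le> 1 / real (Suc n) + (2 * t * (inner (e (w n)) (e v) - g v) + t\<^sup>2 * q)" for n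
      proof -
        have "J (w n + t *\<^sub>R v) = J (w n) + (2 * t * (inner (e (w n)) (e v) - g v) + t\<^sup>2 * q)"
          unfolding J_def q_def power2_norm_eq_inner linear_scale[OF e] linear_add[OF e] linear_scale[OF g] linear_add[OF g]
          by (simp add: inner_add_left inner_add_right inner_commute power2_eq_square algebra_simps)
        then show ?thesis using m[of "w n + t *\<^sub>R v"] w[of n] by linarith
      qed
      moreover have "(\<lambda>n. 1 / real (Suc n) + (2 * t * (inner (e (w n)) (e v) - g v) + t\<^sup>2 * q))
          \<longlonglongrightarrow> 0 + (2 * t * (inner y (e v) - g v) + t\<^sup>2 * q)"
        using LIMSEQ_inverse_real_of_nat by (intro tendsto_intros y) (simp add: inverse_eq_divide)
      ultimately have "0 \<le> 0 + (2 * t * (inner y (e v) - g v) + t\<^sup>2 * q)"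
        by (intro LIMSEQ_le_const) auto
      then show ?thesis by (simp add: d_def)
    qed
    have q: "q \<ge> 0" by (simp add: q_def)
    \<comment> \<open>The quadratic in \<open>t\<close> is smallest at \<open>- d / q\<close>; the
      added 1 covers \<open>q = 0\<close> and still gives a negative value unless
      \<open>d = 0\<close>.\<close>
    define r where "r = d / (q + 1)"
    have d: "d = r * (q + 1)" using q by (simp add: r_def)
    have "2 * (- r) * d + (- r)\<^sup>2 * q = - (r\<^sup>2 * (q + 2))"
      unfolding d by (simp add: power2_eq_square algebra_simps)
    then have "r\<^sup>2 * (q + 2) \<le> 0" using ge[of "- r"] by linarith
    moreover have "r\<^sup>2 * (q + 2) > 0" if "r \<noteq> 0"
      using that q by (intro mult_pos_pos) auto
    ultimately have "d = 0" unfolding d by (metis not_less mult_zero_left)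
    then show ?thesis by (simp add: d_def)
  qed
  then show ?thesis by blast
qed

lemma orthogonal_dense_zero:
  fixes y :: "'y::real_inner"
  assumes "closure X = UNIV" "\<And>x. x \<in> X \<Longrightarrow> inner y x = 0"
  shows "y = 0"
proof -
  have "closure X \<subseteq> {x. inner y x = 0}"
    using assms(2) by (intro closure_minimal closed_hyperplane) auto
  then have "y \<in> {x. inner y x = 0}" using assms(1) by blast
  then show ?thesis by simp
qed

text \<open>Gives meaning to the description by \<open>THE\<close> on \<open>form_dom\<close>:
  existence is the Riesz representation, uniqueness the density of the range of
  \<open>emb\<close>.\<close>

lemma form_op_inner:
  fixes emb :: "'v::{real_inner,complete_space} \<Rightarrow> 'y::{real_inner,complete_space}"
  assumes triple: "gelfand_triple emb" and form: "bounded_bilinear a"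
    and z: "z \<in> form_dom emb a"
  shows "inner (form_op emb a z) (emb w) = - a (inv emb z) w"
proof -
  have emb: "bounded_linear emb" "inj emb" "closure (range emb) = UNIV"
    using triple by (auto simp: gelfand_triple_def)
  obtain v C where v: "z = emb v" "\<And>w. \<bar>a v w\<bar> \<le> C * norm (emb w)"
    using z by (auto simp: form_dom_def)
  have "linear (\<lambda>w. - a v w)"
    using bounded_bilinear.bounded_linear_right[OF form] by (intro linear_compose_neg bounded_linear.linear)
  then obtain y where y: "\<forall>w. inner y (emb w) = - a v w"
    using riesz_on_range[OF bounded_linear.linear[OF emb(1)], of "\<lambda>w. - a v w" C] v by auto
  have inv: "inv emb z = v" using v emb by simp
  have "\<exists>!y. \<forall>w. inner y (emb w) = - a (inv emb z) w"
  proof (rule ex1I[of _ y])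
    fix y' assume "\<forall>w. inner y' (emb w) = - a (inv emb z) w"
    then have "y' - y = 0"
      using y inv by (intro orthogonal_dense_zero[OF emb(3)]) (auto simp: inner_diff_left)
    then show "y' = y" by simp
  qed (use y inv in simp)
  from theI'[OF this] show ?thesis by (auto simp: form_op_def)
qed

text \<open>Away from the closure of \<open>D\<close> the K-functional grows linearly, which the weight \<open>t powr (-\<theta>)\<close>
  with \<open>\<theta> = 1/2\<close> does not compensate.\<close>

lemma interp_space_subset_closure:
  fixes D :: "'y::real_normed_vector set"
  assumes n0: "\<And>x. x \<in> D \<Longrightarrow> 0 \<le> n0 x"
  shows "interp_space D n0 UNIV norm 2 (1/2) \<subseteq> closure D"
proof
  fix x assume "x \<in> interp_space D n0 UNIV norm 2 (1/2)"
  then obtain x0 x1 where x: "x0 \<in> D" "x = x0 + x1"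
    and fin: "interp_integral D n0 UNIV norm 2 (1/2) x < \<infinity>"
    by (auto simp: interp_space_def)
  show "x \<in> closure D"
  proof (rule ccontr)
    assume "x \<notin> closure D"
    then obtain \<delta> where \<delta>: "\<delta> > 0" "\<And>y. y \<in> D \<Longrightarrow> \<delta> \<le> norm (x - y)"
      by (auto simp: closure_approachable dist_norm norm_minus_commute not_less)
    let ?K = "\<lambda>t. K_functional D n0 UNIV norm t x"
    have K: "t * \<delta> \<le> ?K t" if "t > 0" for t
      unfolding K_functional_def
    proof (rule cInf_greatest)
      show "{n0 x0 + t * norm x1 |x0 x1. x0 \<in> D \<and> x1 \<in> UNIV \<and> x = x0 + x1} \<noteq> {}"
        using x by auto
      fix s assume "s \<in> {n0 x0 + t * norm x1 |x0 x1. x0 \<in> D \<and> x1 \<in> UNIV \<and> x = x0 + x1}"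
      then obtain u0 u1 where u: "s = n0 u0 + t * norm u1" "u0 \<in> D" "x = u0 + u1" by auto
      have "\<delta> \<le> norm u1" using \<delta>(2)[OF u(2)] u(3) by simp
      then have "t * \<delta> \<le> t * norm u1" using that by simp
      then show "t * \<delta> \<le> s" using n0[OF u(2)] u(1) by linarith
    qed
    \<comment> \<open>With exponent 2, \<theta> = 1/2 and the measure dt/t, the linear lower bound
      for the K-functional becomes a constant one for the integrand, whose integral over the
      half-line is infinite.\<close>
    have pt: "\<delta>\<^sup>2 \<le> (t powr (- (1/2)) * ?K t) powr 2 / t" if t: "t > 0" for t
    proof -
      have nonneg: "0 \<le> t powr (- (1/2)) * (t * \<delta>)" using t \<delta>(1) by simp
      have "(t powr (- (1/2)) * (t * \<delta>)) powr 2 = (t powr (- (1/2)))\<^sup>2 * (t * \<delta>)\<^sup>2"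
        using nonneg by (simp add: power_mult_distrib)
      also have "(t powr (- (1/2)))\<^sup>2 = 1 / t"
        using t by (simp add: power2_eq_square powr_add[symmetric] powr_minus_divide)
      also have "1 / t * (t * \<delta>)\<^sup>2 = t * \<delta>\<^sup>2" using t by (simp add: power2_eq_square)
      moreover have "t powr (- (1/2)) * (t * \<delta>) \<le> t powr (- (1/2)) * ?K t"
        using K[OF t] by (intro mult_left_mono) auto
      ultimately have "t * \<delta>\<^sup>2 \<le> (t powr (- (1/2)) * ?K t) powr 2"
        using powr_mono2[of 2 "t powr (- (1/2)) * (t * \<delta>)" "t powr (- (1/2)) * ?K t"] nonneg by (simp only:)
      then show ?thesis using t by (simp add: field_simps)
    qed
    have "(\<infinity>::ennreal) = ennreal (\<delta>\<^sup>2) * emeasure lborel {0::real<..}"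
    proof -
      have "ennreal (real n) \<le> emeasure lborel {0::real<..}" for n
      proof -
        have "emeasure lborel {0<..<real n} \<le> emeasure lborel {0::real<..}" by (intro emeasure_mono) auto
        then show ?thesis by simp
      qed
      then have "(SUP n. of_nat n) \<le> emeasure lborel {0::real<..}"
        by (intro SUP_least) (simp add: ennreal_of_nat_eq_real_of_nat)
      then have "emeasure lborel {0::real<..} = \<infinity>"
        by (simp add: ennreal_SUP_of_nat_eq_top top_unique)
      then show ?thesis using \<delta>(1) by (simp add: ennreal_mult_top)
    qed
    also have "\<dots> = (\<integral>\<^sup>+t. ennreal (\<delta>\<^sup>2) * indicator {0::real<..} t \<partial>lborel)"
      by (simp add: nn_integral_cmult_indicator)
    also have "\<dots> \<le> interp_integral D n0 UNIV norm 2 (1/2) x"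
      unfolding interp_integral_def
      by (intro nn_integral_mono) (auto simp: indicator_def intro!: ennreal_leI pt)
    finally show False using fin by simp
  qed
qed

section \<open>The sequence of forms\<close>

lemma Sym_tensor_cong:
  assumes "\<And>zs. zs \<in> tuples UNIV i \<Longrightarrow> F zs = F' zs" "\<And>zs. zs \<in> tuples UNIV j \<Longrightarrow> G zs = G' zs"
    and zs: "zs \<in> tuples UNIV (i + j)"
  shows "Sym i j (tensor i F G) zs = Sym i j (tensor i F' G') zs"
proof -
  have "tensor i F G (permute_list \<sigma> zs) = tensor i F' G' (permute_list \<sigma> zs)" for \<sigma>
    using assms by (simp add: tensor_def tuples_def)
  then show ?thesis by (simp add: Sym_def)
qed

text \<open>Agreement is required on all of \<open>Y\<close>, since the forms are evaluated at
  \<open>B\<close> and at values of \<open>N\<close>, which need not lie in \<open>D\<close>. That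
  orders below \<open>k\<close> suffice drives both the recursive construction and the induction for
  uniqueness.\<close>

lemma rhs_form_cong:
  assumes T: "\<And>j zs. 2 \<le> j \<Longrightarrow> j < k \<Longrightarrow> zs \<in> tuples UNIV j \<Longrightarrow> T j zs = T' j zs"
    and k: "k \<ge> 3" and zs: "zs \<in> tuples UNIV k"
  shows "rhs_form B N T k zs = rhs_form B N T' k zs"
proof -
  have C: "form_C B T i zs = form_C B T' i zs" if "1 \<le> i" "i \<le> k - 2" "zs \<in> tuples UNIV i" for i zs
    unfolding form_C_def using that k by (intro T) (auto simp: tuples_def)
  have G: "form_G N T i zs = form_G N T' i zs" if "2 \<le> i" "i \<le> k - 1" "zs \<in> tuples UNIV i" for i zs
  proof -
    have "T i (zs[l := u]) = T' i (zs[l := u])" for l u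
      using that k by (intro T) (auto simp: tuples_def)
    then show ?thesis by (simp add: form_G_def insert_op_def)
  qed
  have CG: "form_CG B N T i zs = form_CG B N T' i zs" if "2 \<le> i" "i \<le> k - 2" "zs \<in> tuples UNIV i" for i zs
    unfolding form_CG_def using that C[of i zs] G[of i zs] by simp
  have 1: "Sym 1 (k - 1) (tensor 1 (form_C B T 1) (form_G N T (k - 1))) zs =
      Sym 1 (k - 1) (tensor 1 (form_C B T' 1) (form_G N T' (k - 1))) zs"
    using k zs by (intro Sym_tensor_cong C G) auto
  have 2: "Sym i (k - i) (tensor i (form_CG B N T i) (form_CG B N T (k - i))) zs =
      Sym i (k - i) (tensor i (form_CG B N T' i) (form_CG B N T' (k - i))) zs" if "i \<in> {2..k - 2}" for i
    using that k zs by (intro Sym_tensor_cong CG) auto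
  show ?thesis
    unfolding rhs_form_def 1 by (intro arg_cong2[where f = "(+)"] refl sum.cong) (simp only: 2)
qed

lemma tuples_2E:
  assumes "zs \<in> tuples X 2" obtains x y where "zs = [x, y]"
  using assms by (auto simp: tuples_def numeral_2_eq_2 length_Suc_conv)

lemma quadratic_form:
  fixes P :: "'y::real_inner \<Rightarrow>\<^sub>L 'y"
  assumes sym: "\<And>x y. inner (P x) y = inner x (P y)"
  defines "T \<equiv> \<lambda>zs. inner (zs ! 0) (P (zs ! 1))"
  shows "T \<in> bounded_multilinear_forms UNIV norm 2" "symmetric_on UNIV 2 T"
proof -
  have "multilinear_on UNIV 2 T"
    unfolding multilinear_on_def T_def
    by (auto simp: tuples_def nth_list_update less_2_cases_iff inner_add_left inner_add_right blinfun.bilinear_simps)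
  moreover have "\<bar>T zs\<bar> \<le> norm P" if "zs \<in> tuples UNIV 2" "\<forall>z\<in>set zs. norm z \<le> 1" for zs
  proof -
    obtain x y where zs: "zs = [x, y]" using \<open>zs \<in> tuples UNIV 2\<close> by (rule tuples_2E)
    have "norm (P y) \<le> norm P * 1"
      using norm_blinfun[of P y] that(2) zs by (meson list.set_intros mult_left_mono norm_ge_zero order_trans)
    then have "norm x * norm (P y) \<le> 1 * (norm P * 1)"
      using that(2) zs by (intro mult_mono) auto
    then show ?thesis using Cauchy_Schwarz_ineq2[of x "P y"] zs by (simp add: T_def)
  qed
  ultimately show "T \<in> bounded_multilinear_forms UNIV norm 2"
    by (auto simp: bounded_multilinear_forms_def)
  show "symmetric_on UNIV 2 T"
    unfolding symmetric_on_mset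
  proof (intro ballI impI)
    fix xs ys :: "'y list" assume xs: "xs \<in> tuples UNIV 2" and ys: "ys \<in> tuples UNIV 2" and m: "mset xs = mset ys"
    obtain x y where x: "xs = [x, y]" using xs by (rule tuples_2E)
    obtain u v where u: "ys = [u, v]" using ys by (rule tuples_2E)
    have "x = u \<and> y = v \<or> x = v \<and> y = u" using m x u by (auto simp: add_eq_conv_diff split: if_splits)
    then show "T xs = T ys"
      using x u sym[of x y] by (auto simp: T_def inner_commute)
  qed
qed

context stable_flow
begin

lemma lyapunov_system_exists_unique:
  fixes P :: "'y \<Rightarrow>\<^sub>L 'y"
  assumes L: "L = closed_loop A B \<alpha> P"
    and sym: "\<And>x y. inner (P x) y = inner x (P y)"
  shows "\<exists>T R. lyapunov_system D A NY B \<alpha> P T R \<and>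
    (\<forall>T' R'. lyapunov_system D A NY B \<alpha> P T' R' \<longrightarrow>
       (\<forall>k\<ge>2. \<forall>zs\<in>tuples UNIV k. T' k zs = T k zs) \<and>
       (\<forall>k\<ge>3. \<forall>zs\<in>tuples D k. R' k zs = R k zs))"
proof -
  \<comment> \<open>\<open>f\<close> collects the forms chosen so far and \<open>r\<close> is the
    candidate of order \<open>k\<close>; below order 2 nothing is required. \<open>Q\<close> depends
    on \<open>f\<close> only through orders below \<open>k\<close>, as well-founded choice
    demands.\<close>
  define Q where "Q f k r \<longleftrightarrow>
      (k = 2 \<longrightarrow> r = (\<lambda>zs. inner (zs ! 0) (P (zs ! 1)))) \<and>
      (k \<ge> 2 \<longrightarrow> r \<in> bounded_multilinear_forms UNIV norm k \<and> symmetric_on UNIV k r) \<and>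
      (k \<ge> 3 \<longrightarrow> (\<forall>zs\<in>tuples D k. insert_op L k r zs = 1 / (2 * \<alpha>) * rhs_form B NY f k zs))"
    for f :: "nat \<Rightarrow> 'y list \<Rightarrow> real" and k and r :: "'y list \<Rightarrow> real"
  have "\<exists>T. \<forall>k. Q T k (T k)"
  proof (rule dependent_wellorder_choice)
    fix r :: "'y list \<Rightarrow> real" and f g :: "nat \<Rightarrow> 'y list \<Rightarrow> real" and k :: nat
    assume "\<And>j. j < k \<Longrightarrow> f j = g j"
    then have "rhs_form B NY f k zs = rhs_form B NY g k zs" if "k \<ge> 3" "zs \<in> tuples D k" for zs
      using that by (intro rhs_form_cong) (auto simp: tuples_def)
    then show "Q f k r = Q g k r" by (auto simp: Q_def)
  next
    fix k :: nat and f :: "nat \<Rightarrow> 'y list \<Rightarrow> real"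
    assume f: "\<And>j. j < k \<Longrightarrow> Q f j (f j)"
    consider "k < 2" | "k = 2" | "k \<ge> 3" by linarith
    then show "\<exists>r. Q f k r"
    proof cases
      case 2
      then show ?thesis using quadratic_form[OF sym] by (auto simp: Q_def)
    next
      case 3
      have "controlled 2 k (rhs_form B NY f k)"
        using f 3 by (intro controlled_rhs_form) (auto simp: Q_def)
      then obtain r where "r \<in> bounded_multilinear_forms UNIV norm k" "symmetric_on UNIV k r"
        "\<forall>zs\<in>tuples D k. insert_op L k r zs = 1 / (2 * \<alpha>) * rhs_form B NY f k zs"
        by (rule lyapunov_solution) (rule that)
      then show ?thesis using 3 by (auto simp: Q_def)
    qed (auto simp: Q_def)
  qed
  then obtain T where T: "\<And>k. Q T k (T k)" by blast
  define R where "R k = rhs_form B NY T k" for k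
  have "R k \<in> bounded_multilinear_forms D (graph_norm A) k" if k: "k \<ge> 3" for k
  proof -
    have R: "controlled 2 k (R k)"
      unfolding R_def using T k by (intro controlled_rhs_form) (auto simp: Q_def)
    define s where "s = sqrt (2 + 2 * J + 2 * K)"
    \<comment> \<open>Norm bound for the rank-one operator by which \<open>L\<close> differs from
      \<open>A\<close>. It converts the graph norm of \<open>L\<close> into that of
      \<open>A\<close>, in which \<open>R k\<close> has to be bounded.\<close>
    define b where "b = \<bar>1 / \<alpha>\<bar> * norm B * norm P * norm B"
    show ?thesis
    proof (rule controlled_bounded[OF R])
      fix z assume z: "z \<in> D"
      show "norm z \<le> graph_norm A z" by (simp add: graph_norm_def)
      have "norm (((1 / \<alpha>) * inner B (P z)) *\<^sub>R B) \<le> b * norm z"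
      proof -
        have "\<bar>inner B (P z)\<bar> \<le> norm B * (norm P * norm z)"
          using Cauchy_Schwarz_ineq2[of B "P z"] norm_blinfun[of P z]
          by (meson mult_left_mono norm_ge_zero order_trans)
        then have "(\<bar>1 / \<alpha>\<bar> * \<bar>inner B (P z)\<bar>) * norm B \<le> (\<bar>1 / \<alpha>\<bar> * (norm B * (norm P * norm z))) * norm B"
          by (intro mult_right_mono mult_left_mono) auto
        then show ?thesis by (simp add: b_def abs_mult mult_ac)
      qed
      then have "norm (L z) \<le> norm (A z) + b * norm z"
        using norm_triangle_ineq4[of "A z" "((1 / \<alpha>) * inner B (P z)) *\<^sub>R B"]
        by (simp add: L closed_loop_def)
      moreover have "0 \<le> b * norm (A z)" by (simp add: b_def)
      ultimately have "graph_norm L z \<le> (1 + b) * graph_norm A z"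
        by (simp add: graph_norm_def algebra_simps)
      then have "s * graph_norm L z \<le> s * ((1 + b) * graph_norm A z)"
        using J_nonneg K_nonneg by (intro mult_left_mono) (auto simp: s_def)
      then show "weight z \<le> (s * (1 + b)) * graph_norm A z"
        using weight_le_graph[OF z] by (simp add: s_def mult.assoc)
    qed
  qed
  then have sys: "lyapunov_system D A NY B \<alpha> P T R"
    using T[of 2] T unfolding lyapunov_system_def L[symmetric] by (auto simp: Q_def R_def)
  have uniq: "T' k zs = T k zs"
    if sys': "lyapunov_system D A NY B \<alpha> P T' R'" and "k \<ge> 2" "zs \<in> tuples UNIV k" for T' R' k zs
    using \<open>k \<ge> 2\<close> \<open>zs \<in> tuples UNIV k\<close>
  proof (induction k arbitrary: zs rule: less_induct)
    case (less k)
    show ?case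
    proof (cases "k = 2")
      case True
      obtain x y where "zs = [x, y]" using less.prems(2) True by (auto elim: tuples_2E)
      then show ?thesis using sys sys' True by (simp add: lyapunov_system_def)
    next
      case False
      then have k: "k \<ge> 3" using less.prems(1) by simp
      \<comment> \<open>The difference is written as a sum with factor \<open>- 1\<close> to fit the
        closure rules for multilinear maps.\<close>
      let ?\<Delta> = "\<lambda>zs. T' k zs + (- 1) * T k zs"
      have bmf: "T k \<in> bounded_multilinear_forms UNIV norm k" "T' k \<in> bounded_multilinear_forms UNIV norm k"
        using sys sys' k by (auto simp: lyapunov_system_def)
      have "multilinear_on UNIV k ?\<Delta>"
        using bmf by (intro multilinear_on_add multilinear_on_cmult) (auto simp: bounded_multilinear_forms_def)
      moreover have "\<exists>M. \<forall>zs\<in>tuples UNIV k. (\<forall>z\<in>set zs. norm z \<le> 1) \<longrightarrow> \<bar>?\<Delta> zs\<bar> \<le> M"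
      proof -
        obtain M M' where "\<forall>zs\<in>tuples UNIV k. (\<forall>z\<in>set zs. norm z \<le> 1) \<longrightarrow> \<bar>T k zs\<bar> \<le> M"
          "\<forall>zs\<in>tuples UNIV k. (\<forall>z\<in>set zs. norm z \<le> 1) \<longrightarrow> \<bar>T' k zs\<bar> \<le> M'"
          using bmf unfolding bounded_multilinear_forms_def by blast
        then have "\<forall>zs\<in>tuples UNIV k. (\<forall>z\<in>set zs. norm z \<le> 1) \<longrightarrow> \<bar>?\<Delta> zs\<bar> \<le> M' + M"
          by (auto intro!: order_trans[OF abs_triangle_ineq4] add_mono)
        then show ?thesis by blast
      qed
      ultimately have "?\<Delta> \<in> bounded_multilinear_forms UNIV norm k"
        by (simp add: bounded_multilinear_forms_def)
      moreover have "insert_op L k ?\<Delta> ws = 0" if ws: "ws \<in> tuples D k" for ws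
      proof -
        have "insert_op L k (T' k) ws = 1 / (2 * \<alpha>) * rhs_form B NY T' k ws"
          "insert_op L k (T k) ws = 1 / (2 * \<alpha>) * rhs_form B NY T k ws"
          using sys sys' k ws unfolding lyapunov_system_def L by auto
        \<comment> \<open>The right-hand sides agree by the induction hypothesis, so the difference
          solves the homogeneous equation.\<close>
        moreover have "rhs_form B NY T' k ws = rhs_form B NY T k ws"
          using k ws by (intro rhs_form_cong less.IH) (auto simp: tuples_def)
        ultimately show ?thesis by (simp add: insert_op_def sum_subtractf)
      qed
      ultimately have "?\<Delta> zs = 0"
        using k less.prems(2) by (intro lyapunov_unique[of ?\<Delta> k]) auto
      then show ?thesis by simp
    qed
  qed
  have "R' k zs = R k zs"
    if sys': "lyapunov_system D A NY B \<alpha> P T' R'" and k: "k \<ge> 3" and zs: "zs \<in> tuples D k" for T' R' k zs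
  proof -
    have "R' k zs = rhs_form B NY T' k zs" using sys' k zs by (auto simp: lyapunov_system_def)
    also have "\<dots> = R k zs"
      unfolding R_def using k zs uniq[OF sys'] by (intro rhs_form_cong) (auto simp: tuples_def)
    finally show ?thesis .
  qed
  with sys uniq show ?thesis by blast
qed

end

theorem theorem16:
  fixes emb :: "'v::{real_inner,complete_space} \<Rightarrow> 'y::{real_inner,complete_space}"
    and a :: "'v \<Rightarrow> 'v \<Rightarrow> real"
    and \<nu> lam \<alpha> :: real
    and N :: "'v \<Rightarrow> 'y"
    and B :: 'y
    and P :: "'y \<Rightarrow>\<^sub>L 'y"
  defines "D \<equiv> form_dom emb a"
    and "A \<equiv> form_op emb a"
    and "A0 \<equiv> shifted_op lam (form_op emb a)"
    and "NY \<equiv> on_Y emb N"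
  assumes triple: "gelfand_triple emb"
    and form: "bounded_bilinear a"
    and alpha: "\<alpha> > 0"
    and A1: "\<nu> > 0" "\<And>v. a v v \<ge> \<nu> * (norm v)\<^sup>2 - lam * (norm (emb v))\<^sup>2"
    and A2: "bounded_linear N"
      "bounded_into D (graph_norm A) (range emb) (V_norm emb) NY"
      "range emb \<subseteq> adj_dom (range emb) NY"
      "bounded_into (range emb) (V_norm emb) UNIV norm (adj_op (range emb) NY)"
    and A3: "same_normed_space
        (interp_space D (graph_norm (\<lambda>z. - A0 z)) UNIV norm 2 (1/2))
        (interp_norm D (graph_norm (\<lambda>z. - A0 z)) UNIV norm 2 (1/2))
        (range emb) (V_norm emb)"
      "same_normed_space
        (interp_space (adj_dom D A0) (graph_norm (\<lambda>z. - adj_op D A0 z)) UNIV norm 2 (1/2))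
        (interp_norm (adj_dom D A0) (graph_norm (\<lambda>z. - adj_op D A0 z)) UNIV norm 2 (1/2))
        (range emb) (V_norm emb)"
    and A4: "\<exists>(F :: 'y \<Rightarrow>\<^sub>L real) S. generates D (\<lambda>z. A z + F z *\<^sub>R B) S \<and> exp_stable S"
    and riccati: "stabilizing_riccati_solution D A B \<alpha> P"
  shows "\<exists>T R. lyapunov_system D A NY B \<alpha> P T R \<and>
    (\<forall>T' R'. lyapunov_system D A NY B \<alpha> P T' R' \<longrightarrow>
       (\<forall>k\<ge>2. \<forall>zs\<in>tuples UNIV k. T' k zs = T k zs) \<and>
       (\<forall>k\<ge>3. \<forall>zs\<in>tuples D k. R' k zs = R k zs))"
proof -
  have emb: "linear emb" "inj emb" "closure (range emb) = UNIV"
    using triple by (auto simp: gelfand_triple_def bounded_linear.linear)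
  have sym: "\<And>x y. inner (P x) y = inner x (P y)"
    and stable: "\<exists>S. generates D (closed_loop A B \<alpha> P) S \<and> exp_stable S"
    using riccati by (auto simp: stabilizing_riccati_solution_def)
  then obtain S where S: "generates D (closed_loop A B \<alpha> P) S" "exp_stable S" by blast
  have D_range: "D \<subseteq> range emb" by (auto simp: D_def form_dom_def)
  \<comment> \<open>(A3) makes \<open>V\<close> the interpolation space, which cannot leave the
    closure of \<open>D\<close>; as \<open>V\<close> is dense in \<open>Y\<close>, so is
    \<open>D\<close>.\<close>
  have "range emb \<subseteq> closure D"
    using A3(1) interp_space_subset_closure[of D "graph_norm (\<lambda>z. - A0 z)"]
    by (auto simp: same_normed_space_def graph_norm_def)
  then have dense: "closure D = UNIV"
    using closure_minimal[OF _ closed_closure] emb(3) by blast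
  obtain \<kappa> where \<kappa>: "\<And>v. norm (N v) \<le> norm v * \<kappa>" "\<kappa> \<ge> 0"
    using bounded_linear.nonneg_bounded[OF A2(1)] by blast
  \<comment> \<open>\<open>\<bar>lam\<bar>\<close> comes from (A1). The rest is the cost of passing
    from \<open>A\<close> to the closed loop in the energy, a product of two inner products with
    \<open>B\<close> divided by \<alpha>.\<close>
  define b where "b = \<bar>lam\<bar> + 1 / \<alpha> * (norm B * norm P * norm B)"
  have b: "b \<ge> 0" using alpha by (simp add: b_def)
  have bound: "(norm (NY z))\<^sup>2 \<le> \<kappa>\<^sup>2 / \<nu> * b * (norm z)\<^sup>2 - \<kappa>\<^sup>2 / \<nu> * inner (closed_loop A B \<alpha> P z) z"
    if z: "z \<in> D" for z
  proof -
    obtain v where v: "z = emb v" using z D_range by blast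
    then have inv: "inv emb z = v" using emb by simp
    have "inner (A z) z = - a v v"
      using form_op_inner[OF triple form, of z v] z v inv by (simp add: A_def D_def)
    then have "\<nu> * (norm v)\<^sup>2 \<le> lam * (norm z)\<^sup>2 - inner (A z) z"
      using A1(2)[of v] v by simp
    also have "inner (A z) z = inner (closed_loop A B \<alpha> P z) z + 1 / \<alpha> * (inner B (P z) * inner B z)"
      by (simp add: closed_loop_def inner_diff_left)
    also have "lam * (norm z)\<^sup>2 - \<dots> \<le> b * (norm z)\<^sup>2 - inner (closed_loop A B \<alpha> P z) z"
    proof -
      have "\<bar>inner B (P z) * inner B z\<bar> \<le> (norm B * (norm P * norm z)) * (norm B * norm z)"
      proof -
        have "\<bar>inner B (P z)\<bar> \<le> norm B * (norm P * norm z)"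
          using Cauchy_Schwarz_ineq2[of B "P z"] norm_blinfun[of P z]
          by (meson mult_left_mono norm_ge_zero order_trans)
        then show ?thesis
          unfolding abs_mult using Cauchy_Schwarz_ineq2[of B z] by (intro mult_mono) auto
      qed
      then have "- (inner B (P z) * inner B z) \<le> (norm B * norm P * norm B) * (norm z)\<^sup>2"
        by (simp add: power2_eq_square mult_ac)
      then have "1 / \<alpha> * - (inner B (P z) * inner B z) \<le> 1 / \<alpha> * ((norm B * norm P * norm B) * (norm z)\<^sup>2)"
        using alpha by (intro mult_left_mono) auto
      moreover have "lam * (norm z)\<^sup>2 \<le> \<bar>lam\<bar> * (norm z)\<^sup>2" by (intro mult_right_mono) auto
      ultimately show ?thesis by (simp add: b_def algebra_simps)
    qed
    finally have energy: "\<nu> * (norm v)\<^sup>2 \<le> b * (norm z)\<^sup>2 - inner (closed_loop A B \<alpha> P z) z" .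
    have "(norm (NY z))\<^sup>2 \<le> (norm v * \<kappa>)\<^sup>2"
      unfolding NY_def on_Y_def inv using \<kappa>(1) by (intro power_mono) auto
    also have "\<dots> = \<kappa>\<^sup>2 / \<nu> * (\<nu> * (norm v)\<^sup>2)" using A1(1) by (simp add: power_mult_distrib)
    also have "\<dots> \<le> \<kappa>\<^sup>2 / \<nu> * (b * (norm z)\<^sup>2 - inner (closed_loop A B \<alpha> P z) z)"
      using A1(1) by (intro mult_left_mono energy) auto
    finally show ?thesis by (simp add: algebra_simps)
  qed
  have lin: "NY (c *\<^sub>R x + d *\<^sub>R y) = c *\<^sub>R NY x + d *\<^sub>R NY y" if xy: "x \<in> D" "y \<in> D" for x y c d
  proof -
    obtain u v where uv: "x = emb u" "y = emb v" using xy D_range by blast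
    then have "c *\<^sub>R x + d *\<^sub>R y = emb (c *\<^sub>R u + d *\<^sub>R v)"
      by (simp add: linear_add[OF emb(1)] linear_scale[OF emb(1)])
    then have "NY (c *\<^sub>R x + d *\<^sub>R y) = N (c *\<^sub>R u + d *\<^sub>R v)"
      using emb(2) by (simp add: NY_def on_Y_def)
    then show ?thesis
      using uv emb(2) bounded_linear.linear[OF A2(1)]
      by (simp add: NY_def on_Y_def linear_add linear_scale)
  qed
  \<comment> \<open>The constants are those of \<open>bound\<close>: \<open>K\<close> is the squared
    norm bound of \<open>N\<close> divided by \<nu>, and \<open>J\<close> is \<open>K\<close> times
    \<open>b\<close>.\<close>
  interpret stable_flow D "closed_loop A B \<alpha> P" NY S "\<kappa>\<^sup>2 / \<nu> * b" "\<kappa>\<^sup>2 / \<nu>"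
    by unfold_locales (use S dense lin bound b A1(1) in auto)
  show ?thesis using lyapunov_system_exists_unique[OF refl sym] .
qed

end
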